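(* Assume that the Riemann hypothesis and Montgomery's pair correlation conjecture are true. Then for all $T$ sufficiently large we have $$\mu\bigl(I_{+}(0,T)\bigr)\geq 0.32909\,T\qquad\text{and}\qquad \mu\bigl(I_{-}(0,T)\bigr)\geq 0.32909\,T .$$
   Context: $\zeta(s)$ is the Riemann zeta-function, and $\chi(s)$ is the factor in its functional equation $\zeta(s)=\chi(s)\zeta(1-s)$, namely $\chi(s)=2^s\pi^{s-1}\sin(\tfrac12\pi s)\,\Gamma(1-s)$. Hardy's function is $$Z(t)=\zeta(\tfrac12+it)\,\chi(\tfrac12+it)^{-1/2}\qquad(t\in\mathbb R),$$ where $\chi(\tfrac12+it)^{-1/2}$ is the continuous branch in $t\in\mathbb R$ equal to $1$ at $t=0$. (Then $Z$ is real-valued and even on $\mathbb R$ and $|Z(t)|=|\zeta(\tfrac12+it)|$.) $\mu$ denotes Lebesgue measure on $\mathbb R$, and $$I_+(0,T)=\{0<t\leq T: Z(t)>0\},\qquad I_-(0,T)=\{0<t\leq T: Z(t)<0\}.$$ The Riemann hypothesis is the statement that all complex (non-trivial) zeros of $\zeta(s)$ have real part $1/2$. Montgomery's pair correlation conjecture is the following statement. Let $\gamma,\gamma'$ denote ordinates (imaginary parts) of non-trivial zeros of $\zeta(s)$, counted with multiplicity, and let $N(T)=\sum_{0<\gamma\leq T}1$. Then for all fixed real numbers $\alpha<\beta$, as $T\to\infty$, $$\sum_{\substack{0<\gamma,\gamma'\leq T\\ 2\pi\alpha/\log T\,\leq\,\gamma'-\gamma\,\leq\,2\pi\beta/\log T}}1\;\sim\;\left(\int_\alpha^\beta\left[1-\left(\frac{\sin\pi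 u}{\pi u}\right)^2\right]du+\delta(\alpha,\beta)\right)N(T),$$ where $\delta(\alpha,\beta)=1$ if $0\in[\alpha,\beta]$ and $\delta(\alpha,\beta)=0$ otherwise. The sum is over ordered pairs of zeros (with multiplicity), including the pairs in which both members are the same zero. *)

theory Defs
  imports "HOL-Complex_Analysis.Complex_Analysis" "HOL-Library.Complex_Order"
begin

section \<open>The Riemann zeta-function\<close>

text \<open>
  The zeta-function is the analytic continuation of the Dirichlet series to the plane without
  the pole at 1. Functions are total, so the value at the pole is fixed to be 0; it is never used
  below. The theorem \<open>zeta_unique_existence\<close> shows that this description is proper.
\<close>

definition is_zeta :: "(complex \<Rightarrow> complex) \<Rightarrow> bool" where
  "is_zeta f \<longleftrightarrow> f holomorphic_on (- {1}) \<and> f 1 = 0 \<and>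
     (\<forall>s. Re s > 1 \<longrightarrow> (\<lambda>n. of_nat (Suc n) powr (- s)) sums f s)"

definition zeta :: "complex \<Rightarrow> complex" where
  "zeta = (THE f. is_zeta f)"

text \<open>
  For existence, sums of integrals of \<open>b u * (n + u) powr (- s)\<close> over unit intervals are continued
  one strip at a time: subtract the mean of \<open>b\<close> and integrate by parts.
\<close>

definition per_int :: "(real \<Rightarrow> complex) \<Rightarrow> complex \<Rightarrow> nat \<Rightarrow> complex" where
  "per_int b s n = integral {0..1} (\<lambda>u. b u * of_real (real n + 1 + u) powr (- s))"

lemma shifted_nonzero: "0 \<le> u \<Longrightarrow> complex_of_nat n + 1 + complex_of_real u \<noteq> 0"
  by (auto simp: complex_eq_iff)

lemma per_int_continuous:
  fixes b :: "real \<Rightarrow> complex"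
  assumes "continuous_on {0..1} b"
  shows "continuous_on {0..1} (\<lambda>u. b u * of_real (real n + 1 + u) powr (- s))"
  by (intro continuous_intros assms) (auto simp: complex_nonpos_Reals_iff shifted_nonzero)

lemma per_int_parts:
  assumes c: "continuous_on {0..1} c"
    and c': "\<And>u. u \<in> {0<..<1} \<Longrightarrow> (c has_vector_derivative c' u) (at u)"
  shows "((\<lambda>u. c' u * of_real (real n + 1 + u) powr (- s)) has_integral
            c 1 * of_real (real n + 2) powr (- s) - c 0 * of_real (real n + 1) powr (- s)
            + s * per_int c (s + 1) n) {0..1}"
proof -
  let ?g = "\<lambda>u. complex_of_real (real n + 1 + u) powr (- s)"
  let ?g' = "\<lambda>u. - s * complex_of_real (real n + 1 + u) powr (- (s + 1))"
  have "((\<lambda>u. c' u * ?g u) has_integral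
      (c 1 * ?g 1 - c 0 * ?g 0 + s * per_int c (s + 1) n)) {0..1}"
  proof (rule integration_by_parts_interior[OF bounded_bilinear_mult,
        where f = c and f' = c' and g = ?g and g' = ?g'])
    show "continuous_on {0..1} ?g"
      by (intro continuous_intros) (auto simp: complex_nonpos_Reals_iff shifted_nonzero)
    show "(?g has_vector_derivative ?g' u) (at u)" if "u \<in> {0<..<1}" for u
    proof -
      have "((\<lambda>z. (of_real (real n + 1) + z) powr (- s)) has_field_derivative
              - s * (of_real (real n + 1) + of_real u) powr (- s - 1)) (at (complex_of_real u))"
        using that by (auto intro!: derivative_eq_intros simp: complex_nonpos_Reals_iff)
      from has_vector_derivative_real_field[OF this, of UNIV] show ?thesis
        by simp
    qed
    have "((\<lambda>u. c u * of_real (real n + 1 + u) powr (- (s + 1))) has_integral per_int c (s + 1) n) {0..1}"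
      unfolding per_int_def
      by (intro integrable_integral integrable_continuous_interval per_int_continuous c)
    from has_integral_mult_right[OF this, of "- s"]
    show "((\<lambda>u. c u * ?g' u) has_integral
       (c 1 * ?g 1 - c 0 * ?g 0 - (c 1 * ?g 1 - c 0 * ?g 0 + s * per_int c (s + 1) n))) {0..1}"
      by (simp add: algebra_simps)
  qed (use c c' in auto)
  thus ?thesis by (simp add: algebra_simps)
qed

lemma per_int_holomorphic:
  assumes b: "continuous_on {0..1} b"
  shows "(\<lambda>s. per_int b s n) holomorphic_on UNIV"
proof -
  have "(\<lambda>s. integral (cbox 0 1) (\<lambda>u. b u * of_real (real n + 1 + u) powr (- s))) holomorphic_on UNIV"
  proof (rule leibniz_rule_holomorphic[where fx = "\<lambda>s u. - b u * of_real (real n + 1 + u) powr (- s) * Ln (of_real (real n + 1 + u))"])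
    fix s :: complex and u :: real assume u: "u \<in> cbox 0 1"
    hence nz: "complex_of_real (real n + 1 + u) \<noteq> 0"
      by (simp only: of_real_eq_0_iff) auto
    show "((\<lambda>s. b u * of_real (real n + 1 + u) powr (- s)) has_field_derivative
      - b u * of_real (real n + 1 + u) powr (- s) * Ln (of_real (real n + 1 + u))) (at s within UNIV)"
      using nz by (auto intro!: derivative_eq_intros has_field_derivative_powr_right[THEN DERIV_chain2] simp del: of_real_add)
  next
    fix s :: complex
    show "(\<lambda>u. b u * of_real (real n + 1 + u) powr (- s)) integrable_on cbox 0 1"
      using integrable_continuous_interval[OF per_int_continuous[OF b, of n s]] by simp
  next
    have bb: "continuous_on (UNIV \<times> cbox 0 1) (\<lambda>x :: complex \<times> real. b (snd x))"
      by (rule continuous_on_compose2[OF b]) (auto intro: continuous_intros)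
    show "continuous_on (UNIV \<times> cbox 0 1) (\<lambda>(s, u). - b u * of_real (real n + 1 + u) powr (- s) *
        Ln (complex_of_real (real n + 1 + u)))"
      unfolding case_prod_unfold
      by (intro continuous_intros bb) (auto simp: complex_nonpos_Reals_iff shifted_nonzero)
  qed auto
  thus ?thesis by (simp add: per_int_def[abs_def])
qed

lemma per_int_bound:
  assumes b: "continuous_on {0..1} b" and B: "\<And>u. u \<in> {0..1} \<Longrightarrow> norm (b u) \<le> B"
    and s: "a \<le> Re s" "0 \<le> a"
  shows "norm (per_int b s n) \<le> B * real (Suc n) powr (- a)"
proof -
  have B0: "B \<ge> 0" using order_trans[OF norm_ge_zero B[of 0]] by simp
  have "norm (per_int b s n) \<le> B * real (Suc n) powr (- a) * (1 - 0)"
    unfolding per_int_def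
  proof (rule integral_bound)
    fix u :: real assume u: "u \<in> {0..1}"
    have "norm (complex_of_real (real n + 1 + u) powr (- s)) = (real n + 1 + u) powr (- Re s)"
      using u by (subst norm_powr_real_powr) auto
    also have "\<dots> \<le> (real n + 1 + u) powr (- a)"
      using u s by (intro powr_mono) auto
    also have "\<dots> \<le> real (Suc n) powr (- a)"
      using u s by (intro powr_mono2') auto
    finally show "norm (b u * of_real (real n + 1 + u) powr (- s)) \<le> B * real (Suc n) powr (- a)"
      unfolding norm_mult using B[OF u] B0 by (intro mult_mono) auto
  qed (use per_int_continuous[OF b] in auto)
  thus ?thesis by simp
qed

lemma per_int_sum_holomorphic:
  assumes b: "continuous_on {0..1} b"
  shows "\<exists>f. f holomorphic_on {s. Re s > 1} \<and> (\<forall>s. Re s > 1 \<longrightarrow> per_int b s sums f s)"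
proof -
  have "compact (b ` {0..1})" using b by (intro compact_continuous_image) auto
  then obtain B where B: "\<And>u. u \<in> {0..1} \<Longrightarrow> norm (b u) \<le> B"
    by (metis bounded_iff compact_imp_bounded image_eqI)
  define f where "f = (\<lambda>s. \<Sum>n. per_int b s n)"
  have summ: "summable (\<lambda>n. B * real (Suc n) powr (- a))" if "a > 1" for a
    using that by (intro summable_mult) (subst summable_Suc_iff[of "\<lambda>n. real n powr (- a)"], simp add: summable_real_powr_iff)
  have 1: "per_int b s sums f s" if "Re s > 1" for s
    unfolding f_def
    by (rule summable_sums, rule summable_comparison_test[OF _ summ[OF that]])
       (use per_int_bound[OF b B, of "Re s" s] that in auto)
  have "f holomorphic_on {s. Re s > 1}"
  proof (rule holomorphic_uniform_sequence[where f = "\<lambda>n s. \<Sum>k<n. per_int b s k"])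
    show "open {s. Re s > 1}" by (rule open_halfspace_Re_gt)
    show "(\<lambda>s. \<Sum>k<n. per_int b s k) holomorphic_on {s. Re s > 1}" for n
      by (intro holomorphic_intros holomorphic_on_subset[OF per_int_holomorphic[OF b]]) auto
    fix z :: complex assume z: "z \<in> {s. Re s > 1}"
    define d where "d = (Re z - 1) / 2"
    have d: "d > 0" using z by (simp add: d_def)
    have re: "Re w \<ge> 1 + d" if "w \<in> cball z d" for w
      using that abs_Re_le_cmod[of "z - w"] unfolding d_def by (auto simp: dist_norm field_simps)
    have "uniform_limit (cball z d) (\<lambda>n s. \<Sum>k<n. per_int b s k) (\<lambda>s. \<Sum>k. per_int b s k) sequentially"
      by (rule Weierstrass_m_test[OF _ summ[of "1 + d"]])
         (use d per_int_bound[OF b B re] in auto)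
    thus "\<exists>d>0. cball z d \<subseteq> {s. Re s > 1} \<and>
        uniform_limit (cball z d) (\<lambda>n s. \<Sum>k<n. per_int b s k) f sequentially"
      unfolding f_def using d re by (intro exI[of _ d]) force
  qed
  with 1 show ?thesis by blast
qed

lemma powr_telescope:
  fixes s :: complex
  assumes s: "Re s > 1"
  shows "(\<lambda>n. of_real (real n + 1) powr (1 - s) - of_real (real n + 2) powr (1 - s)) sums (1 :: complex)"
proof -
  have "(\<lambda>n. complex_of_real (real n + 1) powr (1 - s)) \<longlonglongrightarrow> 0"
    using s by (intro tendsto_neg_powr_complex_of_real) (auto, real_asymp)
  from telescope_sums'[OF this] show ?thesis by (simp add: algebra_simps)
qed

lemma per_int_continuation:
  assumes b: "continuous_on {0..1} b"
  shows "\<exists>g. g holomorphic_on {s. Re s > 1 - real m} \<and>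
           (\<forall>s. Re s > 1 \<longrightarrow> per_int b s sums (g s / (s - 1)))"
  using b
proof (induction m arbitrary: b)
  case 0
  from per_int_sum_holomorphic[OF 0] obtain f where
    f: "f holomorphic_on {s. Re s > 1}" "\<And>s. Re s > 1 \<Longrightarrow> per_int b s sums f s" by blast
  have "per_int b s sums ((s - 1) * f s / (s - 1))" if "Re s > 1" for s
    using f(2)[OF that] that by (cases "s = 1") auto
  thus ?case using f(1) by (intro exI[of _ "\<lambda>s. (s - 1) * f s"]) (auto intro!: holomorphic_intros)
next
  case (Suc m)
  define B where "B = integral {0..1} b"
  define c where "c = (\<lambda>u. integral {0..u} (\<lambda>x. b x - B))"
  have bB: "continuous_on {0..1} (\<lambda>x. b x - B)" using Suc.prems by (intro continuous_intros)
  have c: "continuous_on {0..1} c" unfolding c_def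
    by (intro indefinite_integral_continuous_1 integrable_continuous_interval bB)
  have c': "(c has_vector_derivative (b u - B)) (at u)" if "u \<in> {0<..<1}" for u
    using integral_has_vector_derivative[OF bB, of u] that
    unfolding c_def by (simp add: at_within_Icc_at)
  have "b integrable_on {0..1}" using Suc.prems by (rule integrable_continuous_interval)
  hence c1: "c 1 = 0" unfolding c_def B_def by (subst integral_diff) auto
  have c0: "c 0 = 0" unfolding c_def by simp
  from Suc.IH[OF c] obtain g where
    g: "g holomorphic_on {s. Re s > 1 - real m}" "\<And>s. Re s > 1 \<Longrightarrow> per_int c s sums (g s / (s - 1))"
    by blast
  have "per_int b s sums ((B + (s - 1) * g (s + 1)) / (s - 1))" if s: "Re s > 1" for s
  proof -
    have s0: "s \<noteq> 0" "s \<noteq> 1" using s by auto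
    have eq: "per_int b s n = B / (s - 1) * (of_real (real n + 1) powr (1 - s) - of_real (real n + 2) powr (1 - s))
               + s * per_int c (s + 1) n" for n
    proof -
      have 1: "((\<lambda>u. (b u - B) * of_real (real n + 1 + u) powr (- s)) has_integral
                 s * per_int c (s + 1) n) {0..1}"
        using per_int_parts[OF c c', of n s] by (simp add: c0 c1)
      have "((\<lambda>u. complex_of_real (real n + 1 + u) powr (- s)) has_integral
              of_real (real n + 1 + 1) powr (1 - s) / (1 - s) - of_real (real n + 1 + 0) powr (1 - s) / (1 - s)) {0..1}"
      proof (rule fundamental_theorem_of_calculus)
        fix u :: real assume u: "u \<in> {0..1}"
        have "((\<lambda>z. (of_real (real n + 1) + z) powr (1 - s)) has_field_derivative
                (1 - s) * (of_real (real n + 1) + of_real u) powr (- s)) (at (complex_of_real u))"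
          using u by (auto intro!: derivative_eq_intros simp: complex_nonpos_Reals_iff)
        from DERIV_cdivide[OF this, of "1 - s"]
        have "((\<lambda>z. (of_real (real n + 1) + z) powr (1 - s) / (1 - s)) has_field_derivative
                (of_real (real n + 1) + of_real u) powr (- s)) (at (complex_of_real u))"
          using s0 by (subst (asm) nonzero_mult_div_cancel_left) auto
        from has_vector_derivative_real_field[OF this, of "{0..1}"]
        show "((\<lambda>u. complex_of_real (real n + 1 + u) powr (1 - s) / (1 - s)) has_vector_derivative
            of_real (real n + 1 + u) powr (- s)) (at u within {0..1})"
          by simp
      qed auto
      from has_integral_add[OF 1 has_integral_mult_right[OF this, of B]]
      have "per_int b s n = s * per_int c (s + 1) n + B * (of_real (real n + 1 + 1) powr (1 - s) / (1 - s)
            - of_real (real n + 1 + 0) powr (1 - s) / (1 - s))"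
        unfolding per_int_def[of b] distrib_right[symmetric] diff_add_cancel by (rule integral_unique)
      also have "real n + 1 + 1 = real n + 2" by simp
      also have "real n + 1 + 0 = real n + 1" by simp
      also have "B * (y / (1 - s) - x / (1 - s)) = B / (s - 1) * (x - y)" for x y
      proof -
        have "y / (1 - s) - x / (1 - s) = (x - y) / (s - 1)"
          by (metis diff_divide_distrib minus_diff_eq minus_divide_divide)
        thus ?thesis by simp
      qed
      finally show ?thesis by (subst add.commute)
    qed
    have "(\<lambda>n. B / (s - 1) * (of_real (real n + 1) powr (1 - s) - of_real (real n + 2) powr (1 - s))
               + s * per_int c (s + 1) n) sums (B / (s - 1) * 1 + s * (g (s + 1) / (s + 1 - 1)))"
      using s by (intro sums_add sums_mult powr_telescope g(2)) auto
    thus ?thesis unfolding eq[symmetric] using s0 by (simp add: add_divide_distrib)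
  qed
  moreover have "(\<lambda>s. B + (s - 1) * g (s + 1)) holomorphic_on {s. Re s > 1 - real (Suc m)}"
    by (intro holomorphic_intros holomorphic_on_compose_gen[OF _ g(1), unfolded o_def]) auto
  ultimately show ?case by blast
qed

lemma zeta_half_plane:
  "\<exists>h. h holomorphic_on ({s. Re s > - real m} - {1}) \<and>
     (\<forall>s. Re s > 1 \<longrightarrow> (\<lambda>n. of_nat (Suc n) powr (- s)) sums h s)"
proof -
  define c where "c = (\<lambda>u. complex_of_real (1 - u))"
  have c: "continuous_on {0..1} c" unfolding c_def by (intro continuous_intros)
  have c': "(c has_vector_derivative (- 1)) (at u)" for u
    unfolding c_def by (auto intro!: derivative_eq_intros)
  have one: "continuous_on {0..1} (\<lambda>_. 1 :: complex)" by simp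
  from per_int_continuation[OF c, of m] obtain g where
    g: "g holomorphic_on {s. Re s > 1 - real m}" "\<And>s. Re s > 1 \<Longrightarrow> per_int c s sums (g s / (s - 1))"
    by blast
  from per_int_continuation[OF one, of "Suc m"] obtain k where
    k: "k holomorphic_on {s. Re s > 1 - real (Suc m)}"
       "\<And>s. Re s > 1 \<Longrightarrow> per_int (\<lambda>_. 1) s sums (k s / (s - 1))"
    by blast
  have "(\<lambda>n. of_nat (Suc n) powr (- s)) sums (k s / (s - 1) + g (s + 1))" if s: "Re s > 1" for s
  proof -
    have s0: "s \<noteq> 0" using s by auto
    have eq: "of_nat (Suc n) powr (- s) = per_int (\<lambda>_. 1) s n + s * per_int c (s + 1) n" for n
    proof -
      have "((\<lambda>u. - 1 * complex_of_real (real n + 1 + u) powr (- s)) has_integral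
          - (of_real (real n + 1) powr (- s)) + s * per_int c (s + 1) n) {0..1}"
        using per_int_parts[OF c c', of n s] by (simp add: c_def)
      from has_integral_neg[OF this]
      have "per_int (\<lambda>_. 1) s n = of_real (real n + 1) powr (- s) - s * per_int c (s + 1) n"
        unfolding per_int_def[of "\<lambda>_. 1"] by (intro integral_unique) simp
      thus ?thesis by (simp add: add.commute)
    qed
    have "(\<lambda>n. per_int (\<lambda>_. 1) s n + s * per_int c (s + 1) n) sums
            (k s / (s - 1) + s * (g (s + 1) / (s + 1 - 1)))"
      using s by (intro sums_add sums_mult g(2) k(2)) auto
    thus ?thesis unfolding eq[symmetric] using s0 by simp
  qed
  moreover have "(\<lambda>s. k s / (s - 1) + g (s + 1)) holomorphic_on ({s. Re s > - real m} - {1})"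
    by (intro holomorphic_intros holomorphic_on_compose_gen[OF _ g(1), unfolded o_def]
          holomorphic_on_subset[OF k(1)]) auto
  ultimately show ?thesis by blast
qed

lemma zeta_agree:
  assumes "f holomorphic_on ({s. Re s > a} - {1})" "g holomorphic_on ({s. Re s > a} - {1})"
    and "\<And>s. Re s > 1 \<Longrightarrow> (\<lambda>n. of_nat (Suc n) powr (- s)) sums f s"
    and "\<And>s. Re s > 1 \<Longrightarrow> (\<lambda>n. of_nat (Suc n) powr (- s)) sums g s"
    and "Re z > a" "z \<noteq> 1"
  shows "f z = g z"
proof (cases "a < 1")
  case False
  hence "Re z > 1" using assms(5) by simp
  thus ?thesis using sums_unique2[OF assms(3,4)] by blast
next
  case True
  show ?thesis
  proof (rule analytic_continuation_open[where f = f and g = g and s = "{s. Re s > 1}" and s' = "{s. Re s > a} - {1}"])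
    show "open {s. Re s > 1}" by (rule open_halfspace_Re_gt)
    show "open ({s. Re s > a} - {1})" by (intro open_Diff open_halfspace_Re_gt) auto
    show "connected ({s. Re s > a} - {1 :: complex})"
      by (rule connected_open_delete) (auto simp: open_halfspace_Re_gt convex_halfspace_Re_gt intro: convex_connected)
    have "2 \<in> {s. Re s > 1}" by simp
    thus "{s. Re s > 1} \<noteq> {}" by blast
    show "f s = g s" if "s \<in> {s. Re s > 1}" for s
      using that assms(3,4)[of s] sums_unique2 by auto
  qed (use assms True in auto)
qed

theorem zeta_unique_existence: "\<exists>!f. is_zeta f"
proof (rule ex_ex1I)
  have "\<forall>m. \<exists>h. h holomorphic_on ({s. Re s > - real m} - {1}) \<and>
     (\<forall>s. Re s > 1 \<longrightarrow> (\<lambda>n. of_nat (Suc n) powr (- s)) sums h s)"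
    using zeta_half_plane by blast
  then obtain h where
    h: "\<And>m. h m holomorphic_on ({s. Re s > - real m} - {1})"
       "\<And>m s. Re s > 1 \<Longrightarrow> (\<lambda>n. of_nat (Suc n) powr (- s)) sums h m s" by metis
  define f where "f = (\<lambda>s :: complex. if s = 1 then 0 else h (nat \<lceil>1 - Re s\<rceil>) s)"
  have f_eq: "f s = h m s" if s: "Re s > - real m" "s \<noteq> 1" for m s
  proof -
    define k where "k = nat \<lceil>1 - Re s\<rceil>"
    have k: "Re s > - real k" unfolding k_def by linarith
    define a where "a = max (- real k) (- real m)"
    have "h k s = h m s"
    proof (rule zeta_agree[where a = a and f = "h k" and g = "h m"])
      show "h k holomorphic_on {s. Re s > a} - {1}" "h m holomorphic_on {s. Re s > a} - {1}"
        by (rule holomorphic_on_subset[OF h(1)]; force simp: a_def)+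
    qed (use h(2) k s in \<open>auto simp: a_def\<close>)
    thus ?thesis using s by (simp add: f_def k_def)
  qed
  have "f holomorphic_on - {1}"
  proof -
    have "f holomorphic_on (\<Union>m. {s. Re s > - real m} - {1})"
    proof (rule holomorphic_on_UN_open)
      show "f holomorphic_on {s. Re s > - real m} - {1}" for m
        using h(1)[of m] by (rule holomorphic_transform) (auto simp: f_eq)
      show "open ({s. Re s > - real m} - {1})" for m
        by (intro open_Diff open_halfspace_Re_gt) auto
    qed
    moreover have "- {1} \<subseteq> (\<Union>m. {s :: complex. Re s > - real m} - {1})"
    proof
      fix s :: complex assume "s \<in> - {1}"
      moreover obtain m where "- Re s < real m" using reals_Archimedean2 by blast
      ultimately show "s \<in> (\<Union>m. {s. Re s > - real m} - {1})" by (auto intro!: exI[of _ m])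
    qed
    ultimately show ?thesis by (rule holomorphic_on_subset)
  qed
  moreover have "(\<lambda>n. of_nat (Suc n) powr (- s)) sums f s" if "Re s > 1" for s
  proof -
    have "s \<noteq> 1" using that by auto
    thus ?thesis using h(2)[OF that, of 0] f_eq[of 0 s] that by simp
  qed
  ultimately show "\<exists>f. is_zeta f" unfolding is_zeta_def by (intro exI[of _ f]) (auto simp: f_def)
next
  fix f g assume f: "is_zeta f" and g: "is_zeta g"
  show "f = g"
  proof
    fix z
    show "f z = g z"
    proof (cases "z = 1")
      case True
      thus ?thesis using f g by (simp add: is_zeta_def)
    next
      case False
      thus ?thesis using f g unfolding is_zeta_def
        by (intro zeta_agree[where a = "Re z - 1" and f = f and g = g]) (auto intro: holomorphic_on_subset)
    qed
  qed
qed

corollary is_zeta_zeta: "is_zeta zeta"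
  unfolding zeta_def by (rule theI'[OF zeta_unique_existence])


section \<open>Hardy's function\<close>

definition chi :: "complex \<Rightarrow> complex" where
  "chi s = 2 powr s * of_real pi powr (s - 1) * sin (1/2 * of_real pi * s) * Gamma (1 - s)"

text \<open>
  The continuous branch of \<open>chi (1/2 + \<i>t) powr (-1/2)\<close> in the real variable \<open>t\<close> with value 1
  at 0; the principal power of \<^typ>\<open>complex\<close> would jump.
\<close>

definition is_chi_branch :: "(real \<Rightarrow> complex) \<Rightarrow> bool" where
  "is_chi_branch g \<longleftrightarrow> continuous_on UNIV g \<and> g 0 = 1 \<and>
     (\<forall>t. g t ^ 2 = inverse (chi (1/2 + \<i> * of_real t)))"

definition chi_inv_sqrt :: "real \<Rightarrow> complex" where
  "chi_inv_sqrt = (THE g. is_chi_branch g)"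

lemma chi_nonzero: "chi (1/2 + \<i> * of_real t) \<noteq> 0"
proof -
  have "sin (1/2 * complex_of_real pi * (1/2 + \<i> * of_real t)) \<noteq> 0"
  proof
    assume "sin (1/2 * complex_of_real pi * (1/2 + \<i> * of_real t)) = 0"
    then obtain n :: int where n: "1/2 * complex_of_real pi * (1/2 + \<i> * of_real t) = of_real (n * pi)"
      by (auto simp: Complex_Transcendental.sin_eq_0)
    from arg_cong[OF n, of Re] have "real_of_int (4 * n) = real_of_int 1" by simp
    hence "4 * n = 1" by (simp only: of_int_eq_iff)
    thus False by presburger
  qed
  moreover have "Gamma (1 - (1/2 + \<i> * complex_of_real t)) \<noteq> 0"
    by (subst Gamma_eq_zero_iff) (auto elim!: nonpos_Ints_cases simp: complex_eq_iff)
  ultimately show ?thesis by (simp add: chi_def)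
qed

lemma chi_half: "chi (1/2) = 1"
proof -
  have 1: "(2::complex) powr (1/2) = of_real (sqrt 2)"
    using powr_of_real[of 2 "1/2"] by (simp add: powr_half_sqrt)
  have "complex_of_real pi powr of_real (- (1/2)) = of_real (pi powr (- (1/2)))"
    by (rule powr_of_real) auto
  moreover have "complex_of_real (- (1/2)) = 1/2 - 1" by simp
  moreover have "pi powr (- (1/2)) = 1 / sqrt pi"
    unfolding powr_minus_divide by (subst powr_half_sqrt) auto
  ultimately have 2: "complex_of_real pi powr (1/2 - 1) = of_real (1 / sqrt pi)"
    by simp
  have 3: "sin (1/2 * complex_of_real pi * (1/2)) = of_real (sqrt 2 / 2)"
    using sin_of_real[of "pi / 4", where 'a = complex] by (simp add: sin_45)
  have 4: "Gamma (1 - 1/2 :: complex) = of_real (sqrt pi)"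
    using Gamma_one_half_complex by simp
  have "sqrt 2 * (1 / sqrt pi) * (sqrt 2 / 2) * sqrt pi = 1"
    by simp
  thus ?thesis unfolding chi_def 1 2 3 4 of_real_mult[symmetric] of_real_eq_1_iff .
qed

theorem chi_branch_unique_existence: "\<exists>!g. is_chi_branch g"
proof (rule ex_ex1I)
  let ?c = "\<lambda>t. inverse (chi (1/2 + \<i> * complex_of_real t))"
  have pole: "1 - (1/2 + \<i> * complex_of_real t) \<notin> \<int>\<^sub>\<le>\<^sub>0" for t
    by (auto elim!: nonpos_Ints_cases simp: complex_eq_iff)
  have "continuous_on UNIV (\<lambda>t. chi (1/2 + \<i> * complex_of_real t))"
  proof -
    have "continuous_on UNIV (\<lambda>t. Gamma (1 - (1/2 + \<i> * complex_of_real t)))"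
      by (rule continuous_on_compose2[OF continuous_on_Gamma[of "- \<int>\<^sub>\<le>\<^sub>0"]])
         (use pole in \<open>auto intro!: continuous_intros\<close>)
    thus ?thesis unfolding chi_def
      by (intro continuous_on_mult continuous_on_powr_complex continuous_on_sin
            continuous_on_add continuous_on_diff continuous_on_const continuous_on_of_real
            continuous_on_id) auto
  qed
  hence "continuous_on UNIV ?c" using chi_nonzero by (intro continuous_on_inverse) auto
  then obtain g where g: "continuous_on UNIV g" "\<And>t. ?c t = g t ^ 2"
  proof (rule continuous_sqrt_on_contractible)
    show "contractible (UNIV :: real set)" by simp
    show "?c t \<noteq> 0" for t using chi_nonzero by simp
  qed auto
  have g0: "g 0 ^ 2 = 1" using g(2)[of 0] chi_half by simp
  have "is_chi_branch (\<lambda>t. g t * g 0)"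
    unfolding is_chi_branch_def
  proof (intro conjI allI)
    show "continuous_on UNIV (\<lambda>t. g t * g 0)" by (intro continuous_intros g(1))
    show "g 0 * g 0 = 1" using g0 by (simp add: power2_eq_square)
    show "(g t * g 0)\<^sup>2 = ?c t" for t unfolding power_mult_distrib g0 g(2) by simp
  qed
  thus "\<exists>g. is_chi_branch g" by blast
next
  fix f g assume f: "is_chi_branch f" and g: "is_chi_branch g"
  have gsq: "g t ^ 2 \<noteq> 0" for t
    using g chi_nonzero[of t] by (simp add: is_chi_branch_def)
  hence gnz: "g t \<noteq> 0" for t by fastforce
  have "f t ^ 2 = g t ^ 2" for t
    using f g by (simp add: is_chi_branch_def)
  hence sq: "(f t / g t) ^ 2 = 1" for t
    using gsq[of t] by (simp add: power_divide)
  have "(\<lambda>t. f t / g t) constant_on UNIV"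
  proof (rule continuous_finite_range_constant)
    show "continuous_on UNIV (\<lambda>t. f t / g t)"
      using f g gnz unfolding is_chi_branch_def by (intro continuous_on_divide) auto
    have "range (\<lambda>t. f t / g t) \<subseteq> {1, -1}"
      using sq by (auto simp only: power2_eq_1_iff image_subset_iff insert_iff)
    thus "finite (range (\<lambda>t. f t / g t))" by (rule finite_subset) auto
  qed auto
  then obtain k where k: "\<And>t. f t / g t = k" by (auto simp: constant_on_def)
  have "k = 1" using k[of 0] f g by (simp add: is_chi_branch_def)
  show "f = g"
  proof
    fix t show "f t = g t" using k[of t] gnz[of t] \<open>k = 1\<close> by simp
  qed
qed

corollary is_chi_branch_chi_inv_sqrt: "is_chi_branch chi_inv_sqrt"
  unfolding chi_inv_sqrt_def by (rule theI'[OF chi_branch_unique_existence])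

definition Hardy_Z :: "real \<Rightarrow> complex" where
  "Hardy_Z t = zeta (1/2 + \<i> * of_real t) * chi_inv_sqrt t"

text \<open>
  In the order on \<^typ>\<open>complex\<close> used here, \<open>z > 0\<close> means that \<open>z\<close> is a positive real number, and
  \<open>z < 0\<close> that it is a negative one.
\<close>

definition I_plus :: "real \<Rightarrow> real set" where
  "I_plus T = {t. 0 < t \<and> t \<le> T \<and> Hardy_Z t > 0}"

definition I_minus :: "real \<Rightarrow> real set" where
  "I_minus T = {t. 0 < t \<and> t \<le> T \<and> Hardy_Z t < 0}"


section \<open>Zeros and pair correlation\<close>

text \<open>The trivial zeros are the negative even integers; 1 is the pole.\<close>

definition nontrivial_zeros :: "complex set" where
  "nontrivial_zeros =
     {s. s \<noteq> 1 \<and> zeta s = 0 \<and> \<not> (\<exists>n::nat. n > 0 \<and> s = - of_nat (2 * n))}"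

definition Riemann_hypothesis :: bool where
  "Riemann_hypothesis \<longleftrightarrow> (\<forall>\<rho>\<in>nontrivial_zeros. Re \<rho> = 1/2)"

definition zeros_upto :: "real \<Rightarrow> complex set" where
  "zeros_upto T = {\<rho> \<in> nontrivial_zeros. 0 < Im \<rho> \<and> Im \<rho> \<le> T}"

definition zero_mult :: "complex \<Rightarrow> nat" where
  "zero_mult \<rho> = nat (zorder zeta \<rho>)"

definition zero_count :: "real \<Rightarrow> nat" where
  "zero_count T = (\<Sum>\<rho>\<in>zeros_upto T. zero_mult \<rho>)"

text \<open>
  Ordered pairs of zeros listed with multiplicity: two points \<open>\<rho>\<close>, \<open>\<rho>'\<close> of multiplicities \<open>m\<close>, \<open>m'\<close>
  give \<open>m * m'\<close> pairs, also when \<open>\<rho> = \<rho>'\<close>.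
\<close>

definition pair_count :: "real \<Rightarrow> real \<Rightarrow> real \<Rightarrow> nat" where
  "pair_count \<alpha> \<beta> T =
     (\<Sum>(\<rho>, \<rho>') \<in> {(\<rho>, \<rho>') \<in> zeros_upto T \<times> zeros_upto T.
          2 * pi * \<alpha> / ln T \<le> Im \<rho>' - Im \<rho> \<and> Im \<rho>' - Im \<rho> \<le> 2 * pi * \<beta> / ln T}.
        zero_mult \<rho> * zero_mult \<rho>')"

text \<open>The value of the integrand at the single point \<open>u = 0\<close> (where \<open>0 / 0 = 0\<close>) is immaterial.\<close>

definition pair_density :: "real \<Rightarrow> real \<Rightarrow> real" where
  "pair_density \<alpha> \<beta> =
     integral {\<alpha>..\<beta>} (\<lambda>u. 1 - (sin (pi * u) / (pi * u))\<^sup>2) + (if 0 \<in> {\<alpha>..\<beta>} then 1 else 0)"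

definition pair_correlation_conjecture :: bool where
  "pair_correlation_conjecture \<longleftrightarrow>
     (\<forall>\<alpha> \<beta>. \<alpha> < \<beta> \<longrightarrow>
        (\<lambda>T. real (pair_count \<alpha> \<beta> T)) \<sim>[at_top] (\<lambda>T. pair_density \<alpha> \<beta> * real (zero_count T)))"

end

theory Submission
  imports Defs "HOL-Real_Asymp.Real_Asymp"
begin

text \<open>
  Under the Riemann hypothesis the zeros of Hardy's function in \<open>(0, T]\<close> are the
  ordinates of the zeros of zeta, so the function keeps one sign on each gap between consecutive
  ordinates and changes it at every simple zero. Write \<open>N\<close> for the number of zeros up
  to \<open>T\<close> and \<open>G \<lambda>\<close> for the integral of \<open>1 - (sin (\<pi> u) /
  (\<pi> u))\<^sup>2\<close> over \<open>{0..\<lambda>}\<close> (\<open>pair_int\<close> below).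
  Pair correlation is used twice. The pairs with \<open>0 \<le> \<gamma>' - \<gamma> \<le> 2 \<pi>
  \<lambda> / log T\<close> number about \<open>(G \<lambda> + 1) N\<close>. Since the diagonal
  contributes the sum of the squared multiplicities, letting \<open>\<lambda>\<close> be small shows
  that almost all zeros are simple; as each simple zero is an endpoint of one gap on which the
  function is positive, and a gap has two endpoints, about \<open>N / 2\<close> gaps at least are
  positive. Since the diagonal also contributes at least \<open>N\<close>, and every gap is itself a
  pair of zeros, at most about \<open>G \<lambda> N\<close> gaps are as short as \<open>2 \<pi>
  \<lambda> / log T\<close>. The positive gaps have the least total length if they are the shortest
  ones that these bounds allow. Hence, for every \<open>\<Lambda>\<close>, their total length is at
  least about \<open>2 \<pi> N / log T\<close> times the integral of \<open>1/2 - G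
  \<lambda>\<close> over \<open>{0..\<Lambda>}\<close> (\<open>sign_set_measure\<close>,
  \<open>sign_measure_pair_count\<close>). The negative gaps are treated in the same way. The best
  \<open>\<Lambda>\<close> solves \<open>G \<Lambda> = 1/2\<close>; the value \<open>\<Lambda> = 3 /
  \<pi>\<close> is close to it, makes the relevant power series rational, and gives 0.3290932...
  (\<open>constant_lower_bound\<close>).

  What remains is the factor \<open>2 \<pi> N / log T\<close>: pair correlation only compares the
  pairs with \<open>N\<close>, so the size of \<open>N\<close> has to come from the theory of zeta.
  It suffices that \<open>N\<close> is at least \<open>(1 - o(1)) T log T / (2 \<pi>)\<close>
  (\<open>zero_count_lower_bound\<close>). This is one half of the Riemann-von Mangoldt formula and
  follows from the argument principle on the rectangle with real parts in \<open>{-1..2}\<close>: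
  the left side contributes the main term through the functional equation, and the right side
  \<open>O(T)\<close>. The upper side is \<open>O(T)\<close> as well if it keeps away from the
  zeros: right of the critical line the logarithmic derivative near height \<open>T\<close> is, up
  to \<open>O(log T)\<close>, a sum of \<open>O(log T)\<close> terms \<open>1 / (s - \<rho>)\<close>
  (\<open>Landau_local\<close>), and the functional equation reflects this bound to the left part.

  The functional equation is needed for the real values of Hardy's function, too. On \<open>(-1,
  0)\<close> it results from computing the Mellin transform of \<open>coth (x / 2) / 2 - 1 /
  x\<close> in two ways: by partial fractions the transform is a multiple of the Dirichlet series of
  \<open>zeta (1 - s)\<close>, and expanded in powers of \<open>exp (-x)\<close> it is \<open>Gamma
  s\<close> times the series of trapezoidal errors that continues \<open>zeta s\<close>. All terms
  are positive, so only Tonelli's theorem is involved.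
\<close>

section \<open>Zeta to the left of its half-plane of convergence\<close>

text \<open>
  The Peano kernel of the trapezoidal rule, with negative sign: it vanishes at both ends and has
  second derivative 1, so two integrations by parts against it leave the error of the rule.
\<close>

definition trapezoid_kernel :: "real \<Rightarrow> complex" where "trapezoid_kernel u = of_real ((u\<^sup>2 - u) / 2)"

lemma trapezoid_kernel_cont: "continuous_on {0..1} trapezoid_kernel"
  unfolding trapezoid_kernel_def by (intro continuous_intros) auto

lemma trapezoid_kernel_bound: "u \<in> {0..1} \<Longrightarrow> norm (trapezoid_kernel u) \<le> 1"
proof -
  assume u: "u \<in> {0..1}"
  have "0 \<le> u * (1-u)" "u * (1 - u) \<le> 1 * 1" using u by (intro mult_nonneg_nonneg mult_mono; auto)+
  thus ?thesis unfolding trapezoid_kernel_def norm_of_real by (simp add: power2_eq_square algebra_simps)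
qed

lemma per_int_trapezoid:
  "per_int (\<lambda>_. 1) s n = (of_real (real n + 1) powr (-s) + of_real (real n + 2) powr (-s)) / 2
     + s * (s + 1) * per_int trapezoid_kernel (s + 2) n"
proof -
  define c1 where "c1 = (\<lambda>u. complex_of_real (u - 1/2))"
  have c1: "continuous_on {0..1} c1" unfolding c1_def by (intro continuous_intros)
  have d1: "(c1 has_vector_derivative 1) (at u)" for u
    unfolding c1_def by (auto intro!: derivative_eq_intros)
  have d2: "(trapezoid_kernel has_vector_derivative c1 u) (at u)" for u
    unfolding trapezoid_kernel_def c1_def
  proof -
    have "((\<lambda>z::complex. (z\<^sup>2 - z) / 2) has_field_derivative (of_real u - 1/2)) (at (of_real u))"
      by (auto intro!: derivative_eq_intros simp: field_simps)
    from has_vector_derivative_real_field[OF this, of UNIV]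
    show "((\<lambda>u. complex_of_real ((u\<^sup>2 - u) / 2)) has_vector_derivative complex_of_real (u - 1/2)) (at u)"
      by simp
  qed
  have "per_int (\<lambda>_. 1) s n = (of_real (real n + 1) powr (-s) + of_real (real n + 2) powr (-s)) / 2
     + s * per_int c1 (s + 1) n"
    unfolding per_int_def[of "\<lambda>_. 1"]
    using per_int_parts[OF c1 d1, of n s, THEN integral_unique] by (simp add: c1_def field_simps)
  moreover have "per_int c1 (s + 1) n = (s + 1) * per_int trapezoid_kernel (s + 2) n"
    unfolding per_int_def[of c1]
    using per_int_parts[OF trapezoid_kernel_cont d2, of n "s+1", THEN integral_unique] by (simp add: trapezoid_kernel_def add_ac)
  ultimately show ?thesis by simp
qed

text \<open>
  Integration by parts with the constant 1, read backwards with \<open>s - 1\<close> for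
  \<open>s\<close>.
\<close>

lemma per_int_one:
  assumes "s \<noteq> 1"
  shows "per_int (\<lambda>_. 1) s n = (of_real (real n + 1) powr (1 - s) - of_real (real n + 2) powr (1 - s)) / (s - 1)"
proof -
  have "((\<lambda>u. 0 * of_real (real n + 1 + u) powr (- (s-1))) has_integral
            1 * of_real (real n + 2) powr (- (s-1)) - 1 * of_real (real n + 1) powr (- (s-1))
            + (s-1) * per_int (\<lambda>_. 1) ((s-1) + 1) n) {0..1}"
    by (rule per_int_parts) auto
  hence "of_real (real n + 2) powr (- (s-1)) - of_real (real n + 1) powr (- (s-1))
            + (s-1) * per_int (\<lambda>_. 1) s n = 0"
    using integral_unique by fastforce
  thus ?thesis using assms by (simp add: field_simps)
qed

definition trapezoid_series :: "complex \<Rightarrow> complex" where "trapezoid_series s = (\<Sum>n. per_int trapezoid_kernel s n)"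

lemma trapezoid_series: "trapezoid_series holomorphic_on {s. Re s > 1}" "Re s > 1 \<Longrightarrow> per_int trapezoid_kernel s sums trapezoid_series s"
proof -
  obtain f where f: "f holomorphic_on {s. Re s > 1}" "\<And>s. Re s > 1 \<Longrightarrow> per_int trapezoid_kernel s sums f s"
    using per_int_sum_holomorphic[OF trapezoid_kernel_cont] by blast
  have eq: "trapezoid_series s = f s" if "Re s > 1" for s
    using f(2)[OF that] by (simp add: trapezoid_series_def sums_iff)
  show "trapezoid_series holomorphic_on {s. Re s > 1}"
    using f(1) by (rule holomorphic_transform) (simp add: eq)
  show "Re s > 1 \<Longrightarrow> per_int trapezoid_kernel s sums trapezoid_series s" using f(2) eq by simp
qed

lemma zeta_sums: "Re s > 1 \<Longrightarrow> (\<lambda>n. of_nat (Suc n) powr (- s)) sums zeta s"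
  using is_zeta_zeta by (simp add: is_zeta_def)

lemma zeta_holomorphic: "zeta holomorphic_on (- {1})"
  using is_zeta_zeta by (simp add: is_zeta_def)

lemma summable_Suc_powr: "a > 1 \<Longrightarrow> summable (\<lambda>n. real (Suc n) powr (- a))"
  by (subst summable_Suc_iff[of "\<lambda>n. real n powr (- a)"]) (simp add: summable_real_powr_iff)

text \<open>
  Applying the trapezoidal rule to \<open>v powr (-s)\<close> on all unit intervals turns the
  Dirichlet series into the integral \<open>1 / (s - 1)\<close>, half the first term, and an error
  series that still converges for \<open>Re s > -1\<close>. This single formula gives the growth of
  zeta in the strip and, below, its Mellin representation on \<open>(-1, 0)\<close>.
\<close>

lemma zeta_trapezoid_formula:
  assumes "Re s > -1" "s \<noteq> 1"
  shows "zeta s = 1/2 + 1 / (s - 1) - s * (s + 1) * trapezoid_series (s + 2)"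
proof (rule zeta_agree[where a = "-1" and f = zeta])
  show "zeta holomorphic_on {s. -1 < Re s} - {1}"
    using zeta_holomorphic by (rule holomorphic_on_subset) auto
  show "(\<lambda>s. 1/2 + 1 / (s - 1) - s * (s + 1) * trapezoid_series (s + 2)) holomorphic_on {s. -1 < Re s} - {1}"
    by (intro holomorphic_intros holomorphic_on_compose_gen[OF _ trapezoid_series(1), unfolded o_def]) auto
  fix s :: complex assume s: "Re s > 1"
  show "(\<lambda>n. of_nat (Suc n) powr (- s)) sums zeta s" using zeta_sums[OF s] .
  have s1: "s \<noteq> 1" using s by auto
  let ?a = "\<lambda>n. complex_of_nat (Suc n) powr (- s)"
  have "(\<lambda>n. per_int (\<lambda>_. 1) s n) sums (1 / (s - 1))"
    unfolding per_int_one[OF s1] by (intro sums_divide powr_telescope s)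
  moreover have "(\<lambda>n. s * (s + 1) * per_int trapezoid_kernel (s + 2) n) sums (s * (s + 1) * trapezoid_series (s + 2))"
    by (intro sums_mult trapezoid_series(2)) (use s in auto)
  ultimately have "(\<lambda>n. per_int (\<lambda>_. 1) s n - s * (s + 1) * per_int trapezoid_kernel (s + 2) n) sums
     (1 / (s - 1) - s * (s + 1) * trapezoid_series (s + 2))" by (rule sums_diff)
  hence 1: "(\<lambda>n. (?a n + ?a (Suc n)) / 2) sums (1 / (s - 1) - s * (s + 1) * trapezoid_series (s + 2))"
    by (simp add: per_int_trapezoid add_ac)
  have "?a \<longlonglongrightarrow> 0" using zeta_sums[OF s] by (intro summable_LIMSEQ_zero) (simp add: sums_iff)
  hence "(\<lambda>n. ?a n - ?a (Suc n)) sums (?a 0)" using telescope_sums'[of ?a 0] by simp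
  hence "(\<lambda>n. (?a n - ?a (Suc n)) / 2) sums (?a 0 / 2)" by (rule sums_divide)
  from sums_add[OF this 1] show "?a sums (1/2 + 1 / (s - 1) - s * (s + 1) * trapezoid_series (s + 2))"
    by (simp add: field_simps)
qed (use assms in auto)

lemma trapezoid_series_bound:
  assumes "a > 1" shows "\<exists>C>0. \<forall>s. Re s \<ge> a \<longrightarrow> norm (trapezoid_series s) \<le> C"
proof (intro exI conjI allI impI)
  let ?C = "(\<Sum>n. real (Suc n) powr (- a))"
  have sm: "summable (\<lambda>n. real (Suc n) powr (- a))" by (rule summable_Suc_powr) fact
  show "0 < ?C" by (rule suminf_pos[OF sm]) auto
  fix s assume s: "Re s \<ge> a"
  have "norm (per_int trapezoid_kernel s n) \<le> real (Suc n) powr (- a)" for n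
    using per_int_bound[OF trapezoid_kernel_cont trapezoid_kernel_bound s, of n] assms by simp
  thus "norm (trapezoid_series s) \<le> ?C"
    unfolding trapezoid_series_def by (rule norm_suminf_le[OF _ sm])
qed

lemma zeta_poly_bound:
  "\<exists>C>0. \<forall>s. Re s \<ge> - 9/10 \<longrightarrow> norm (s - 1) \<ge> 1 \<longrightarrow> norm (zeta s) \<le> C * (1 + norm s) ^ 2"
proof -
  obtain C where C: "C > 0" "\<And>s. Re s \<ge> 11/10 \<Longrightarrow> norm (trapezoid_series s) \<le> C"
    using trapezoid_series_bound[of "11/10"] by auto
  show ?thesis
  proof (intro exI[of _ "2 + C"] conjI allI impI)
    show "0 < 2 + C" using C by simp
    fix s :: complex assume s: "Re s \<ge> - 9/10" "norm (s - 1) \<ge> 1"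
    have s1: "s \<noteq> 1" using s by auto
    have "norm (zeta s) \<le> norm (1/2 :: complex) + norm (1 / (s - 1)) + norm (s * (s + 1) * trapezoid_series (s + 2))"
      unfolding zeta_trapezoid_formula[OF less_le_trans[OF _ s(1)] s1, simplified]
      by (metis (no_types, lifting) add_mono_thms_linordered_semiring(3) norm_triangle_ineq norm_triangle_ineq4 order_trans)
    also have "norm (1 / (s - 1)) \<le> 1" using s s1 by (auto simp: norm_divide divide_simps)
    also have "norm (s * (s + 1) * trapezoid_series (s + 2)) \<le> ((1 + norm s) * (1 + norm s)) * C"
      unfolding norm_mult using C(2)[of "s + 2"] s norm_triangle_ineq[of s 1]
      by (intro mult_mono) auto
    also have "norm (1/2 :: complex) + 1 + ((1 + norm s) * (1 + norm s)) * C \<le> (2 + C) * (1 + norm s) ^ 2"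
    proof -
      have "1 \<le> (1 + norm s) ^ 2" by (rule one_le_power) auto
      thus ?thesis by (simp add: algebra_simps power2_eq_square norm_divide) 
    qed
    finally show "norm (zeta s) \<le> (2 + C) * (1 + norm s) ^ 2" by simp
  qed
qed

lemma zeta_bounded_right:
  "\<exists>C>0. \<forall>s. Re s \<ge> 3/2 \<longrightarrow> norm (zeta s) \<le> C"
proof (intro exI conjI allI impI)
  let ?C = "(\<Sum>n. real (Suc n) powr (- (3/2)))"
  have sm: "summable (\<lambda>n. real (Suc n) powr (- (3/2)))" by (rule summable_Suc_powr) auto
  show "0 < ?C" by (rule suminf_pos[OF sm]) auto
  fix s :: complex assume s: "Re s \<ge> 3/2"
  have "norm (of_nat (Suc n) powr (- s)) \<le> real (Suc n) powr (- (3/2))" for n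
    using s by (subst norm_powr_real_powr) (auto intro!: powr_mono)
  hence "norm (\<Sum>n. of_nat (Suc n) powr (- s)) \<le> ?C" by (rule norm_suminf_le[OF _ sm])
  thus "norm (zeta s) \<le> ?C" using zeta_sums[of s] s by (simp add: sums_iff)
qed

text \<open>
  All terms but the first add up to at most \<open>\<pi>\<^sup>2 / 6 - 1 < 3/4\<close> in modulus.
\<close>

lemma norm_zeta_ge_quarter:
  assumes "Re s \<ge> 2" shows "norm (zeta s) \<ge> 1/4" 
proof -
  let ?r = "\<lambda>n. inverse ((real (Suc n))\<^sup>2)"
  have r: "?r sums (pi\<^sup>2 / 6)" using inverse_squares_sums by (simp add: inverse_eq_divide add.commute)
  have sm: "summable ?r" using r by (simp add: sums_iff)
  have z: "(\<lambda>n. of_nat (Suc n) powr (- s)) sums zeta s" using assms by (intro zeta_sums) auto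
  have "norm (of_nat (Suc (Suc n)) powr (- s)) \<le> ?r (Suc n)" for n
  proof -
    have "norm (of_nat (Suc (Suc n)) powr (- s)) \<le> real (Suc (Suc n)) powr (- 2)"
      using assms by (subst norm_powr_real_powr) (auto intro!: powr_mono)
    also have "\<dots> = ?r (Suc n)"
      unfolding powr_minus by (subst powr_numeral) (auto simp: power_inverse)
    finally show ?thesis .
  qed
  hence "norm (\<Sum>n. of_nat (Suc (Suc n)) powr (- s)) \<le> (\<Sum>n. ?r (Suc n))"
    proof (intro norm_suminf_le)
    show "summable (\<lambda>n. ?r (Suc n))" using sm by (subst summable_Suc_iff)
  qed
  also have "(\<Sum>n. ?r (Suc n)) = pi\<^sup>2/6 - 1"
    using suminf_split_head[OF sm] r by (simp add: sums_iff)
  also have "(\<Sum>n. of_nat (Suc (Suc n)) powr (- s)) = zeta s - 1"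
    using suminf_split_head[OF sums_summable[OF z]] z by (simp add: sums_iff)
  finally have "norm (zeta s - 1) \<le> pi\<^sup>2/6 - 1" .
  moreover have "pi\<^sup>2 \<le> 3.15\<^sup>2" using pi_approx by (intro power_mono) auto
  ultimately have "norm (zeta s - 1) \<le> 3/4" by (simp add: power2_eq_square)
  moreover have "norm (1::complex) \<le> norm (zeta s) + norm (zeta s - 1)"
    using norm_triangle_ineq4[of "zeta s" "zeta s - 1"] by simp
  ultimately show ?thesis by simp
qed

text \<open>
  The function \<open>cnj (zeta (cnj s))\<close> satisfies the characterization of zeta.
\<close>

lemma zeta_cnj: "zeta (cnj s) = cnj (zeta s)"
proof -
  have "is_zeta (\<lambda>s. cnj (zeta (cnj s)))"
    unfolding is_zeta_def
  proof (intro conjI allI impI)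
    have "cnj \<circ> zeta \<circ> cnj holomorphic_on (- {1})"
      by (rule holomorphic_on_compose_cnj_cnj, rule holomorphic_on_subset[OF zeta_holomorphic])
         (auto simp: complex_eq_iff)
    thus "(\<lambda>s. cnj (zeta (cnj s))) holomorphic_on - {1}" by (simp add: o_def)
    show "cnj (zeta (cnj 1)) = 0" using is_zeta_zeta by (simp add: is_zeta_def)
    fix s :: complex assume s: "1 < Re s"
    have "(\<lambda>n. cnj (of_nat (Suc n) powr (- cnj s))) sums cnj (zeta (cnj s))"
      using zeta_sums[of "cnj s"] s by (subst sums_cnj) auto
    moreover have "cnj (of_nat (Suc n) powr (- cnj s)) = of_nat (Suc n) powr (- s)" for n
      by (subst cnj_powr) (auto simp: complex_nonpos_Reals_iff)
    ultimately show "(\<lambda>n. of_nat (Suc n) powr (- s)) sums cnj (zeta (cnj s))" by simp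
  qed
  with zeta_unique_existence is_zeta_zeta have "(\<lambda>s. cnj (zeta (cnj s))) = zeta" by blast
  from fun_cong[OF this, of s] show ?thesis by (metis complex_cnj_cnj)
qed

text \<open>
  Cauchy's inequality on discs of radius 1/2 bounds the derivative.
\<close>

lemma zeta_logderiv_bounded_at_2: "\<exists>C>0. \<forall>s. Re s = 2 \<longrightarrow> norm (deriv zeta s / zeta s) \<le> C"
proof -
  obtain C where C: "C > 0" "\<And>s. Re s \<ge> 3/2 \<Longrightarrow> norm (zeta s) \<le> C" using zeta_bounded_right by auto
  show ?thesis
  proof (intro exI[of _ "8 * C"] conjI allI impI)
    show "8 * C > 0" using C by simp
    fix s :: complex assume s: "Re s = 2"
    have re: "Re w \<ge> 3/2" if "w \<in> cball s (1/2)" for w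
      using that abs_Re_le_cmod[of "s - w"] s by (auto simp: dist_norm)
    have "zeta holomorphic_on cball s (1/2)"
      by (rule holomorphic_on_subset[OF zeta_holomorphic]) (use re in force)
    hence "norm ((deriv ^^ 1) zeta s) \<le> fact 1 * C / (1/2) ^ 1"
      using C(2) re
      by (intro Cauchy_inequality) (auto intro: holomorphic_on_imp_continuous_on holomorphic_on_subset simp: dist_norm norm_minus_commute)
    hence "norm (deriv zeta s) \<le> 2 * C" by simp
    hence "norm (deriv zeta s / zeta s) \<le> (2 * C) / (1/4)"
      unfolding norm_divide using norm_zeta_ge_quarter[of s] s C by (intro frac_le) auto
    thus "norm (deriv zeta s / zeta s) \<le> 8 * C" by simp
  qed
qed

section \<open>The functional equation\<close>

text \<open>
  The logarithmic derivative of Euler's reflection formula.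
\<close>

lemma Digamma_reflection:
  fixes z :: complex
  assumes z: "z \<notin> \<int>"
  shows "Digamma (1 - z) - Digamma z = of_real pi * cot (of_real pi * z)"
proof -
  have z1: "1 - z \<notin> \<int>" using z by (metis Ints_1 Ints_diff diff_diff_eq2 add_diff_cancel_left')
  have nz: "z \<notin> \<int>\<^sub>\<le>\<^sub>0" "1 - z \<notin> \<int>\<^sub>\<le>\<^sub>0" using z z1 nonpos_Ints_Int by blast+
  have sinz: "sin (of_real pi * z) \<noteq> 0"
  proof
    assume "sin (of_real pi * z) = 0"
    then obtain n :: int where "of_real pi * z = of_real (n * pi)"
      by (auto simp: Complex_Transcendental.sin_eq_0)
    hence "z = of_int n" by simp
    thus False using z by simp
  qed
  let ?P = "Gamma z * Gamma (1 - z)"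
  have "((\<lambda>z. Gamma z * Gamma (1 - z)) has_field_derivative ?P * (Digamma z - Digamma (1 - z))) (at z)"
    using nz by (auto intro!: derivative_eq_intros simp: algebra_simps)
  moreover have "((\<lambda>z. of_real pi / sin (of_real pi * z)) has_field_derivative
       - (of_real pi / sin (of_real pi * z)) * (of_real pi * cot (of_real pi * z))) (at z)"
    using sinz by (auto intro!: derivative_eq_intros simp: cot_def divide_simps)
  ultimately have "?P * (Digamma z - Digamma (1 - z)) = - (of_real pi / sin (of_real pi * z)) * (of_real pi * cot (of_real pi * z))"
    unfolding Gamma_reflection_complex by (rule DERIV_unique)
  hence "?P * (Digamma z - Digamma (1 - z)) = ?P * (- (of_real pi * cot (of_real pi * z)))"
    unfolding Gamma_reflection_complex by simp
  moreover have "?P \<noteq> 0" using nz by (simp add: Gamma_eq_zero_iff)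
  ultimately have "Digamma z - Digamma (1 - z) = - (of_real pi * cot (of_real pi * z))"
    using mult_left_cancel[of ?P] by blast
  thus ?thesis by (simp add: algebra_simps)
qed

text \<open>
  This is \<open>coth (x / 2) / 2 - 1 / x\<close>.
\<close>

definition coth_kernel :: "real \<Rightarrow> real" where
  "coth_kernel x = (1 + exp (- x)) / (2 * (1 - exp (- x))) - 1 / x"

text \<open>
  The reflection formula at \<open>z = \<i> x / (2 \<pi>)\<close>, where the cotangent becomes a
  hyperbolic cotangent and the two Digamma series combine into the partial fractions.
\<close>

lemma coth_partial_fractions:
  assumes x: "x > 0"
  shows "(\<lambda>k. 2 * x / (x\<^sup>2 + (2 * pi * real (Suc k))\<^sup>2)) sums coth_kernel x"
proof -
  define y where "y = x / (2 * pi)"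
  have y: "y > 0" using x by (simp add: y_def)
  define z where "z = \<i> * of_real y"
  have zZ: "z \<notin> \<int>" using y by (auto simp: z_def complex_is_Int_iff)
  have nz: "z \<noteq> 0" "1 - z \<noteq> 0" "1 + z \<noteq> 0" using y by (auto simp: z_def complex_eq_iff)
  have "(\<lambda>k. inverse (of_nat (Suc k)) - inverse (w + of_nat k)) sums (Digamma w + euler_mascheroni)"
    if "w \<noteq> 0" for w :: complex
    using summable_Digamma[OF that] unfolding Digamma_def by (simp add: summable_sums)
  from sums_diff[OF this[OF nz(2)] this[OF nz(3)]]
  have "(\<lambda>k. inverse (1 + z + of_nat k) - inverse (1 - z + of_nat k)) sums (Digamma (1 - z) - Digamma (1 + z))"
    by simp
  moreover have "inverse (1 + z + of_nat k) - inverse (1 - z + of_nat k) = - \<i> * of_real (2 * y / ((real (Suc k))\<^sup>2 + y\<^sup>2))" for k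
  proof -
    have n: "1 + z + of_nat k \<noteq> 0" "1 - z + of_nat k \<noteq> 0" using y by (auto simp: z_def complex_eq_iff)
    have "inverse (1 + z + of_nat k) - inverse (1 - z + of_nat k) = - 2 * z / ((1 + z + of_nat k) * (1 - z + of_nat k))"
      using n by (simp add: field_simps)
    also have "(1 + z + of_nat k) * (1 - z + of_nat k) = of_real ((real (Suc k))\<^sup>2 + y\<^sup>2)"
      by (simp add: z_def power2_eq_square algebra_simps)
    finally show ?thesis by (simp add: z_def del: of_real_add of_nat_Suc)
  qed
  ultimately have 1: "(\<lambda>k. - \<i> * of_real (2 * y / ((real (Suc k))\<^sup>2 + y\<^sup>2))) sums (Digamma (1 - z) - Digamma (1 + z))"
    by simp
  define E where "E = exp (- x)"
  have E: "E < 1" "E > 0" using x by (auto simp: E_def)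
  have "Digamma (1 + z) = Digamma z + 1 / z" using Digamma_plus1[OF nz(1)] by (simp add: add.commute)
  hence "Digamma (1 - z) - Digamma (1 + z) = of_real pi * cot (of_real pi * z) - 1 / z"
    using Digamma_reflection[OF zZ] by (simp add: algebra_simps)
  also have "cot (of_real pi * z) = - \<i> * of_real ((1 + E) / (1 - E))"
  proof -
    have e: "\<i> * (of_real pi * z) = of_real (- (x / 2))" by (simp add: z_def y_def)
    have c: "cos (of_real pi * z) = of_real (cosh (x/2))" "sin (of_real pi * z) = \<i> * of_real (sinh (x/2))"
      unfolding cos_exp_eq sin_exp_eq e of_real_minus[symmetric] exp_of_real cosh_def sinh_def
      by (auto simp: field_simps)
    have "E = exp (- (x/2)) * exp (-(x/2))" unfolding E_def by (simp flip: exp_add)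
    moreover have "exp (x/2) * exp (-(x/2)) = 1" by (simp flip: exp_add)
    ultimately have "cosh (x/2) * (1 - E) = sinh (x/2) * (1 + E)"
      unfolding cosh_def sinh_def by (simp add: algebra_simps)
    moreover have "sinh (x/2) > 0" using x by simp
    ultimately have "cosh (x/2) / sinh (x/2) = (1 + E) / (1 - E)" using E by (simp add: field_simps)
    moreover have "of_real c / (\<i> * of_real s) = - \<i> * of_real (c / s)" for c s :: real
      by (cases "s = 0") (auto simp: field_simps)
    ultimately show ?thesis unfolding cot_def c by (simp only:)
  qed
  also have "of_real pi * (- \<i> * of_real ((1 + E) / (1 - E))) - 1 / z = - \<i> * of_real (pi * ((1 + E) / (1 - E)) - 1 / y)"
  proof -
    have "1 / z = - \<i> * of_real (1 / y)" using y by (simp add: z_def field_simps)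
    moreover have "of_real pi * (- \<i> * of_real K) - (- \<i> * of_real (1 / y)) = - \<i> * of_real (pi * K - 1 / y)"
      for K by (simp add: algebra_simps)
    ultimately show ?thesis by (simp only:)
  qed
  finally have eqD: "Digamma (1 - z) - Digamma (1 + z) = - \<i> * of_real (pi * ((1 + E) / (1 - E)) - 1 / y)" .
  have "(\<lambda>k. \<i> * (- \<i> * of_real (2 * y / ((real (Suc k))\<^sup>2 + y\<^sup>2)))) sums
        (\<i> * (- \<i> * of_real (pi * ((1 + E) / (1 - E)) - 1 / y)))"
    by (rule sums_mult[OF 1[unfolded eqD]])
  hence "(\<lambda>k. complex_of_real (2 * y / ((real (Suc k))\<^sup>2 + y\<^sup>2))) sums
        (of_real (pi * ((1 + E) / (1 - E)) - 1 / y))"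
    by (simp only: mult.assoc[symmetric]) (simp del: of_real_divide of_real_add of_real_mult of_real_diff)
  hence "(\<lambda>k. 2 * y / ((real (Suc k))\<^sup>2 + y\<^sup>2)) sums (pi * ((1 + E) / (1 - E)) - 1 / y)"
    by (simp only: sums_of_real_iff)
  hence "(\<lambda>k. 1 / (2 * pi) * (2 * y / ((real (Suc k))\<^sup>2 + y\<^sup>2))) sums (1 / (2 * pi) * (pi * ((1 + E) / (1 - E)) - 1 / y))"
    by (rule sums_mult)
  moreover have "1 / (2 * pi) * (pi * ((1 + E) / (1 - E)) - 1 / y) = coth_kernel x"
    using x E unfolding coth_kernel_def E_def[symmetric] y_def by (simp add: field_simps)
  moreover have "1 / (2 * pi) * (2 * y / ((real (Suc k))\<^sup>2 + y\<^sup>2)) = 2 * x / (x\<^sup>2 + (2 * pi * real (Suc k))\<^sup>2)" for k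
  proof -
    have "(real (Suc k))\<^sup>2 + y\<^sup>2 = (x\<^sup>2 + (2 * pi * real (Suc k))\<^sup>2) / (4 * pi\<^sup>2)"
      by (simp add: y_def power_divide power_mult_distrib add_divide_distrib del: of_nat_Suc)
    thus ?thesis by (simp add: y_def power2_eq_square)
  qed
  ultimately show ?thesis by simp
qed

lemma nn_integral_Gamma_scaled:
  assumes p: "p > 0" and b: "b > (0::real)"
  shows "(\<integral>\<^sup>+x. ennreal (x powr (p - 1) * exp (- b * x)) * indicator {0<..} x \<partial>lborel) = ennreal (Gamma p * b powr (- p))"
proof -
  have g: "(\<integral>\<^sup>+x. ennreal (x powr (p - 1) * exp (- x)) * indicator {0<..} x \<partial>lborel) = ennreal (Gamma p)"
    unfolding Gamma_conv_nn_integral_real[OF p]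
    by (intro nn_integral_cong_AE AE_I[of _ _ "{0}"]) (auto simp: indicator_def exp_minus field_simps)
  have "ennreal (Gamma p) = ennreal \<bar>b\<bar> * (\<integral>\<^sup>+x. ennreal ((0 + b * x) powr (p - 1) * exp (- (0 + b * x))) * indicator {0<..} (0 + b * x) \<partial>lborel)"
    unfolding g[symmetric] using b by (intro nn_integral_real_affine) auto
  also have "(\<integral>\<^sup>+x. ennreal ((0 + b * x) powr (p - 1) * exp (- (0 + b * x))) * indicator {0<..} (0 + b * x) \<partial>lborel) =
     (\<integral>\<^sup>+x. ennreal (b powr (p - 1)) * (ennreal (x powr (p - 1) * exp (- b * x)) * indicator {0<..} x) \<partial>lborel)"
    using b by (intro nn_integral_cong)
      (auto simp: indicator_def powr_mult zero_less_mult_iff ennreal_mult'[symmetric] mult_ac)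
  also have "\<dots> = ennreal (b powr (p - 1)) * (\<integral>\<^sup>+x. ennreal (x powr (p - 1) * exp (- b * x)) * indicator {0<..} x \<partial>lborel)"
    by (rule nn_integral_cmult) auto
  finally have "ennreal (Gamma p) = ennreal b * (ennreal (b powr (p - 1)) * (\<integral>\<^sup>+x. ennreal (x powr (p - 1) * exp (- b * x)) * indicator {0<..} x \<partial>lborel))" (is "_ = _ * (_ * ?I)")
    using b by simp
  also have "\<dots> = ennreal (b powr p) * ?I"
    using b by (simp add: mult.assoc[symmetric] ennreal_mult'[symmetric] powr_diff powr_add)
  finally have "ennreal (b powr (-p)) * ennreal (Gamma p) = ennreal (b powr (-p)) * (ennreal (b powr p) * ?I)" by simp
  also have "\<dots> = ?I" using b by (simp add: mult.assoc[symmetric] ennreal_mult'[symmetric] powr_minus)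
  finally show ?thesis using p by (simp add: ennreal_mult'[symmetric] mult.commute Gamma_real_pos)
qed

lemma nn_integral_square_subst:
  fixes f :: "real \<Rightarrow> real"
  assumes [measurable]: "f \<in> borel_measurable borel" and f: "\<And>x. f x \<ge> 0"
  shows "(\<integral>\<^sup>+x. ennreal (f x) * indicator {0<..} x \<partial>lborel) =
         (\<integral>\<^sup>+x. ennreal (f (x\<^sup>2) * (2 * x)) * indicator {0<..} x \<partial>lborel)"
proof -
  have eq: "(\<integral>\<^sup>+x. ennreal (f x) * indicator {0..(real n)\<^sup>2} x \<partial>lborel) =
         (\<integral>\<^sup>+x. ennreal (f (x\<^sup>2) * (2 * x)) * indicator {0..real n} x \<partial>lborel)" for n
  proof -
    have "(\<integral>\<^sup>+x. ennreal (f x * indicator {0\<^sup>2..(real n)\<^sup>2} x) \<partial>lborel) =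
         (\<integral>\<^sup>+x. ennreal (f (x\<^sup>2) * (2 * x) * indicator {0..real n} x) \<partial>lborel)"
      by (rule nn_integral_substitution) (auto intro!: derivative_eq_intros continuous_intros simp: set_borel_measurable_def)
    moreover have "ennreal (f x * indicator {0\<^sup>2..(real n)\<^sup>2} x) = ennreal (f x) * indicator {0..(real n)\<^sup>2} x" for x
      by (auto simp: indicator_def)
    moreover have "ennreal (f (x\<^sup>2) * (2 * x) * indicator {0..real n} x) = ennreal (f (x\<^sup>2) * (2 * x)) * indicator {0..real n} x" for x
      by (auto simp: indicator_def)
    ultimately show ?thesis by simp
  qed
  have sup: "(\<integral>\<^sup>+x. ennreal (g x) * indicator {0<..} x \<partial>lborel) = (SUP n. (\<integral>\<^sup>+x. ennreal (g x) * indicator {0..c n} x \<partial>lborel))"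
    if [measurable]: "g \<in> borel_measurable borel" and c: "incseq c" "filterlim c at_top sequentially" for g and c :: "nat \<Rightarrow> real"
  proof -
    have "(\<integral>\<^sup>+x. ennreal (g x) * indicator {0<..} x \<partial>lborel) = (\<integral>\<^sup>+x. ennreal (g x) * indicator {0..} x \<partial>lborel)"
      by (intro nn_integral_cong_AE AE_I[of _ _ "{0}"]) (auto simp: indicator_def)
    also have "\<dots> = (\<integral>\<^sup>+x. (SUP n. ennreal (g x) * indicator {0..c n} x) \<partial>lborel)"
    proof (rule nn_integral_cong)
      fix x :: real
      show "ennreal (g x) * indicator {0..} x = (SUP n. ennreal (g x) * indicator {0..c n} x)"
      proof (cases "x \<ge> 0")
        case True
        obtain n where "x \<le> c n" using c(2) by (metis eventually_sequentially filterlim_at_top order_refl)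
        hence "ennreal (g x) \<le> (SUP n. ennreal (g x) * indicator {0..c n} x)"
          using True by (intro SUP_upper2[of n]) auto
        moreover have "(SUP n. ennreal (g x) * indicator {0..c n} x) \<le> ennreal (g x)"
          by (intro SUP_least) (auto simp: indicator_def)
        ultimately show ?thesis using True by simp
      qed auto
    qed
    also have "\<dots> = (SUP n. (\<integral>\<^sup>+x. ennreal (g x) * indicator {0..c n} x \<partial>lborel))"
      using c(1) by (intro nn_integral_monotone_convergence_SUP)
        (auto simp: incseq_def le_fun_def indicator_def intro: order_trans)
    finally show ?thesis .
  qed
  have 1: "(\<integral>\<^sup>+x. ennreal (f x) * indicator {0<..} x \<partial>lborel) = (SUP n. (\<integral>\<^sup>+x. ennreal (f x) * indicator {0..(real n)\<^sup>2} x \<partial>lborel))"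
    by (rule sup) (auto simp: incseq_def intro!: power_mono filterlim_pow_at_top filterlim_real_sequentially)
  have 2: "(\<integral>\<^sup>+x. ennreal (f (x\<^sup>2) * (2 * x)) * indicator {0<..} x \<partial>lborel) = (SUP n. (\<integral>\<^sup>+x. ennreal (f (x\<^sup>2) * (2 * x)) * indicator {0..real n} x \<partial>lborel))"
    by (rule sup) (auto simp: incseq_def filterlim_real_sequentially)
  show ?thesis unfolding 1 2 eq ..
qed

text \<open>
  Write \<open>1 / (y + d)\<close> as a Laplace integral and exchange: the inner and outer integrals
  are Gamma integrals, whose product is evaluated by reflection.
\<close>

lemma nn_integral_stieltjes:
  assumes p: "0 < p" "p < (1::real)" and d: "d > 0"
  shows "(\<integral>\<^sup>+y. ennreal (y powr (p - 1) / (y + d)) * indicator {0<..} y \<partial>lborel) = ennreal (d powr (p - 1) * pi / sin (pi * p))"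
proof -
  have "(\<integral>\<^sup>+y. ennreal (y powr (p - 1) / (y + d)) * indicator {0<..} y \<partial>lborel) =
     (\<integral>\<^sup>+y. (\<integral>\<^sup>+v. ennreal (y powr (p - 1) * exp (- v * y)) * indicator {0<..} y * (ennreal (exp (- d * v)) * indicator {0<..} v) \<partial>lborel) \<partial>lborel)"
  proof (rule nn_integral_cong)
    fix y :: real
    show "ennreal (y powr (p - 1) / (y + d)) * indicator {0<..} y =
       (\<integral>\<^sup>+v. ennreal (y powr (p - 1) * exp (- v * y)) * indicator {0<..} y * (ennreal (exp (- d * v)) * indicator {0<..} v) \<partial>lborel)"
    proof (cases "y > 0")
      case True
      have "(\<integral>\<^sup>+v. ennreal (y powr (p - 1) * exp (- v * y)) * indicator {0<..} y * (ennreal (exp (- d * v)) * indicator {0<..} v) \<partial>lborel)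
        = (\<integral>\<^sup>+v. ennreal (y powr (p - 1)) * (ennreal (v powr (1 - 1) * exp (- (y + d) * v)) * indicator {0<..} v) \<partial>lborel)"
        using True by (intro nn_integral_cong)
          (auto simp: indicator_def ennreal_mult'[symmetric] exp_add[symmetric] algebra_simps)
      also have "\<dots> = ennreal (y powr (p - 1)) * (\<integral>\<^sup>+v. (ennreal (v powr (1 - 1) * exp (- (y + d) * v)) * indicator {0<..} v) \<partial>lborel)"
        by (rule nn_integral_cmult) auto
      also have "\<dots> = ennreal (y powr (p - 1) / (y + d))"
        using True d by (subst nn_integral_Gamma_scaled) (auto simp: ennreal_mult'[symmetric] powr_minus_divide)
      finally show ?thesis using True by simp
    qed auto
  qed
  also have "\<dots> = (\<integral>\<^sup>+v. (\<integral>\<^sup>+y. ennreal (y powr (p - 1) * exp (- v * y)) * indicator {0<..} y * (ennreal (exp (- d * v)) * indicator {0<..} v) \<partial>lborel) \<partial>lborel)"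
    by (rule lborel_pair.Fubini') measurable
  also have "\<dots> = (\<integral>\<^sup>+v. ennreal (Gamma p) * (ennreal (v powr ((1 - p) - 1) * exp (- d * v)) * indicator {0<..} v) \<partial>lborel)"
  proof (rule nn_integral_cong)
    fix v :: real
    show "(\<integral>\<^sup>+y. ennreal (y powr (p - 1) * exp (- v * y)) * indicator {0<..} y * (ennreal (exp (- d * v)) * indicator {0<..} v) \<partial>lborel)
       = ennreal (Gamma p) * (ennreal (v powr ((1 - p) - 1) * exp (- d * v)) * indicator {0<..} v)"
    proof (cases "v > 0")
      case True
      have "(\<integral>\<^sup>+y. ennreal (y powr (p - 1) * exp (- v * y)) * indicator {0<..} y * (ennreal (exp (- d * v)) * indicator {0<..} v) \<partial>lborel)
        = (\<integral>\<^sup>+y. ennreal (y powr (p - 1) * exp (- v * y)) * indicator {0<..} y \<partial>lborel) * (ennreal (exp (- d * v)) * indicator {0<..} v)"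
        by (rule nn_integral_multc) auto
      also have "\<dots> = ennreal (Gamma p * v powr (- p)) * ennreal (exp (- d * v))"
        using True p by (subst nn_integral_Gamma_scaled) auto
      finally show ?thesis using True p
        by (simp add: ennreal_mult'[symmetric] Gamma_real_pos mult.assoc)
    qed auto
  qed
  also have "\<dots> = ennreal (Gamma p) * (\<integral>\<^sup>+v. ennreal (v powr ((1 - p) - 1) * exp (- d * v)) * indicator {0<..} v \<partial>lborel)"
    by (rule nn_integral_cmult) auto
  also have "\<dots> = ennreal (Gamma p) * ennreal (Gamma (1 - p) * d powr (- (1 - p)))"
    using p d by (subst nn_integral_Gamma_scaled) auto
  also have "\<dots> = ennreal (Gamma p * Gamma (1 - p) * d powr (p - 1))"
    using p by (simp add: ennreal_mult'[symmetric] Gamma_real_pos mult.assoc)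
  also have "Gamma p * Gamma (1 - p) = pi / sin (pi * p)"
  proof -
    have "complex_of_real (Gamma p * Gamma (1 - p)) = of_real (pi / sin (pi * p))"
      using Gamma_reflection_complex[of "of_real p"]
      by (simp add: Gamma_complex_of_real[symmetric] sin_of_real[symmetric] del: sin_of_real)
    thus ?thesis by (simp only: of_real_eq_iff)
  qed
  finally show ?thesis by (simp add: mult.commute)
qed

lemma nn_integral_fraction:
  assumes s: "-1 < s" "s < (0::real)" and c: "c > 0"
  shows "(\<integral>\<^sup>+x. ennreal (2 * x / (x\<^sup>2 + c\<^sup>2) * x powr (s - 1)) * indicator {0<..} x \<partial>lborel) =
    ennreal (c powr (s - 1) * pi / cos (pi * s / 2))"
proof -
  define p where "p = (s + 1) / 2"
  have p: "0 < p" "p < 1" using s by (auto simp: p_def)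
  have "(\<integral>\<^sup>+x. ennreal (2 * x / (x\<^sup>2 + c\<^sup>2) * x powr (s - 1)) * indicator {0<..} x \<partial>lborel) =
     (\<integral>\<^sup>+x. ennreal ((\<lambda>y. y powr (p - 1) / (\<bar>y\<bar> + c\<^sup>2)) (x\<^sup>2) * (2 * x)) * indicator {0<..} x \<partial>lborel)"
  proof (rule nn_integral_cong)
    fix x :: real
    have "(x\<^sup>2) powr (p - 1) = x powr (s - 1)" if "x > 0"
    proof -
      have "(x\<^sup>2) powr (p - 1) = (x powr 2) powr (p - 1)" using that by (simp add: powr_numeral)
      also have "\<dots> = x powr (2 * (p - 1))" by (simp add: powr_powr)
      also have "2 * (p - 1) = s - 1" by (simp add: p_def)
      finally show ?thesis .
    qed
    thus "ennreal (2 * x / (x\<^sup>2 + c\<^sup>2) * x powr (s - 1)) * indicator {0<..} x =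
      ennreal ((\<lambda>y. y powr (p - 1) / (\<bar>y\<bar> + c\<^sup>2)) (x\<^sup>2) * (2 * x)) * indicator {0<..} x"
      by (auto simp: indicator_def mult_ac)
  qed
  also have "\<dots> = (\<integral>\<^sup>+y. ennreal (y powr (p - 1) / (\<bar>y\<bar> + c\<^sup>2)) * indicator {0<..} y \<partial>lborel)"
    by (rule nn_integral_square_subst[symmetric]) auto
  also have "\<dots> = (\<integral>\<^sup>+y. ennreal (y powr (p - 1) / (y + c\<^sup>2)) * indicator {0<..} y \<partial>lborel)"
    by (intro nn_integral_cong) (auto simp: indicator_def)
  also have "\<dots> = ennreal ((c\<^sup>2) powr (p - 1) * pi / sin (pi * p))"
    using p c by (intro nn_integral_stieltjes) auto
  also have "(c\<^sup>2) powr (p - 1) = c powr (s - 1)"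
  proof -
    have "(c\<^sup>2) powr (p - 1) = (c powr 2) powr (p - 1)" using c by (simp add: powr_numeral)
    also have "\<dots> = c powr (2 * (p - 1))" by (simp add: powr_powr)
    also have "2 * (p - 1) = s - 1" by (simp add: p_def)
    finally show ?thesis .
  qed
  also have "sin (pi * p) = cos (pi * s / 2)"
  proof -
    have eq: "pi * p = pi / 2 - (- (pi * s / 2))" by (simp add: p_def field_simps)
    show ?thesis unfolding eq using cos_sin_eq[of "- (pi * s / 2)"] by simp
  qed
  finally show ?thesis .
qed

text \<open>
  The \<open>n\<close>-th term is the error of the trapezoidal rule for \<open>exp (- v x)\<close>
  on \<open>{n..n+1}\<close>; these errors form a geometric series.
\<close>

lemma coth_kernel_as_integrals:
  assumes x: "x > 0"
  shows "ennreal (coth_kernel x) = (\<Sum>n. \<integral>\<^sup>+u. ennreal ((u - u\<^sup>2) / 2 * (x\<^sup>2 * exp (- (real n + u) * x))) * indicator {0..1} u \<partial>lborel)"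
proof -
  define E where "E = exp (- x)"
  have E: "0 < E" "E < 1" using x by (auto simp: E_def)
  define w where "w = (1 + E) / 2 - (1 - E) / x"
  have int: "((\<lambda>u. (u - u\<^sup>2) / 2 * (x\<^sup>2 * exp (- (real n + u) * x))) has_integral E ^ n * w) {0..1}" for n
  proof -
    define A where "A = (\<lambda>u. ((u - u\<^sup>2) / 2 * (- x) - (1 - 2 * u) / 2 + 1 / x) * exp (- (real n + u) * x))"
    have "((\<lambda>u. (u - u\<^sup>2) / 2 * (x\<^sup>2 * exp (- (real n + u) * x))) has_integral A 1 - A 0) {0..1}"
    proof (rule fundamental_theorem_of_calculus)
      fix u :: real
      have "(A has_real_derivative (u - u\<^sup>2) / 2 * (x\<^sup>2 * exp (- (real n + u) * x))) (at u)"
        unfolding A_def using x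
        by (auto intro!: derivative_eq_intros) (simp add: field_simps power2_eq_square)
      thus "(A has_vector_derivative (u - u\<^sup>2) / 2 * (x\<^sup>2 * exp (- (real n + u) * x))) (at u within {0..1})"
        using has_field_derivative_at_within has_real_derivative_iff_has_vector_derivative by blast
    qed auto
    moreover have "exp (- (real n + 1) * x) = E ^ n * E" "exp (- (real n + 0) * x) = E ^ n"
      unfolding E_def exp_of_nat_mult[symmetric] exp_add[symmetric] by (simp_all add: algebra_simps)
    hence "A 1 = (1 / 2 + 1 / x) * (E ^ n * E)" "A 0 = (- 1 / 2 + 1 / x) * E ^ n"
      unfolding A_def by simp_all
    hence "A 1 - A 0 = E ^ n * w" by (simp add: w_def algebra_simps diff_divide_distrib add_divide_distrib)
    ultimately show ?thesis by simp
  qed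
  have nn: "(u - u\<^sup>2) / 2 * (x\<^sup>2 * exp (- (real n + u) * x)) \<ge> 0" if "u \<in> {0..1}" for u n
  proof -
    have "u * u \<le> u * 1" using that by (intro mult_left_mono) auto
    thus ?thesis by (simp add: power2_eq_square)
  qed
  have w0: "w \<ge> 0"
    using has_integral_nonneg[OF int[of 0] nn] by simp
  have "(\<Sum>n. \<integral>\<^sup>+u. ennreal ((u - u\<^sup>2) / 2 * (x\<^sup>2 * exp (- (real n + u) * x))) * indicator {0..1} u \<partial>lborel) = (\<Sum>n. ennreal (E ^ n * w))"
    by (intro suminf_cong nn_integral_has_integral_lebesgue' int nn)
  also have "\<dots> = ennreal (1 / (1 - E) * w)"
    using E w0 by (intro suminf_ennreal_eq sums_mult2 geometric_sums) auto
  also have "1 / (1 - E) * w = coth_kernel x"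
    using E x unfolding coth_kernel_def w_def E_def[symmetric] by (simp add: field_simps)
  finally show ?thesis ..
qed

lemma coth_kernel_nonneg: "x > 0 \<Longrightarrow> coth_kernel x \<ge> 0"
  by (rule sums_le[OF _ sums_zero coth_partial_fractions]) auto

lemma coth_kernel_measurable [measurable]: "coth_kernel \<in> borel_measurable borel"
  unfolding coth_kernel_def by measurable

lemma powr_sum_real:
  assumes "a > 1" shows "(\<lambda>k. real (Suc k) powr (- a)) sums Re (zeta (of_real a))" "zeta (of_real a) = of_real (Re (zeta (of_real a)))"
proof -
  have "(\<lambda>n. complex_of_nat (Suc n) powr (- of_real a)) sums zeta (of_real a)" using assms by (intro zeta_sums) auto
  moreover have "complex_of_nat (Suc n) powr (- of_real a) = of_real (real (Suc n) powr (- a))" for n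
    using powr_of_real[of "real (Suc n)" "-a"] by simp
  ultimately have 1: "(\<lambda>n. complex_of_real (real (Suc n) powr (- a))) sums zeta (of_real a)" by simp
  from sums_Re[OF this] show 2: "(\<lambda>k. real (Suc k) powr (- a)) sums Re (zeta (of_real a))" by simp
  show "zeta (of_real a) = of_real (Re (zeta (of_real a)))"
    using sums_unique2[OF 1] sums_of_real[OF 2] by blast
qed

lemma cos_half_pos:
  assumes "-1 < s" "s < (1::real)"
  shows "cos (pi * s / 2) > 0"
proof (rule cos_gt_zero_pi)
  have "pi * (-1) < pi * s" "pi * s < pi * 1" using assms by (intro mult_strict_left_mono; simp)+
  thus "- (pi / 2) < pi * s / 2" "pi * s / 2 < pi / 2" by auto
qed

text \<open>
  The \<open>n\<close>-th partial fraction contributes a constant multiple of \<open>n powr (s -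
  1)\<close>, so the sum is the Dirichlet series at \<open>1 - s > 1\<close>.
\<close>

lemma mellin_by_fractions:
  assumes s: "-1 < s" "s < (0::real)"
  shows "(\<integral>\<^sup>+x. ennreal (coth_kernel x * x powr (s - 1)) * indicator {0<..} x \<partial>lborel) =
    ennreal ((2 * pi) powr (s - 1) * pi / cos (pi * s / 2) * Re (zeta (of_real (1 - s))))"
proof -
  have cpos: "cos (pi * s / 2) > 0" by (rule cos_half_pos) (use s in auto)
  let ?t = "\<lambda>k x. 2 * x / (x\<^sup>2 + (2 * pi * real (Suc k))\<^sup>2) * x powr (s - 1)"
  have "(\<integral>\<^sup>+x. ennreal (coth_kernel x * x powr (s - 1)) * indicator {0<..} x \<partial>lborel) =
    (\<integral>\<^sup>+x. (\<Sum>k. ennreal (?t k x) * indicator {0<..} x) \<partial>lborel)"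
  proof (rule nn_integral_cong)
    fix x :: real
    show "ennreal (coth_kernel x * x powr (s - 1)) * indicator {0<..} x = (\<Sum>k. ennreal (?t k x) * indicator {0<..} x)"
    proof (cases "x > 0")
      case True
      have "(\<Sum>k. ennreal (?t k x)) = ennreal (coth_kernel x * x powr (s - 1))"
        using True by (intro suminf_ennreal_eq sums_mult2 coth_partial_fractions) auto
      thus ?thesis using True by simp
    qed auto
  qed
  also have "\<dots> = (\<Sum>k. \<integral>\<^sup>+x. ennreal (?t k x) * indicator {0<..} x \<partial>lborel)"
    by (rule nn_integral_suminf) auto
  also have "\<dots> = (\<Sum>k. ennreal ((2 * pi * real (Suc k)) powr (s - 1) * pi / cos (pi * s / 2)))"
    using s by (intro suminf_cong nn_integral_fraction) auto
  also have "\<dots> = ennreal ((2 * pi) powr (s - 1) * pi / cos (pi * s / 2) * Re (zeta (of_real (1 - s))))"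
  proof (rule suminf_ennreal_eq)
    show "0 \<le> (2 * pi * real (Suc k)) powr (s - 1) * pi / cos (pi * s / 2)" for k using cpos by simp
    have "(\<lambda>k. (2 * pi) powr (s - 1) * pi / cos (pi * s / 2) * real (Suc k) powr (- (1 - s))) sums
        ((2 * pi) powr (s - 1) * pi / cos (pi * s / 2) * Re (zeta (of_real (1 - s))))"
      using s by (intro sums_mult powr_sum_real) auto
    moreover have "(2 * pi * real (Suc k)) powr (s - 1) = (2 * pi) powr (s - 1) * real (Suc k) powr (- (1 - s))" for k
      by (subst powr_mult) auto
    ultimately show "(\<lambda>k. (2 * pi * real (Suc k)) powr (s - 1) * pi / cos (pi * s / 2)) sums
        ((2 * pi) powr (s - 1) * pi / cos (pi * s / 2) * Re (zeta (of_real (1 - s))))"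
      by (simp add: mult_ac)
  qed
  finally show ?thesis .
qed

text \<open>
  The error integrals as real numbers, including the one for the interval at the origin, which
  \<open>per_int\<close> leaves out.
\<close>

definition trapezoid_int :: "real \<Rightarrow> nat \<Rightarrow> real" where
  "trapezoid_int s n = integral {0..1} (\<lambda>u. (u - u\<^sup>2) / 2 * (real n + u) powr (- (s + 2)))"

text \<open>
  The interval at the origin, where the integrand is singular, has to be computed by hand. For
  \<open>s < 0\<close> the value, times \<open>s (s + 1)\<close>, is \<open>1/2 + 1 / (s -
  1)\<close>, which is exactly the part of \<open>zeta_trapezoid_formula\<close> outside the series.
\<close>

lemma trapezoid_int_0:
  assumes "-1 < s" "s < (0::real)"
  shows "((\<lambda>u. (u - u\<^sup>2) / 2 * (real 0 + u) powr (- (s + 2))) has_integral 1 / (2 * s * (s - 1))) {0..1}"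
proof -
  have "((\<lambda>u. (u powr (- s - 1) - u powr (- s)) / 2) has_integral (1 powr (- s - 1 + 1) / (- s - 1 + 1) - 1 powr (- s + 1) / (- s + 1)) / 2) {0..1}"
    using assms by (intro has_integral_divide has_integral_diff has_integral_powr_from_0) auto
  also have "(1 powr (- s - 1 + 1) / (- s - 1 + 1) - 1 powr (- s + 1) / (- s + 1)) / 2 = 1 / (2 * s * (s - 1))"
    using assms by (simp add: field_simps)
  finally show ?thesis
  proof (rule has_integral_eq[rotated])
    fix u :: real assume "u \<in> {0..1}"
    have "u * u powr (- (s + 2)) = u powr (- s - 1)" "u\<^sup>2 * u powr (- (s + 2)) = u powr (- s)" if "u > 0"
    proof -
      have "u * u powr (- (s + 2)) = u powr (1 + - (s + 2))" unfolding powr_add using that by simp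
      also have "1 + - (s + 2) = - s - 1" by simp
      finally show "u * u powr (- (s + 2)) = u powr (- s - 1)" .
      have "u\<^sup>2 * u powr (- (s + 2)) = u powr (2 + - (s + 2))" unfolding powr_add using that by (simp add: powr_numeral)
      thus "u\<^sup>2 * u powr (- (s + 2)) = u powr (- s)" by simp
    qed
    moreover have "(u - u\<^sup>2) / 2 * P = (u * P - u\<^sup>2 * P) / 2" for P by (simp add: left_diff_distrib)
    ultimately show "(u powr (- s - 1) - u powr (- s)) / 2 = (u - u\<^sup>2) / 2 * (real 0 + u) powr (- (s + 2))"
      using \<open>u \<in> _\<close> by (cases "u = 0") simp_all
  qed
qed

lemma trapezoid_int_Suc:
  shows "((\<lambda>u. (u - u\<^sup>2) / 2 * (real (Suc n) + u) powr (- (s + 2))) has_integral trapezoid_int s (Suc n)) {0..1}"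
    "per_int trapezoid_kernel (of_real s + 2) n = - of_real (trapezoid_int s (Suc n))"
proof -
  have "(\<lambda>u. (u - u\<^sup>2) / 2 * (real (Suc n) + u) powr (- (s + 2))) integrable_on {0..1}"
    by (intro integrable_continuous_interval continuous_intros) auto
  thus 1: "((\<lambda>u. (u - u\<^sup>2) / 2 * (real (Suc n) + u) powr (- (s + 2))) has_integral trapezoid_int s (Suc n)) {0..1}"
    unfolding trapezoid_int_def by (rule integrable_integral)
  have hi: "((\<lambda>u. - of_real ((u - u\<^sup>2) / 2 * (real (Suc n) + u) powr (- (s + 2)))) has_integral - complex_of_real (trapezoid_int s (Suc n))) {0..1}"
    by (intro has_integral_neg has_integral_of_real 1)
  have eq: "- of_real ((u - u\<^sup>2) / 2 * (real (Suc n) + u) powr (- (s + 2))) = trapezoid_kernel u * of_real (real n + 1 + u) powr (- (of_real s + 2))"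
    if "u \<in> {0..1}" for u
  proof -
    have "of_real (real n + 1 + u) powr (of_real (- (s + 2))) = complex_of_real ((real n + 1 + u) powr (- (s + 2)))"
      using that by (intro powr_of_real) auto
    moreover have "complex_of_real (- (s + 2)) = - (of_real s + 2)" by simp
    ultimately have e1: "of_real (real n + 1 + u) powr (- (of_real s + 2)) = complex_of_real ((real n + 1 + u) powr (- (s + 2)))"
      by (simp only:)
    have e2: "real (Suc n) + u = real n + 1 + u" by simp
    have "- ((u - u\<^sup>2) / 2 * P) = (u\<^sup>2 - u) / 2 * P" for P by (simp add: field_simps)
    thus ?thesis unfolding trapezoid_kernel_def e1 e2 of_real_mult[symmetric] of_real_minus[symmetric] by (rule arg_cong)
  qed
  have "((\<lambda>u. trapezoid_kernel u * of_real (real n + 1 + u) powr (- (of_real s + 2))) has_integral - complex_of_real (trapezoid_int s (Suc n))) {0..1}"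
    by (rule has_integral_eq[OF eq hi])
  thus "per_int trapezoid_kernel (of_real s + 2) n = - of_real (trapezoid_int s (Suc n))"
    unfolding per_int_def by (rule integral_unique)
qed

lemma trapezoid_int_nonneg: "trapezoid_int s n \<ge> 0"
proof -
  have "0 \<le> (u - u\<^sup>2) / 2 * (real n + u) powr (- (s + 2))" if "u \<in> {0..1}" for u
  proof -
    have "u * u \<le> u * 1" using that by (intro mult_left_mono) auto
    thus ?thesis by (simp add: power2_eq_square)
  qed
  thus ?thesis unfolding trapezoid_int_def
  proof (cases "(\<lambda>u. (u - u\<^sup>2) / 2 * (real n + u) powr (- (s + 2))) integrable_on {0..1}")
    case False
    show "0 \<le> integral {0..1} (\<lambda>u. (u - u\<^sup>2) / 2 * (real n + u) powr (- (s + 2)))"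
      unfolding not_integrable_integral[OF False] by simp
  qed (rule Henstock_Kurzweil_Integration.integral_nonneg)
qed

text \<open>
  Tonelli's theorem moves the Mellin transform inside, where \<open>x\<^sup>2 exp (- v x)\<close>
  becomes \<open>Gamma (s + 2) * v powr (- (s + 2))\<close>.
\<close>

lemma mellin_by_trapezoids:
  assumes s: "-1 < s" "s < (0::real)"
  shows "(\<integral>\<^sup>+x. ennreal (coth_kernel x * x powr (s - 1)) * indicator {0<..} x \<partial>lborel) =
    (\<Sum>n. ennreal (Gamma (s + 2) * trapezoid_int s n))"
proof -
  let ?b = "\<lambda>u::real. (u - u\<^sup>2) / 2"
  have b0: "?b u \<ge> 0" if "u \<in> {0..1}" for u
  proof -
    have "u * u \<le> u * 1" using that by (intro mult_left_mono) auto
    thus ?thesis by (simp add: power2_eq_square)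
  qed
  have G: "Gamma (s + 2) > 0" using s by (intro Gamma_real_pos) auto
  let ?F = "\<lambda>n x u. ennreal (x powr ((s + 2) - 1) * exp (- (real n + u) * x)) * indicator {0<..} x * (ennreal (?b u) * indicator {0..1} u)"
  have "(\<integral>\<^sup>+x. ennreal (coth_kernel x * x powr (s - 1)) * indicator {0<..} x \<partial>lborel) =
     (\<integral>\<^sup>+x. (\<Sum>n. \<integral>\<^sup>+u. ?F n x u \<partial>lborel) \<partial>lborel)"
  proof (rule nn_integral_cong)
    fix x :: real
    show "ennreal (coth_kernel x * x powr (s - 1)) * indicator {0<..} x = (\<Sum>n. \<integral>\<^sup>+u. ?F n x u \<partial>lborel)"
    proof (cases "x > 0")
      case True
      have "x powr (s + 1) = x powr (s - 1) * x\<^sup>2"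
      proof -
        have "x powr ((s - 1) + 2) = x powr (s - 1) * x\<^sup>2"
          unfolding powr_add using True by (simp add: powr_numeral)
        moreover have "(s - 1) + 2 = s + 1" by simp
        ultimately show ?thesis by (simp only:)
      qed
      hence pw: "x powr ((s + 2) - 1) = x powr (s - 1) * x\<^sup>2" by (simp add: add.commute)
      have "(\<Sum>n. \<integral>\<^sup>+u. ?F n x u \<partial>lborel) = (\<Sum>n. \<integral>\<^sup>+u. ennreal (x powr (s - 1)) *
         (ennreal (?b u * (x\<^sup>2 * exp (- (real n + u) * x))) * indicator {0..1} u) \<partial>lborel)"
      proof (intro suminf_cong nn_integral_cong)
        fix n u
        show "?F n x u = ennreal (x powr (s - 1)) * (ennreal (?b u * (x\<^sup>2 * exp (- (real n + u) * x))) * indicator {0..1} u)"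
        proof (cases "u \<in> {0..1}")
          case u: True
          let ?e = "exp (- (real n + u) * x)"
          have "ennreal (x powr (s - 1) * x\<^sup>2 * ?e) * ennreal (?b u) = ennreal (x powr (s - 1) * x\<^sup>2 * ?e * ?b u)"
            by (rule ennreal_mult[symmetric]) (use b0[OF u] in simp_all)
          also have "x powr (s - 1) * x\<^sup>2 * ?e * ?b u = x powr (s - 1) * (?b u * (x\<^sup>2 * ?e))"
            by (simp only: mult_ac)
          also have "ennreal \<dots> = ennreal (x powr (s - 1)) * ennreal (?b u * (x\<^sup>2 * ?e))"
            by (rule ennreal_mult) (use b0[OF u] in simp_all)
          finally show ?thesis unfolding pw using True u by simp
        qed simp
      qed
      also have "\<dots> = (\<Sum>n. ennreal (x powr (s - 1)) * (\<integral>\<^sup>+u. 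
         (ennreal (?b u * (x\<^sup>2 * exp (- (real n + u) * x))) * indicator {0..1} u) \<partial>lborel))"
        by (intro suminf_cong nn_integral_cmult) auto
      also have "\<dots> = ennreal (x powr (s - 1)) * ennreal (coth_kernel x)"
        unfolding coth_kernel_as_integrals[OF True] by (rule ennreal_suminf_cmult)
      also have "\<dots> = ennreal (x powr (s - 1) * coth_kernel x)"
        by (rule ennreal_mult[symmetric]) (use coth_kernel_nonneg[OF True] in simp_all)
      finally show ?thesis using True by (simp only: mult.commute[of "coth_kernel x"]) simp
    qed auto
  qed
  also have "\<dots> = (\<Sum>n. \<integral>\<^sup>+x. (\<integral>\<^sup>+u. ?F n x u \<partial>lborel) \<partial>lborel)"
    by (rule nn_integral_suminf) measurable
  also have "\<dots> = (\<Sum>n. \<integral>\<^sup>+u. (\<integral>\<^sup>+x. ?F n x u \<partial>lborel) \<partial>lborel)"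
    by (intro suminf_cong lborel_pair.Fubini') measurable
  also have "\<dots> = (\<Sum>n. \<integral>\<^sup>+u. ennreal (Gamma (s + 2)) * (ennreal (?b u * (real n + u) powr (- (s + 2))) * indicator {0..1} u) \<partial>lborel)"
  proof (intro suminf_cong nn_integral_cong)
    fix n :: nat and u :: real
    have "(\<integral>\<^sup>+x. ?F n x u \<partial>lborel) = (\<integral>\<^sup>+x. ennreal (x powr ((s + 2) - 1) * exp (- (real n + u) * x)) * indicator {0<..} x \<partial>lborel) * (ennreal (?b u) * indicator {0..1} u)"
      by (rule nn_integral_multc) auto
    also have "\<dots> = ennreal (Gamma (s + 2)) * (ennreal (?b u * (real n + u) powr (- (s + 2))) * indicator {0..1} u)"
    proof (cases "u \<in> {0<..1}")
      case True
      hence u: "u \<in> {0..1}" "real n + u > 0" by auto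
      have "ennreal (Gamma (s + 2) * (real n + u) powr (- (s + 2))) * ennreal (?b u) =
          ennreal (Gamma (s + 2) * (real n + u) powr (- (s + 2)) * ?b u)"
        by (rule ennreal_mult[symmetric]) (use b0[OF u(1)] G in simp_all)
      also have "Gamma (s + 2) * (real n + u) powr (- (s + 2)) * ?b u = Gamma (s + 2) * (?b u * (real n + u) powr (- (s + 2)))"
        by (simp only: mult_ac)
      also have "ennreal \<dots> = ennreal (Gamma (s + 2)) * ennreal (?b u * (real n + u) powr (- (s + 2)))"
        by (rule ennreal_mult) (use b0[OF u(1)] G in simp_all)
      finally show ?thesis using s u by (subst nn_integral_Gamma_scaled) simp_all
    qed (auto simp: indicator_def)
    finally show "(\<integral>\<^sup>+x. ?F n x u \<partial>lborel) = ennreal (Gamma (s + 2)) * (ennreal (?b u * (real n + u) powr (- (s + 2))) * indicator {0..1} u)" .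
  qed
  also have "\<dots> = (\<Sum>n. ennreal (Gamma (s + 2)) * (\<integral>\<^sup>+u. (ennreal (?b u * (real n + u) powr (- (s + 2))) * indicator {0..1} u) \<partial>lborel))"
    by (intro suminf_cong nn_integral_cmult) auto
  also have "\<dots> = (\<Sum>n. ennreal (Gamma (s + 2)) * ennreal (trapezoid_int s n))"
  proof (intro suminf_cong arg_cong2[where f = "(*)"] refl)
    fix n
    have "((\<lambda>u. ?b u * (real n + u) powr (- (s + 2))) has_integral trapezoid_int s n) {0..1}"
    proof (cases n)
      case 0
      have "trapezoid_int s 0 = 1 / (2 * s * (s - 1))" unfolding trapezoid_int_def by (rule integral_unique[OF trapezoid_int_0[OF s]])
      thus ?thesis unfolding 0 using trapezoid_int_0[OF s] by (simp only:)
    qed (use trapezoid_int_Suc(1) in auto)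
    thus "(\<integral>\<^sup>+u. (ennreal (?b u * (real n + u) powr (- (s + 2))) * indicator {0..1} u) \<partial>lborel) = ennreal (trapezoid_int s n)"
      using b0 by (intro nn_integral_has_integral_lebesgue') auto
  qed
  finally show ?thesis using G trapezoid_int_nonneg by (simp add: ennreal_mult'[symmetric])
qed

text \<open>
  The two evaluations of the Mellin transform are compared; \<open>Gamma (s + 2) = (s + 1) s Gamma
  s\<close> absorbs the factor of the error series.
\<close>

lemma zeta_Gamma_negative:
  assumes s: "-1 < s" "s < (0::real)"
  shows "Gamma s * Re (zeta (of_real s)) = (2 * pi) powr (s - 1) * pi / cos (pi * s / 2) * Re (zeta (of_real (1 - s)))"
    and "zeta (of_real s) = of_real (Re (zeta (of_real s)))"
proof -
  have G: "Gamma (s + 2) > 0" using s by (intro Gamma_real_pos) auto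
  have "per_int trapezoid_kernel (of_real s + 2) sums trapezoid_series (of_real s + 2)" using s by (intro trapezoid_series(2)) simp
  hence 1: "(\<lambda>n. - complex_of_real (trapezoid_int s (Suc n))) sums trapezoid_series (of_real s + 2)"
    by (simp add: trapezoid_int_Suc(2)[abs_def])
  define q where "q = - Re (trapezoid_series (of_real s + 2))"
  have q: "(\<lambda>n. trapezoid_int s (Suc n)) sums q"
    unfolding q_def using sums_minus[OF sums_Re[OF 1]] by simp
  have zq: "trapezoid_series (of_real s + 2) = - of_real q"
    using sums_unique2[OF 1 sums_minus[OF sums_of_real[OF q]]] by simp
  have t0: "trapezoid_int s 0 = 1 / (2 * s * (s - 1))" unfolding trapezoid_int_def by (rule integral_unique[OF trapezoid_int_0[OF s]])
  have tq: "trapezoid_int s sums (q + 1 / (2 * s * (s - 1)))" using q unfolding t0[symmetric] by (rule sums_Suc)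
  have z: "zeta (of_real s) = of_real (1/2 + 1 / (s - 1) + s * (s + 1) * q)"
    using s by (subst zeta_trapezoid_formula) (auto simp: zq)
  show "zeta (of_real s) = of_real (Re (zeta (of_real s)))" unfolding z by simp
  have g: "Gamma (s + 2) = (s + 1) * s * Gamma s"
  proof -
    have "s \<notin> \<int>"
    proof
      assume "s \<in> \<int>"
      then obtain n where n: "s = of_int n" by (elim Ints_cases)
      hence "n > -1" "n < 0" using s by linarith+
      thus False by simp
    qed
    hence nz: "s \<notin> \<int>\<^sub>\<le>\<^sub>0" "s + 1 \<notin> \<int>\<^sub>\<le>\<^sub>0" using nonpos_Ints_Int
      by (metis, metis Ints_1 Ints_diff add_diff_cancel_right')
    have "Gamma (s + 1 + 1) = (s + 1) * (s * Gamma s)"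
      unfolding Gamma_plus1[OF nz(2)] Gamma_plus1[OF nz(1)] ..
    moreover have "s + 1 + 1 = s + 2" by simp
    ultimately show ?thesis by (simp only: mult.assoc)
  qed
  have "ennreal ((2 * pi) powr (s - 1) * pi / cos (pi * s / 2) * Re (zeta (of_real (1 - s)))) = (\<Sum>n. ennreal (Gamma (s + 2) * trapezoid_int s n))"
    unfolding mellin_by_fractions[OF s, symmetric] mellin_by_trapezoids[OF s] ..
  also have "\<dots> = ennreal (Gamma (s + 2) * (q + 1 / (2 * s * (s - 1))))"
    using G trapezoid_int_nonneg by (intro suminf_ennreal_eq sums_mult tq) auto
  finally have "(2 * pi) powr (s - 1) * pi / cos (pi * s / 2) * Re (zeta (of_real (1 - s))) = Gamma (s + 2) * (q + 1 / (2 * s * (s - 1)))"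
  proof (subst (asm) ennreal_inj)
    have "0 \<le> q + 1 / (2 * s * (s - 1))" using sums_le[OF _ sums_zero tq] trapezoid_int_nonneg by simp
    thus "0 \<le> Gamma (s + 2) * (q + 1 / (2 * s * (s - 1)))" using G by simp
    have "0 \<le> Re (zeta (of_real (1 - s)))"
      by (rule sums_le[OF _ sums_zero powr_sum_real(1)]) (use s in auto)
    moreover have "cos (pi * s / 2) > 0" by (rule cos_half_pos) (use s in auto)
    ultimately show "0 \<le> (2 * pi) powr (s - 1) * pi / cos (pi * s / 2) * Re (zeta (of_real (1 - s)))" by simp
  qed
  also have "\<dots> = Gamma s * Re (zeta (of_real s))"
    unfolding g z using s by (simp add: field_simps)
  finally show "Gamma s * Re (zeta (of_real s)) = (2 * pi) powr (s - 1) * pi / cos (pi * s / 2) * Re (zeta (of_real (1 - s)))" ..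
qed

text \<open>
  Reflection and the double angle formula turn \<open>\<pi> / (cos (\<pi> s / 2) Gamma s)\<close>
  into \<open>2 sin (\<pi> s / 2) Gamma (1 - s)\<close>.
\<close>

lemma functional_equation_negative:
  assumes s: "-1 < s" "s < (0::real)"
  shows "zeta (of_real s) = chi (of_real s) * zeta (1 - of_real s)"
proof -
  have cpos: "cos (pi * s / 2) > 0" by (rule cos_half_pos) (use s in auto)
  have sneg: "sin (pi * s / 2) < 0"
  proof -
    have "pi * (-1) < pi * s" using s by (intro mult_strict_left_mono) auto
    moreover have "pi * s < 0" using s by (intro mult_pos_neg) auto
    ultimately have "0 < sin (- (pi * s / 2))" by (intro sin_gt_zero) auto
    thus ?thesis by simp
  qed
  have refl: "Gamma s * Gamma (1 - s) = pi / sin (pi * s)"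
  proof -
    have "complex_of_real (Gamma s * Gamma (1 - s)) = of_real (pi / sin (pi * s))"
      using Gamma_reflection_complex[of "of_real s"]
      by (simp add: Gamma_complex_of_real[symmetric] sin_of_real[symmetric] del: sin_of_real)
    thus ?thesis by (simp only: of_real_eq_iff)
  qed
  have sin2: "sin (pi * s) = 2 * sin (pi * s / 2) * cos (pi * s / 2)"
    using sin_double[of "pi * s / 2"] by simp
  have sp: "sin (pi * s) \<noteq> 0" unfolding sin2 using cpos sneg by simp
  have G0: "Gamma s \<noteq> 0" using refl sp by auto
  have G1: "Gamma (1 - s) = pi / (2 * sin (pi * s / 2) * cos (pi * s / 2)) / Gamma s"
  proof -
    have "Gamma (1 - s) = pi / sin (pi * s) / Gamma s"
      unfolding refl[symmetric] using G0 by simp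
    thus ?thesis unfolding sin2 .
  qed
  define R where "R = 2 powr s * pi powr (s - 1) * sin (pi * s / 2) * Gamma (1 - s)"
  have "complex_of_real (2 powr s) = of_real 2 powr of_real s" by (rule powr_of_real[symmetric]) auto
  moreover have "complex_of_real (pi powr (s - 1)) = of_real pi powr of_real (s - 1)" by (rule powr_of_real[symmetric]) auto
  moreover have "complex_of_real (sin (pi * s / 2)) = sin (of_real (pi * s / 2))" by (rule sin_of_real[symmetric])
  moreover have "complex_of_real (Gamma (1 - s)) = Gamma (of_real (1 - s))" by (rule Gamma_complex_of_real[symmetric])
  ultimately have chi: "chi (of_real s) = of_real R"
    unfolding chi_def R_def by (simp add: mult.commute[of _ "complex_of_real s"])
  have "R * Re (zeta (of_real (1 - s))) = 2 powr s * pi powr (s - 1) * pi / (2 * cos (pi * s / 2)) * Re (zeta (of_real (1 - s))) / Gamma s"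
    unfolding R_def G1 using sneg by (simp add: field_simps)
  also have "2 powr s * pi powr (s - 1) * pi / (2 * cos (pi * s / 2)) = (2 * pi) powr (s - 1) * pi / cos (pi * s / 2)"
    by (simp add: powr_mult powr_diff)
  also have "(2 * pi) powr (s - 1) * pi / cos (pi * s / 2) * Re (zeta (of_real (1 - s))) = Gamma s * Re (zeta (of_real s))"
    using zeta_Gamma_negative(1)[OF s] ..
  finally have "R * Re (zeta (of_real (1 - s))) = Re (zeta (of_real s))" using G0 by simp
  hence "complex_of_real R * of_real (Re (zeta (of_real (1 - s)))) = of_real (Re (zeta (of_real s)))"
    unfolding of_real_mult[symmetric] by (rule arg_cong)
  thus ?thesis
    unfolding chi using zeta_Gamma_negative(2)[OF s] powr_sum_real(2)[of "1 - s"] s by simp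
qed

text \<open>
  A starlike domain that contains \<open>(-1, 0)\<close> and all non-real points, and on which no
  factor of the functional equation has a pole.
\<close>

definition slit_plane :: "complex set" where "slit_plane = - {z. Im z = 0 \<and> Re z \<ge> 0}"

lemma open_slit_plane: "open slit_plane"
proof -
  have eq: "slit_plane = {z. Re z < 0} \<union> {z. Im z < 0} \<union> {z. Im z > 0}"
    by (auto simp: slit_plane_def)
  show ?thesis unfolding eq
    by (intro open_Un open_halfspace_Re_lt open_halfspace_Im_lt open_halfspace_Im_gt)
qed

lemma connected_slit_plane: "connected slit_plane"
proof -
  have "starlike slit_plane"
    unfolding starlike_def
  proof (intro bexI[of _ "-1"] ballI subsetI)
    show "-1 \<in> slit_plane" by (simp add: slit_plane_def)
    fix x z :: complex assume x: "x \<in> slit_plane" and z: "z \<in> closed_segment (-1) x"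
    then obtain u where u: "0 \<le> u" "u \<le> 1" "z = (1 - u) *\<^sub>R (-1) + u *\<^sub>R x"
      by (auto simp: in_segment)
    show "z \<in> slit_plane"
    proof (cases "Im x = 0")
      case True
      hence "Re x < 0" using x by (auto simp: slit_plane_def)
      hence "u * Re x \<le> 0" using u by (intro mult_nonneg_nonpos) auto
      moreover have "u * Re x < 0" if "u = 1" using that \<open>Re x < 0\<close> by simp
      ultimately have "Re z < 0" using u by (cases "u = 1") auto
      thus ?thesis by (simp add: slit_plane_def)
    next
      case False
      thus ?thesis using u by (cases "u = 0") (auto simp: slit_plane_def)
    qed
  qed
  thus ?thesis by (rule starlike_imp_connected)
qed

lemma chi_holomorphic: "chi holomorphic_on slit_plane"
proof -
  have "1 - s \<notin> \<int>\<^sub>\<le>\<^sub>0" if "s \<in> slit_plane" for s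
    using that by (auto elim!: nonpos_Ints_cases simp: slit_plane_def complex_eq_iff)
  thus ?thesis unfolding chi_def by (intro holomorphic_intros) auto
qed

text \<open>
  Analytic continuation from \<open>(-1, 0)\<close>, which accumulates at \<open>-1/2\<close>.
\<close>

theorem functional_equation:
  assumes "s \<in> slit_plane"
  shows "zeta s = chi s * zeta (1 - s)"
proof -
  let ?f = "\<lambda>s. zeta s - chi s * zeta (1 - s)"
  have "?f s = 0"
  proof (rule analytic_continuation[of ?f slit_plane "of_real ` {-1<..<0}" "- 1 / 2"])
    have "zeta holomorphic_on slit_plane"
      by (rule holomorphic_on_subset[OF zeta_holomorphic]) (auto simp: slit_plane_def)
    moreover have "(\<lambda>s. zeta (1 - s)) holomorphic_on slit_plane"
      by (intro holomorphic_on_compose_gen[OF _ zeta_holomorphic, unfolded o_def] holomorphic_intros)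
         (auto simp: slit_plane_def)
    ultimately show "?f holomorphic_on slit_plane"
      by (intro holomorphic_intros chi_holomorphic)
    show "of_real ` {-1<..<0} \<subseteq> slit_plane" by (auto simp: slit_plane_def)
    show "- 1 / 2 \<in> slit_plane" by (simp add: slit_plane_def)
    show "- 1 / 2 islimpt complex_of_real ` {-1<..<0}"
      unfolding islimpt_approachable
    proof (intro allI impI)
      fix e :: real assume e: "e > 0"
      define d where "d = min (e / 2) (1 / 4)"
      have d: "d > 0" "d < e" "d \<le> 1/4" using e by (auto simp: d_def)
      show "\<exists>x'\<in>complex_of_real ` {- 1<..<0}. x' \<noteq> - 1 / 2 \<and> dist x' (- 1 / 2) < e"
      proof (intro bexI conjI)
        have "complex_of_real (- 1 / 2 + d) - (- 1 / 2) = of_real d" by simp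
        thus "dist (complex_of_real (- 1 / 2 + d)) (- 1 / 2) < e" "complex_of_real (- 1 / 2 + d) \<noteq> - 1 / 2"
          using d by (simp_all add: dist_norm)
        show "complex_of_real (- 1 / 2 + d) \<in> complex_of_real ` {- 1<..<0}"
          by (rule imageI) (use d in auto)
      qed
    qed
    show "?f z = 0" if "z \<in> of_real ` {-1<..<0}" for z
      using that functional_equation_negative by auto
  qed (use assms open_slit_plane connected_slit_plane in auto)
  thus ?thesis by simp
qed

lemma chi_nonzero_off_axis:
  assumes "Im s \<noteq> 0" shows "chi s \<noteq> 0"
proof -
  have "sin (1/2 * complex_of_real pi * s) \<noteq> 0"
  proof
    assume "sin (1/2 * complex_of_real pi * s) = 0"
    then obtain n :: int where n: "1/2 * complex_of_real pi * s = of_real (n * pi)"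
      by (auto simp: Complex_Transcendental.sin_eq_0)
    from arg_cong[OF n, of Im] show False using assms by simp
  qed
  moreover have "Gamma (1 - s) \<noteq> 0"
    using assms by (subst Gamma_eq_zero_iff) (auto elim!: nonpos_Ints_cases simp: complex_eq_iff)
  ultimately show ?thesis by (simp add: chi_def)
qed

text \<open>
  The logarithmic derivative of \<open>chi\<close>, factor by factor.
\<close>

definition chi_dlog :: "complex \<Rightarrow> complex" where
  "chi_dlog s = Ln 2 + Ln (of_real pi) + of_real pi / 2 * cot (of_real pi * s / 2) - Digamma (1 - s)"

lemma has_field_derivative_chi:
  assumes "Im s \<noteq> 0" shows "(chi has_field_derivative chi s * chi_dlog s) (at s)"
proof -
  have sn: "sin (of_real pi * s / 2) \<noteq> 0"
    using chi_nonzero_off_axis[OF assms] by (auto simp: chi_def)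
  have gn: "1 - s \<notin> \<int>\<^sub>\<le>\<^sub>0"
    using assms by (auto elim!: nonpos_Ints_cases simp: complex_eq_iff)
  have 1: "((\<lambda>s. 2 powr s) has_field_derivative 2 powr s * Ln 2) (at s)"
    by (auto intro!: derivative_eq_intros has_field_derivative_powr_right)
  have 2: "((\<lambda>s. of_real pi powr (s - 1)) has_field_derivative of_real pi powr (s - 1) * Ln (of_real pi)) (at s)"
    by (rule DERIV_cong[OF DERIV_chain2[OF has_field_derivative_powr_right]]) (auto intro!: derivative_eq_intros)
  have 3: "((\<lambda>s. sin (1/2 * of_real pi * s)) has_field_derivative sin (of_real pi * s / 2) * (of_real pi / 2 * cot (of_real pi * s / 2))) (at s)"
    using sn by (auto intro!: derivative_eq_intros simp: cot_def)
  have 4: "((\<lambda>s. Gamma (1 - s)) has_field_derivative Gamma (1 - s) * (- Digamma (1 - s))) (at s)"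
    using gn by (auto intro!: derivative_eq_intros)
  show ?thesis
    unfolding chi_def[abs_def]
    by (rule DERIV_cong[OF DERIV_mult[OF DERIV_mult[OF DERIV_mult[OF 1 2] 3] 4]])
       (simp add: chi_dlog_def algebra_simps)
qed

lemma zeta_logderiv_reflect:
  assumes s: "Im s \<noteq> 0" and z: "zeta s \<noteq> 0"
  shows "deriv zeta s / zeta s = chi_dlog s - deriv zeta (1 - s) / zeta (1 - s)"
proof -
  have sl: "s \<in> slit_plane" using s by (simp add: slit_plane_def)
  have z1: "zeta (1 - s) \<noteq> 0" using functional_equation[OF sl] z by auto
  have d1: "(zeta has_field_derivative deriv zeta (1 - s)) (at (1 - s))"
    by (rule holomorphic_derivI[OF zeta_holomorphic]) (use s in auto)
  have "((\<lambda>s. chi s * zeta (1 - s)) has_field_derivative chi s * chi_dlog s * zeta (1 - s) + (deriv zeta (1 - s) * (-1)) * chi s) (at s)"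
  proof (intro DERIV_mult has_field_derivative_chi s)
    show "((\<lambda>s. zeta (1 - s)) has_field_derivative deriv zeta (1 - s) * (-1)) (at s)"
      by (rule DERIV_chain2[where f = zeta and g = "\<lambda>s. 1 - s", OF d1]) (auto intro!: derivative_eq_intros)
  qed
  moreover have "eventually (\<lambda>s. s \<in> slit_plane) (nhds s)" using sl open_slit_plane by (rule eventually_nhds_in_open[rotated])
  hence ev: "eventually (\<lambda>s. chi s * zeta (1 - s) = zeta s) (nhds s)"
    by eventually_elim (simp add: functional_equation)
  ultimately have "(zeta has_field_derivative chi s * chi_dlog s * zeta (1 - s) + (deriv zeta (1 - s) * (-1)) * chi s) (at s)"
    using iffD1[OF DERIV_cong_ev[OF refl ev refl]] by blast
  hence "deriv zeta s = chi s * chi_dlog s * zeta (1 - s) - deriv zeta (1 - s) * chi s"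
    by (simp add: DERIV_imp_deriv)
  thus ?thesis unfolding functional_equation[OF sl] using z1 chi_nonzero_off_axis[OF s] by (simp add: field_simps)
qed

lemma cot_bound:
  fixes z :: complex
  assumes "Im z \<ge> 1 \<or> Im z \<le> -1" shows "norm (cot z) \<le> 2"
proof -
  define E where "E = exp (2 * Im z)"
  have E0: "E > 0" by (simp add: E_def)
  have big: "E + inverse E \<ge> 4"
  proof -
    have "(2::real)\<^sup>2 \<le> exp 1 ^ 2"
      using exp_ge_add_one_self[of "1::real"] by (intro power_mono) auto
    moreover have "exp (2::real) = exp 1 ^ 2" using exp_double[of "1::real"] by simp
    ultimately have e2: "exp 2 \<ge> (4::real)" by simp
    have "E \<ge> exp 2 \<or> inverse E \<ge> exp 2"
      using assms unfolding E_def exp_minus[symmetric] by auto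
    thus ?thesis using e2 E0 by (auto intro: add_increasing add_increasing2)
  qed
  define c where "c = cos (2 * Re z)"
  have c: "c \<le> 1" "c \<ge> -1" by (auto simp: c_def)
  have E: "exp (Im z) * exp (Im z) = E" "exp (Im z) * inverse (exp (Im z)) = 1"
    "inverse (exp (Im z)) * inverse (exp (Im z)) = inverse E"
    by (simp_all add: E_def flip: exp_add exp_minus inverse_mult_distrib)
  have n1: "(norm (cos z))\<^sup>2 = (E + inverse E + 2 * c) / 4"
  proof -
    have "(exp (Im z) - inverse (exp (Im z)))\<^sup>2 = E + inverse E - 2"
    proof -
      have "(a - b)\<^sup>2 = a * a + b * b - 2 * (a * b)" for a b :: real
        by (simp add: power2_eq_square algebra_simps)
      from this[of "exp (Im z)" "inverse (exp (Im z))"] show ?thesis unfolding E by simp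
    qed
    hence "(norm (cos z))\<^sup>2 = (cos (Re z))\<^sup>2 + (E + inverse E - 2) / 4"
      unfolding norm_cos_squared by (rule arg_cong)
    moreover have "(cos (Re z))\<^sup>2 = (1 + c) / 2" unfolding c_def cos_double_cos by simp
    ultimately show ?thesis by argo
  qed
  have n2: "(norm (sin z))\<^sup>2 = (E + inverse E - 2 * c) / 4" unfolding E_def c_def norm_sin_squared ..
  have "(norm (cos z))\<^sup>2 \<le> (2 * norm (sin z))\<^sup>2"
    unfolding power_mult_distrib n1 n2 using big c by simp
  hence "norm (cos z) \<le> 2 * norm (sin z)" by (rule power2_le_imp_le) auto
  moreover have "norm (sin z) > 0"
  proof -
    have "(norm (sin z))\<^sup>2 > 0" unfolding n2 using big c by simp
    thus ?thesis by simp
  qed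
  ultimately show ?thesis unfolding cot_def norm_divide by (simp add: divide_simps)
qed

lemma Digamma_sums:
  fixes w :: complex assumes "w \<noteq> 0"
  shows "(\<lambda>k. inverse (of_nat (Suc k)) - inverse (w + of_nat k)) sums (Digamma w + euler_mascheroni)"
  using summable_Digamma[OF assms] unfolding Digamma_def by (simp add: summable_sums)

text \<open>
  A crude bound suffices: on the upper side of the rectangle an error of order \<open>T\<close> is
  allowed.
\<close>

lemma Digamma_linear_bound:
  fixes w :: complex assumes w: "Re w \<ge> 1/2"
  shows "norm (Digamma w) \<le> 4 * norm (w - 1) + 1"
proof -
  let ?r = "\<lambda>n. inverse ((real (Suc n))\<^sup>2)"
  have r: "?r sums (pi\<^sup>2 / 6)" using inverse_squares_sums by (simp add: inverse_eq_divide add.commute)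
  have w0: "w \<noteq> 0" using w by auto
  have b: "norm (inverse (of_nat (Suc k)) - inverse (w + of_nat k)) \<le> 2 * norm (w - 1) * ?r k" for k
  proof -
    have wk: "w + of_nat k \<noteq> 0" using w by (auto simp: complex_eq_iff)
    have "real (Suc k) / 2 \<le> Re (w + of_nat k)" using w by simp
    also have "\<dots> \<le> norm (w + of_nat k)" by (rule complex_Re_le_cmod)
    finally have n: "real (Suc k) / 2 \<le> norm (w + of_nat k)" .
    have "inverse a - inverse b = (b - a) / (a * b)" if "a \<noteq> 0" "b \<noteq> 0" for a b :: complex
      using that by (simp add: field_simps)
    from this[OF of_nat_neq_0[of k] wk]
    have "inverse (of_nat (Suc k)) - inverse (w + of_nat k) = (w - 1) / (of_nat (Suc k) * (w + of_nat k))"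
      by simp
    hence "norm (inverse (of_nat (Suc k)) - inverse (w + of_nat k)) = norm (w - 1) / (real (Suc k) * norm (w + of_nat k))"
      by (simp only: norm_divide norm_mult norm_of_nat)
    also have "\<dots> \<le> norm (w - 1) / (real (Suc k) * (real (Suc k) / 2))"
      using wk by (intro divide_left_mono mult_left_mono n mult_pos_pos) simp_all
    also have "\<dots> = 2 * norm (w - 1) * ?r k" by (simp add: power2_eq_square inverse_eq_divide del: of_nat_Suc)
    finally show ?thesis .
  qed
  have "norm (\<Sum>k. inverse (of_nat (Suc k)) - inverse (w + of_nat k)) \<le> (\<Sum>k. 2 * norm (w - 1) * ?r k)"
    by (rule norm_suminf_le[OF b summable_mult[OF sums_summable[OF r]]])
  also have "(\<Sum>k. 2 * norm (w - 1) * ?r k) = 2 * norm (w - 1) * (pi\<^sup>2 / 6)"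
    by (rule sums_unique[symmetric, OF sums_mult[OF r]])
  also have "\<dots> \<le> 2 * norm (w - 1) * 2"
  proof (rule mult_left_mono)
    have "pi\<^sup>2 \<le> 3.15\<^sup>2" using pi_approx by (intro power_mono) auto
    thus "pi\<^sup>2 / 6 \<le> 2" by (simp add: power2_eq_square)
  qed auto
  finally have "norm (Digamma w + euler_mascheroni) \<le> 4 * norm (w - 1)"
    using Digamma_sums[OF w0] by (simp add: sums_iff)
  moreover have "norm (euler_mascheroni :: complex) \<le> 1"
    unfolding of_real_euler_mascheroni[where 'a = complex, symmetric] norm_of_real
    using euler_mascheroni_less_13_over_22 euler_mascheroni_pos by linarith
  moreover have "norm (Digamma w) \<le> norm (Digamma w + euler_mascheroni) + norm (euler_mascheroni :: complex)"
    using norm_triangle_ineq4[of "Digamma w + euler_mascheroni" euler_mascheroni] by simp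
  ultimately show ?thesis by linarith
qed

text \<open>
  All terms of the series have nonnegative real part, so the first \<open>m\<close> of them,
  \<open>m\<close> about \<open>t\<close>, give a lower bound. Each is at least \<open>1 / (k + 1) -
  1 / (2 t)\<close>, whence the harmonic sum up to a bounded error.
\<close>

lemma Digamma_Re_lower:
  assumes t: "t \<ge> 1"
  shows "Re (Digamma (2 - \<i> * of_real t)) \<ge> ln t - 2"
proof -
  define w where "w = 2 - \<i> * complex_of_real t"
  have w0: "w \<noteq> 0" by (simp add: w_def complex_eq_iff)
  define a where "a = (\<lambda>k. 1 / real (Suc k) - (real k + 2) / ((real k + 2)\<^sup>2 + t\<^sup>2))"
  have "Re (inverse (of_nat (Suc k)) - inverse (w + of_nat k)) = a k" for k
  proof -
    have "inverse (of_nat (Suc k)) = complex_of_real (1 / real (Suc k))" by (simp add: inverse_eq_divide)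
    moreover have "Re (inverse (w + of_nat k)) = (real k + 2) / ((real k + 2)\<^sup>2 + t\<^sup>2)"
      by (simp add: w_def add.commute)
    ultimately show ?thesis by (simp add: a_def)
  qed
  hence a: "a sums (Re (Digamma w) + euler_mascheroni)"
    using sums_Re[OF Digamma_sums[OF w0]] by (simp add: of_real_euler_mascheroni[symmetric, where 'a=complex] del: of_real_euler_mascheroni)
  have a0: "a k \<ge> 0" for k
  proof -
    have "(real k + 2) / ((real k + 2)\<^sup>2 + t\<^sup>2) \<le> (real k + 2) / (real k + 2)\<^sup>2"
      by (intro divide_left_mono mult_pos_pos add_pos_nonneg) auto
    also have "\<dots> = 1 / (real k + 2)" by (simp add: power2_eq_square)
    also have "\<dots> \<le> 1 / real (Suc k)" by (intro divide_left_mono) auto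
    finally show ?thesis by (simp add: a_def)
  qed
  \<comment> \<open>with about \<open>t\<close> terms, the subtracted \<open>1 / (2 t)\<close> add up to at most 1\<close>
  define m where "m = nat \<lceil>t\<rceil>"
  have m: "real m \<ge> t" "real m \<le> 2 * t" using t by (auto simp: m_def) linarith+
  have "(\<Sum>k<m. a k) \<ge> (\<Sum>k<m. 1 / real (Suc k) - 1 / (2 * t))"
  proof (rule sum_mono)
    fix k
    have "2 * t * (real k + 2) \<le> (real k + 2)\<^sup>2 + t\<^sup>2" using sum_squares_bound[of t "real k + 2"] by simp
    moreover have "(real k + 2)\<^sup>2 + t\<^sup>2 > 0" by (intro add_pos_nonneg) auto
    ultimately have "(real k + 2) / ((real k + 2)\<^sup>2 + t\<^sup>2) \<le> 1 / (2 * t)" using t by (simp add: field_simps)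
    thus "1 / real (Suc k) - 1 / (2 * t) \<le> a k" by (simp add: a_def)
  qed
  also have "(\<Sum>k<m. 1 / real (Suc k) - 1 / (2 * t)) = harm m - real m / (2 * t)"
  proof -
    have "harm m = (\<Sum>k<m. 1 / real (Suc k))"
      by (induction m) (auto simp: harm_Suc inverse_eq_divide harm_expand(1))
    thus ?thesis by (simp add: sum_subtractf)
  qed
  finally have "harm m - real m / (2 * t) \<le> (\<Sum>k<m. a k)" .
  moreover have "real m / (2 * t) \<le> 1" using m t by (simp add: field_simps)
  moreover have "ln t \<le> harm m"
  proof -
    have "ln t \<le> ln (real m + 1)" using m t by (subst ln_le_cancel_iff) auto
    also have "\<dots> \<le> harm m" using ln_le_harm[of m] by (simp add: add.commute)
    finally show ?thesis .
  qed
  moreover have "(\<Sum>k<m. a k) \<le> Re (Digamma w) + euler_mascheroni"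
    using sum_le_suminf[OF sums_summable[OF a], of "{..<m}"] a0 a by (simp add: sums_iff)
  ultimately show ?thesis using euler_mascheroni_less_13_over_22 by (simp add: w_def)
qed

text \<open>
  The second bound is the source of the main term \<open>T log T\<close> in the number of zeros.
\<close>

lemma chi_dlog_bounds:
  "\<exists>C>0. (\<forall>s. \<bar>Im s\<bar> \<ge> 1 \<longrightarrow> Re s \<le> 1/2 \<longrightarrow> norm (chi_dlog s) \<le> C + 4 * norm s) \<and>
     (\<forall>t\<ge>1. Re (chi_dlog (-1 + \<i> * of_real t)) \<le> C - ln t)"
proof -
  define C where "C = norm (Ln 2 + Ln (of_real pi)) + pi + 3"
  have cot: "norm (of_real pi / 2 * cot (of_real pi * s / 2)) \<le> pi" if "\<bar>Im s\<bar> \<ge> 1" for s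
  proof -
    have "\<bar>Im (of_real pi * s / 2)\<bar> \<ge> 1"
    proof -
      have "2 * 1 \<le> pi * \<bar>Im s\<bar>" using that pi_ge_two by (intro mult_mono) auto
      thus ?thesis by (simp add: abs_mult)
    qed
    hence "norm (cot (of_real pi * s / 2)) \<le> 2" by (intro cot_bound) linarith
    hence "pi / 2 * norm (cot (of_real pi * s / 2)) \<le> pi / 2 * 2" by (intro mult_left_mono) auto
    thus ?thesis by (simp add: norm_mult norm_divide)
  qed
  show ?thesis
  proof (intro exI[of _ C] conjI allI impI)
    show "C > 0" using pi_gt_zero norm_ge_zero[of "Ln 2 + Ln (complex_of_real pi)"] unfolding C_def by linarith
  next
    fix s :: complex assume s: "\<bar>Im s\<bar> \<ge> 1" "Re s \<le> 1/2"
    have "norm (Digamma (1 - s)) \<le> 4 * norm (1 - s - 1) + 1" using s by (intro Digamma_linear_bound) auto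
    hence "norm (Digamma (1 - s)) \<le> 4 * norm s + 1" by simp
    moreover have "norm (chi_dlog s) \<le> norm (Ln 2 + Ln (of_real pi)) + norm (of_real pi / 2 * cot (of_real pi * s / 2)) + norm (Digamma (1 - s))"
      unfolding chi_dlog_def by (rule order_trans[OF norm_triangle_ineq4 add_right_mono[OF norm_triangle_ineq]])
    ultimately show "norm (chi_dlog s) \<le> C + 4 * norm s" using cot[OF s(1)] unfolding C_def by linarith
  next
    fix t :: real assume t: "t \<ge> 1"
    let ?s = "-1 + \<i> * of_real t"
    have "1 - ?s = 2 - \<i> * of_real t" by simp
    hence "Re (chi_dlog ?s) = Re (Ln 2 + Ln (of_real pi)) + Re (of_real pi / 2 * cot (of_real pi * ?s / 2)) - Re (Digamma (2 - \<i> * of_real t))"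
      unfolding chi_dlog_def by (simp only: plus_complex.sel minus_complex.sel)
    moreover have "Re (Ln 2 + Ln (of_real pi)) \<le> norm (Ln 2 + Ln (of_real pi))" by (rule complex_Re_le_cmod)
    moreover have "Re (of_real pi / 2 * cot (of_real pi * ?s / 2)) \<le> pi"
      by (rule order_trans[OF complex_Re_le_cmod cot]) (use t in simp)
    ultimately show "Re (chi_dlog ?s) \<le> C - ln t" using Digamma_Re_lower[OF t] unfolding C_def by linarith
  qed
qed

section \<open>The logarithmic derivative near zeros of a holomorphic function\<close>

text \<open>
  The map \<open>u / (2 A - u)\<close> takes the half-plane \<open>Re u < A\<close> into the unit
  disc and fixes 0, so Schwarz's lemma applies.
\<close>

lemma Borel_Caratheodory_0:
  assumes holo: "u holomorphic_on ball 0 r" and r: "0 < r1" "r1 < r" and u0: "u 0 = 0"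
    and A: "A > 0" and Re: "\<And>z. z \<in> ball 0 r \<Longrightarrow> Re (u z) < A" and z: "norm z \<le> r1"
  shows "norm (u z) \<le> 2 * A * r1 / (r - r1)"
proof -
  define \<phi> where "\<phi> = (\<lambda>z. u (of_real r * z) / (2 * of_real A - u (of_real r * z)))"
  have in_ball: "of_real r * w \<in> ball (0::complex) r" if "norm w < 1" for w :: complex
    using that r by (simp add: norm_mult)
  have nz: "2 * of_real A - u (of_real r * w) \<noteq> 0" if "norm w < 1" for w
    using Re[OF in_ball[OF that]] A by (auto simp: complex_eq_iff)
  have hol: "\<phi> holomorphic_on ball 0 1"
    unfolding \<phi>_def
    by (intro holomorphic_intros holomorphic_on_compose_gen[OF _ holo, unfolded o_def])
       (use nz in_ball in auto)
  have lt1: "norm (\<phi> w) < 1" if "norm w < 1" for w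
  proof -
    define v where "v = u (of_real r * w)"
    have v: "Re v < A" using Re[OF in_ball[OF that]] by (simp add: v_def)
    have "A * Re v < A * A" using v A by simp
    hence "(norm v)\<^sup>2 < (norm (2 * of_real A - v))\<^sup>2"
      unfolding cmod_power2 by (simp add: power2_eq_square algebra_simps)
    hence "norm v < norm (2 * of_real A - v)" by (rule power2_less_imp_less) auto
    thus ?thesis using nz[OF that] unfolding \<phi>_def v_def[symmetric] norm_divide by (simp add: divide_simps)
  qed
  define w where "w = z / of_real r"
  have nw: "norm w \<le> r1 / r" "norm w < 1"
    using z r by (auto simp: w_def norm_divide divide_simps)
  have "norm (\<phi> w) \<le> norm w"
    by (rule Schwarz_Lemma(1)[OF hol _ lt1 nw(2)]) (auto simp: \<phi>_def u0)
  hence \<phi>: "norm (\<phi> w) \<le> r1 / r" using nw by linarith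
  have rz: "of_real r * w = z" using r by (simp add: w_def)
  have "u z * (1 + \<phi> w) = 2 * of_real A * \<phi> w"
    using nz[OF nw(2)] unfolding \<phi>_def rz by (simp add: field_simps)
  hence eq: "norm (u z) * norm (1 + \<phi> w) = 2 * A * norm (\<phi> w)"
    using A by (metis (no_types, lifting) abs_of_pos mult_pos_pos norm_mult norm_of_real of_real_mult of_real_numeral zero_less_numeral)
  have "1 - r1 / r \<le> norm (1 + \<phi> w)"
    using \<phi> norm_triangle_ineq4[of "1 + \<phi> w" "\<phi> w"] by simp
  hence "norm (u z) * (1 - r1 / r) \<le> 2 * A * norm (\<phi> w)"
    unfolding eq[symmetric] by (intro mult_left_mono) auto
  also have "\<dots> \<le> 2 * A * (r1 / r)" using \<phi> A by (intro mult_left_mono) auto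
  also have "1 - r1 / r = (r - r1) / r" using r by (simp add: field_simps)
  finally have "norm (u z) * (r - r1) / r \<le> 2 * A * r1 / r" by simp
  hence "norm (u z) * (r - r1) \<le> 2 * A * r1" using r by (simp only: divide_le_cancel)
  thus ?thesis using r by (simp add: pos_le_divide_eq)
qed

text \<open>
  Cauchy's inequality on a disc reaching halfway to the boundary.
\<close>

lemma Borel_Caratheodory_deriv_0:
  assumes holo: "u holomorphic_on ball 0 r" and r: "0 < r1" "r1 < r" and u0: "u 0 = 0"
    and A: "A > 0" and Re: "\<And>z. z \<in> ball 0 r \<Longrightarrow> Re (u z) < A" and z: "norm z \<le> r1"
  shows "norm (deriv u z) \<le> 4 * A * (r + r1) / (r - r1)\<^sup>2"
proof -
  \<comment> \<open>half the distance from \<open>z\<close> to the boundary, in the worst case \<open>norm z = r1\<close>\<close>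
  define d where "d = (r - r1) / 2"
  have d: "d > 0" "r1 + d < r" using r by (auto simp: d_def field_simps)
  have sub: "norm w \<le> r1 + d" if "norm (z - w) \<le> d" for w
    using that z norm_triangle_ineq4[of z "z - w"] by simp
  hence cb: "cball z d \<subseteq> ball 0 r" using d by (force simp: dist_norm)
  define B where "B = 2 * A * (r1 + d) / (r - (r1 + d))"
  have "norm ((deriv ^^ 1) u z) \<le> fact 1 * B / d ^ 1"
  proof (rule Cauchy_inequality)
    show "u holomorphic_on ball z d" using holo by (rule holomorphic_on_subset) (use cb in auto)
    show "continuous_on (cball z d) u"
      using holo cb by (blast intro: holomorphic_on_imp_continuous_on holomorphic_on_subset)
    fix w assume "norm (z - w) = d"
    thus "norm (u w) \<le> B"
      unfolding B_def using sub[of w] r d by (intro Borel_Caratheodory_0[OF holo _ _ u0 A Re]) auto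
  qed (use d in auto)
  also have "fact 1 * B / d ^ 1 = B / d" by simp
  also have "B / d = 4 * A * (r + r1) / (r - r1)\<^sup>2"
  proof -
    have 1: "r - (r1 + d) = (r - r1) / 2" "r1 + d = (r + r1) / 2" by (auto simp: d_def field_simps)
    have "2 * A * (y / 2) / (e / 2) / (e / 2) = 4 * A * y / (e * e)" for y e :: real
      by simp
    thus ?thesis unfolding B_def 1(1) unfolding 1(2) unfolding d_def power2_eq_square by simp
  qed
  finally show ?thesis by simp
qed

text \<open>
  The Blaschke factor of the disc of radius \<open>R\<close>: its only zero there is
  \<open>a\<close>, and its modulus is 1 on the boundary.
\<close>

definition Blaschke :: "real \<Rightarrow> complex \<Rightarrow> complex \<Rightarrow> complex" where
  "Blaschke R a z = of_real R * (z - a) / (of_real (R\<^sup>2) - cnj a * z)"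

lemma Blaschke_denom_nz:
  assumes "norm a < R" "norm z \<le> R" shows "of_real (R\<^sup>2) - cnj a * z \<noteq> 0"
proof
  assume "of_real (R\<^sup>2) - cnj a * z = 0"
  hence "norm (cnj a * z) = norm (complex_of_real (R\<^sup>2))" by simp
  hence "norm a * norm z = R * R" unfolding norm_of_real norm_mult by (simp add: power2_eq_square)
  moreover have "norm a * norm z \<le> norm a * R" using assms by (intro mult_left_mono) auto
  moreover have "norm a * R < R * R" using assms norm_ge_zero[of a] by (intro mult_strict_right_mono) linarith+
  ultimately show False by simp
qed

lemma Blaschke_factor_boundary:
  assumes "norm z = R"
  shows "norm (of_real (R\<^sup>2) - cnj a * z) = R * norm (z - a)"
proof -
  have "of_real (R\<^sup>2) = cnj z * z"
    using complex_norm_square[of z] assms by (simp add: mult.commute)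
  hence "of_real (R\<^sup>2) - cnj a * z = cnj (z - a) * z" by (simp add: algebra_simps)
  thus ?thesis using assms by (simp add: norm_mult del: complex_cnj_diff)
qed

text \<open>
  Dividing by a Blaschke factor does not change the modulus on the boundary circle, so the maximum
  principle keeps the bound.
\<close>

lemma Blaschke_extract:
  assumes holo: "g holomorphic_on ball 0 R'" and R: "R < R'" and a: "norm a < R" and ga: "g a = 0"
    and M: "\<And>z. norm z \<le> R \<Longrightarrow> norm (g z) \<le> M"
  shows "\<exists>h. h holomorphic_on ball 0 R' \<and> (\<forall>z. norm z \<le> R \<longrightarrow> norm (h z) \<le> M) \<and>
           (\<forall>z. norm z \<le> R \<longrightarrow> g z = h z * Blaschke R a z)"
proof -
  have R0: "R > 0" using a by (metis norm_ge_zero order_le_less_trans)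
  define k where "k = (\<lambda>z. if z = a then deriv g a else (g z - g a) / (z - a))"
  have k: "k holomorphic_on ball 0 R'"
    unfolding k_def using a R by (intro pole_lemma holo) (auto simp: interior_open)
  have gk: "g z = (z - a) * k z" for z using ga by (simp add: k_def)
  define h where "h = (\<lambda>z. k z * (of_real (R\<^sup>2) - cnj a * z) / of_real R)"
  have h: "h holomorphic_on ball 0 R'" unfolding h_def using R0 by (intro holomorphic_intros k) auto
  have gh: "g z = h z * Blaschke R a z" if "norm z \<le> R" for z
    using Blaschke_denom_nz[OF a that] R0 unfolding h_def Blaschke_def gk by (simp add: field_simps)
  have "norm (h z) \<le> M" if z: "norm z \<le> R" for z
  proof (rule maximum_modulus_frontier[of h "cball 0 R" M])
    show "h holomorphic_on interior (cball 0 R)"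
      using h by (rule holomorphic_on_subset) (use R in auto)
    show "continuous_on (closure (cball 0 R)) h"
      using R R0 by (intro holomorphic_on_imp_continuous_on holomorphic_on_subset[OF h]) (auto)
    show "bounded (cball 0 R :: complex set)" by simp
    show "z \<in> cball 0 R" using z R0 by simp
    fix w :: complex assume "w \<in> frontier (cball 0 R)"
    hence w: "norm w = R" using R0 by simp
    have "norm (h w) = norm (k w) * norm (w - a)"
      unfolding h_def norm_mult norm_divide Blaschke_factor_boundary[OF w] using R0 by simp
    also have "\<dots> = norm (g w)" unfolding gk norm_mult by simp
    also have "\<dots> \<le> M" using M w by simp
    finally show "norm (h w) \<le> M" .
  qed
  with h gh show ?thesis by blast
qed

lemma Blaschke_at_0: "R > 0 \<Longrightarrow> norm (Blaschke R a 0) = norm a / R"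
  by (simp add: Blaschke_def norm_mult norm_divide power2_eq_square)

lemma prod_list_bound:
  assumes "\<And>a. a \<in> set zs \<Longrightarrow> 0 \<le> f a \<and> f a \<le> (q::real)"
  shows "0 \<le> prod_list (map f zs) \<and> prod_list (map f zs) \<le> q ^ length zs"
  using assms
proof (induction zs)
  case (Cons a zs)
  have "0 \<le> f a" "f a \<le> q" using Cons.prems by auto
  moreover have "0 \<le> prod_list (map f zs)" "prod_list (map f zs) \<le> q ^ length zs" using Cons by auto
  ultimately show ?case by (auto intro!: mult_mono)
qed auto

lemma norm_prod_list: "norm (prod_list (xs :: 'a :: real_normed_field list)) = prod_list (map norm xs)"
  by (induction xs) (auto simp: norm_mult)

text \<open>
  Zeros are divided out one at a time. At the origin each Blaschke factor has modulus at most
  \<open>r / R\<close>, while the quotient stays bounded by \<open>M\<close>; this is Jensen's bound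
  for the number of factors. A factorization with the largest number of factors leaves a quotient
  without zeros in the smaller disc.
\<close>

lemma zero_factorization:
  assumes holo: "f holomorphic_on ball 0 R'" and R: "0 < r" "r < R" "R < R'"
    and M: "\<And>z. norm z \<le> R \<Longrightarrow> norm (f z) \<le> M" and f0: "f 0 \<noteq> 0"
  shows "\<exists>zs g. g holomorphic_on ball 0 R' \<and> set zs \<subseteq> {a. norm a \<le> r \<and> f a = 0} \<and>
     real (length zs) \<le> ln (M / norm (f 0)) / ln (R / r) \<and>
     (\<forall>z. norm z \<le> R \<longrightarrow> norm (g z) \<le> M) \<and> norm (f 0) \<le> norm (g 0) \<and>
     (\<forall>z. norm z \<le> r \<longrightarrow> g z \<noteq> 0) \<and>
     (\<forall>z. norm z \<le> R \<longrightarrow> f z = g z * prod_list (map (\<lambda>a. Blaschke R a z) zs))"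
proof -
  define P where "P = (\<lambda>(zs::complex list, g). g holomorphic_on ball 0 R' \<and> set zs \<subseteq> {a. norm a \<le> r \<and> f a = 0} \<and>
     (\<forall>z. norm z \<le> R \<longrightarrow> norm (g z) \<le> M) \<and>
     (\<forall>z. norm z \<le> R \<longrightarrow> f z = g z * prod_list (map (\<lambda>a. Blaschke R a z) zs)))"
  have f0': "norm (f 0) > 0" using f0 by simp
  have M0: "M > 0" using M[of 0] f0' R by (auto simp del: zero_less_norm_iff)
  have lnq: "ln (R / r) > 0" using R by simp
  have len: "real (length zs) \<le> ln (M / norm (f 0)) / ln (R / r) \<and> norm (f 0) \<le> norm (g 0)" if "P (zs, g)" for zs g
  proof -
    have eq: "norm (f 0) = norm (g 0) * prod_list (map (\<lambda>a. norm a / R) zs)"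
      using that R by (simp add: P_def norm_mult norm_prod_list o_def Blaschke_at_0)
    have b: "0 \<le> prod_list (map (\<lambda>a. norm a / R) zs) \<and> prod_list (map (\<lambda>a. norm a / R) zs) \<le> (r / R) ^ length zs"
      using that R by (intro prod_list_bound) (auto simp: P_def divide_simps)
    have g0: "norm (g 0) \<le> M" using that R by (auto simp: P_def)
    have "(r / R) ^ length zs \<le> 1" using R by (intro power_le_one) auto
    hence "norm (g 0) * prod_list (map (\<lambda>a. norm a / R) zs) \<le> norm (g 0) * 1"
      using b by (intro mult_left_mono) auto
    moreover have "norm (f 0) \<le> M * (r / R) ^ length zs"
      unfolding eq using g0 b M0 by (intro mult_mono) auto
    hence "ln (norm (f 0)) \<le> ln (M * (r / R) ^ length zs)" using f0' M0 R by (subst ln_le_cancel_iff) simp_all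
    hence "ln (norm (f 0)) \<le> ln M + real (length zs) * ln (r / R)"
      using M0 R by (simp add: ln_mult ln_realpow)
    hence "real (length zs) * ln (R / r) \<le> ln (M / norm (f 0))"
      using M0 R f0' by (simp add: ln_div algebra_simps)
    ultimately show ?thesis using lnq eq by (simp add: field_simps)
  qed
  \<comment> \<open>a factorization with the largest possible number of Blaschke factors\<close>
  define Q where "Q = (\<lambda>k. \<exists>zs g. P (zs, g) \<and> length zs = k)"
  have "Q 0" unfolding Q_def P_def using holo M by (intro exI[of _ "[]"] exI[of _ f]) auto
  moreover have "\<forall>k. Q k \<longrightarrow> k \<le> nat \<lfloor>ln (M / norm (f 0)) / ln (R / r)\<rfloor>"
    using len unfolding Q_def by (metis le_nat_floor)
  ultimately obtain k where k: "Q k" "\<And>k'. Q k' \<Longrightarrow> k' \<le> k"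
    by (metis GreatestI_nat Greatest_le_nat)
  from k(1) obtain zs g where zg: "P (zs, g)" "length zs = k" by (auto simp: Q_def)
  have "g a \<noteq> 0" if a: "norm a \<le> r" for a
  proof
    assume ga: "g a = 0"
    have "\<exists>h. h holomorphic_on ball 0 R' \<and> (\<forall>z. norm z \<le> R \<longrightarrow> norm (h z) \<le> M) \<and>
           (\<forall>z. norm z \<le> R \<longrightarrow> g z = h z * Blaschke R a z)"
      using zg(1) a R ga by (intro Blaschke_extract) (auto simp: P_def)
    then obtain h where h: "h holomorphic_on ball 0 R'" "\<And>z. norm z \<le> R \<Longrightarrow> norm (h z) \<le> M"
         "\<And>z. norm z \<le> R \<Longrightarrow> g z = h z * Blaschke R a z" by blast
    have fa: "f a = 0" using zg(1) a R ga by (auto simp: P_def)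
    have "P (a # zs, h)" using h zg(1) a fa by (auto simp: P_def)
    hence "Q (Suc k)" unfolding Q_def using zg(2) by (intro exI[of _ "a # zs"]) auto
    from k(2)[OF this] show False by simp
  qed
  thus ?thesis using zg(1) len[OF zg(1)] unfolding P_def by (intro exI[of _ zs] exI[of _ g]) auto
qed

lemma Blaschke_logderiv:
  assumes "norm a < R" "norm z \<le> R" "z \<noteq> a"
  shows "(Blaschke R a has_field_derivative
           Blaschke R a z * (1 / (z - a) + cnj a / (of_real (R\<^sup>2) - cnj a * z))) (at z)"
proof -
  have "R \<noteq> 0" using assms(1) by (metis norm_not_less_zero)
  thus ?thesis
  unfolding Blaschke_def using Blaschke_denom_nz[OF assms(1,2)] assms(3)
  by (auto intro!: derivative_eq_intros simp: divide_simps) (auto simp: algebra_simps)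
qed

lemma prod_list_logderiv:
  fixes B :: "complex \<Rightarrow> complex \<Rightarrow> complex"
  assumes "\<And>a. a \<in> set zs \<Longrightarrow> (B a has_field_derivative B a z * l a) (at z)"
  shows "((\<lambda>z. prod_list (map (\<lambda>a. B a z) zs)) has_field_derivative
           prod_list (map (\<lambda>a. B a z) zs) * sum_list (map l zs)) (at z)"
  using assms
  by (induction zs) (auto intro!: derivative_eq_intros simp: algebra_simps)

text \<open>
  The quotient \<open>g\<close> by the Blaschke factors has a logarithm in the disc of radius
  \<open>r\<close>, whose real part is at most \<open>ln (M / norm (f 0))\<close> above its value at
  0; Borel-Caratheodory bounds \<open>deriv g / g\<close>. A Blaschke factor contributes \<open>1 /
  (z - a)\<close> and a bounded term.
\<close>

lemma Landau_local_0:
  assumes holo: "f holomorphic_on ball 0 R'" and R: "0 < r1" "r1 < r" "r < R" "R < R'"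
    and M: "\<And>z. norm z \<le> R \<Longrightarrow> norm (f z) \<le> M" and f0: "f 0 \<noteq> 0"
  shows "\<exists>zs. set zs = {a. norm a \<le> r \<and> f a = 0} \<and>
     real (length zs) \<le> ln (M / norm (f 0)) / ln (R / r) \<and>
     (\<forall>z. norm z \<le> r1 \<longrightarrow> f z \<noteq> 0 \<longrightarrow>
        norm (deriv f z / f z - (\<Sum>a\<leftarrow>zs. 1 / (z - a)))
          \<le> 4 * (ln (M / norm (f 0)) + 1) * (r + r1) / (r - r1)\<^sup>2 + real (length zs) / (R - r))"
proof -
  have r0: "0 < r" using R by auto
  obtain zs g where g: "g holomorphic_on ball 0 R'" and zs: "set zs \<subseteq> {a. norm a \<le> r \<and> f a = 0}"
     and len: "real (length zs) \<le> ln (M / norm (f 0)) / ln (R / r)" and gM: "\<And>z. norm z \<le> R \<Longrightarrow> norm (g z) \<le> M"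
     and g0: "norm (f 0) \<le> norm (g 0)" and gnz: "\<And>z. norm z \<le> r \<Longrightarrow> g z \<noteq> 0"
     and fg: "\<And>z. norm z \<le> R \<Longrightarrow> f z = g z * prod_list (map (\<lambda>a. Blaschke R a z) zs)"
    using zero_factorization[OF holo r0 R(3,4) M f0] by blast
  have f0': "norm (f 0) > 0" using f0 by simp
  have M0: "M > 0" using M[of 0] f0' R by (auto simp del: zero_less_norm_iff)
  have gr: "g holomorphic_on ball 0 r" using g by (rule holomorphic_on_subset) (use R in auto)
  have "\<exists>l. l holomorphic_on ball 0 r \<and> (\<forall>z\<in>ball 0 r. g z = exp (l z))"
  proof -
    obtain l where "l holomorphic_on ball 0 r" "\<And>z. z \<in> ball 0 r \<Longrightarrow> g z = exp (l z)"
      using contractible_imp_holomorphic_log[OF gr convex_imp_contractible[OF convex_ball]] gnz by auto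
    thus ?thesis by blast
  qed
  then obtain l where l: "l holomorphic_on ball 0 r" "\<And>z. z \<in> ball 0 r \<Longrightarrow> g z = exp (l z)" by blast
  define u where "u = (\<lambda>z. l z - l 0)"
  have u: "u holomorphic_on ball 0 r" unfolding u_def by (intro holomorphic_intros l)
  let ?A = "ln (M / norm (f 0)) + 1"
  have "norm (f 0) \<le> M" using M[of 0] R by simp
  hence "0 \<le> ln (M / norm (f 0))" using f0' M0 by (intro ln_ge_zero) simp
  hence A: "?A > 0" by simp
  have Reu: "Re (u z) < ?A" if z: "z \<in> ball 0 r" for z
  proof -
    have "exp (Re (l z)) \<le> M" using gM[of z] l(2)[OF z] z R by (simp add: norm_exp_eq_Re)
    hence 1: "Re (l z) \<le> ln M" using M0 by (metis exp_gt_zero ln_exp ln_le_cancel_iff)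
    have "norm (f 0) \<le> exp (Re (l 0))" using g0 l(2)[of 0] r0 by (simp add: norm_exp_eq_Re)
    hence "ln (norm (f 0)) \<le> Re (l 0)" using f0' by (metis exp_gt_zero ln_exp ln_le_cancel_iff)
    thus ?thesis using 1 M0 f0' by (simp add: u_def ln_div)
  qed
  have "norm (deriv f z / f z - (\<Sum>a\<leftarrow>zs. 1 / (z - a)))
          \<le> 4 * ?A * (r + r1) / (r - r1)\<^sup>2 + real (length zs) / (R - r)"
    if z: "norm z \<le> r1" and fz: "f z \<noteq> 0" for z
  proof -
    have zr: "z \<in> ball 0 r" "norm z \<le> r" "norm z \<le> R" "norm z < R" using z R by auto
    let ?B = "\<lambda>z. prod_list (map (\<lambda>a. Blaschke R a z) zs)"
    let ?L = "\<lambda>a. 1 / (z - a) + cnj a / (of_real (R\<^sup>2) - cnj a * z)"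
    have B: "(?B has_field_derivative ?B z * sum_list (map ?L zs)) (at z)"
      using zs fz zr R by (intro prod_list_logderiv Blaschke_logderiv) auto
    have dl: "(l has_field_derivative deriv u z) (at z)"
    proof -
      have "(u has_field_derivative deriv u z) (at z)"
        using holomorphic_derivI[OF u] zr by auto
      hence "((\<lambda>z. u z + l 0) has_field_derivative deriv u z + 0) (at z)" by (intro derivative_intros)
      thus ?thesis by (simp add: u_def)
    qed
    have D: "((\<lambda>z. exp (l z) * ?B z) has_field_derivative f z * (deriv u z + sum_list (map ?L zs))) (at z)"
      using fg[OF zr(3)] l(2)[OF zr(1)] by (auto intro!: derivative_eq_intros dl B simp: algebra_simps)
    have "eventually (\<lambda>w. w \<in> ball 0 r) (nhds z)"
      using zr by (intro eventually_nhds_in_open) auto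
    hence ev: "eventually (\<lambda>w. exp (l w) * ?B w = f w) (nhds z)"
      by eventually_elim (use l(2) fg R in auto)
    have "(f has_field_derivative f z * (deriv u z + sum_list (map ?L zs))) (at z)"
      using iffD1[OF DERIV_cong_ev[OF refl ev refl] D] .
    hence "deriv f z / f z = deriv u z + sum_list (map ?L zs)"
      using fz by (simp add: DERIV_imp_deriv)
    also have "sum_list (map ?L zs) = (\<Sum>a\<leftarrow>zs. 1 / (z - a)) + (\<Sum>a\<leftarrow>zs. cnj a / (of_real (R\<^sup>2) - cnj a * z))"
      by (simp add: sum_list_addf)
    finally have "deriv f z / f z - (\<Sum>a\<leftarrow>zs. 1 / (z - a)) =
       deriv u z + (\<Sum>a\<leftarrow>zs. cnj a / (of_real (R\<^sup>2) - cnj a * z))" by simp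
    also have "norm \<dots> \<le> norm (deriv u z) + norm (\<Sum>a\<leftarrow>zs. cnj a / (of_real (R\<^sup>2) - cnj a * z))"
      by (rule norm_triangle_ineq)
    also have "norm (deriv u z) \<le> 4 * ?A * (r + r1) / (r - r1)\<^sup>2"
      by (rule Borel_Caratheodory_deriv_0[OF u R(1,2) _ A Reu z]) (auto simp: u_def)
    also have "norm (\<Sum>a\<leftarrow>zs. cnj a / (of_real (R\<^sup>2) - cnj a * z)) \<le> (\<Sum>a\<leftarrow>zs. 1 / (R - r))"
    proof -
      have "norm (cnj a / (of_real (R\<^sup>2) - cnj a * z)) \<le> 1 / (R - r)" if "a \<in> set zs" for a
      proof -
        have a: "norm a \<le> r" using zs that by auto
        have "norm (cnj a * z) \<le> r * R" unfolding norm_mult using a zr r0 by (intro mult_mono) auto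
        moreover have "R\<^sup>2 \<le> norm (of_real (R\<^sup>2) - cnj a * z) + norm (cnj a * z)"
          using norm_triangle_ineq[of "of_real (R\<^sup>2) - cnj a * z" "cnj a * z"] by (simp del: of_real_power)
        ultimately have "R * (R - r) \<le> norm (of_real (R\<^sup>2) - cnj a * z)"
          by (simp add: power2_eq_square algebra_simps)
        hence "norm (cnj a / (of_real (R\<^sup>2) - cnj a * z)) \<le> R / (R * (R - r))"
          unfolding norm_divide using a R r0 by (intro frac_le) auto
        thus ?thesis using R r0 by simp
      qed
      hence "(\<Sum>a\<leftarrow>zs. norm (cnj a / (of_real (R\<^sup>2) - cnj a * z))) \<le> (\<Sum>a\<leftarrow>zs. 1 / (R - r))"
        by (intro sum_list_mono) auto
      moreover have "norm (\<Sum>a\<leftarrow>zs. cnj a / (of_real (R\<^sup>2) - cnj a * z)) \<le> (\<Sum>a\<leftarrow>zs. norm (cnj a / (of_real (R\<^sup>2) - cnj a * z)))"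
        by (induction zs) (auto intro: norm_triangle_le)
      ultimately show ?thesis by linarith
    qed
    finally show ?thesis by (simp add: sum_list_triv)
  qed
  moreover have "a \<in> set zs" if a: "norm a \<le> r" "f a = 0" for a
  proof -
    have "g a * prod_list (map (\<lambda>b. Blaschke R b a) zs) = 0" using fg[of a] a R by simp
    hence "0 \<in> set (map (\<lambda>b. Blaschke R b a) zs)" using gnz[OF a(1)] by (simp add: prod_list_zero_iff)
    then obtain b where b: "b \<in> set zs" "Blaschke R b a = 0" by auto
    have "norm b < R" using b(1) zs R by auto
    hence "a = b" using b(2) Blaschke_denom_nz[of b R a] a R r0 by (auto simp: Blaschke_def)
    thus ?thesis using b(1) by simp
  qed
  ultimately show ?thesis using zs len by (intro exI[of _ zs]) auto
qed

text \<open>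
  The same with one constant for all functions and centres. The zeros in the disc of radius
  \<open>r1\<close> are among the \<open>zs\<close>, so a point far from all of \<open>zs\<close> is
  also not a zero.
\<close>

lemma Landau_local:
  assumes R: "0 < r1" "r1 < r" "r < R" "R < R'"
  shows "\<exists>C>0. \<forall>f c M. f holomorphic_on ball c R' \<longrightarrow> (\<forall>z\<in>cball c R. norm (f z) \<le> M) \<longrightarrow> f c \<noteq> 0 \<longrightarrow>
     (\<exists>zs. {a\<in>cball c r1. f a = 0} \<subseteq> set zs \<and> real (length zs) \<le> C * (ln (M / norm (f c)) + 1) \<and>
     (\<forall>z\<in>cball c r1. f z \<noteq> 0 \<longrightarrow>
        norm (deriv f z / f z - (\<Sum>a\<leftarrow>zs. 1 / (z - a))) \<le> C * (ln (M / norm (f c)) + 1)))"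
proof -
  define C1 where "C1 = 1 / ln (R / r)"
  define C where "C = 4 * (r + r1) / (r - r1)\<^sup>2 + C1 / (R - r) + C1"
  have C1: "C1 > 0" using R by (simp add: C1_def)
  have pos: "4 * (r + r1) / (r - r1)\<^sup>2 > 0" "C1 / (R - r) > 0" using R C1 by auto
  show ?thesis
  proof (intro exI[of _ C] conjI allI impI)
    show "C > 0" unfolding C_def using pos C1 by linarith
    fix f :: "complex \<Rightarrow> complex" and c M
    assume f: "f holomorphic_on ball c R'" and M: "\<forall>z\<in>cball c R. norm (f z) \<le> M" and f0: "f c \<noteq> 0"
    define g where "g = (\<lambda>z. f (c + z))"
    have g: "g holomorphic_on ball 0 R'" unfolding g_def
      by (intro holomorphic_on_compose_gen[OF _ f, unfolded o_def] holomorphic_intros) (auto simp: dist_norm)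
    have gM: "norm (g z) \<le> M" if "norm z \<le> R" for z
      unfolding g_def using M that by (auto simp: dist_norm)
    have g0: "g 0 \<noteq> 0" using f0 by (simp add: g_def)
    obtain zs where zs: "set zs = {a. norm a \<le> r \<and> g a = 0}"
      "real (length zs) \<le> ln (M / norm (g 0)) / ln (R / r)"
      "\<And>z. norm z \<le> r1 \<Longrightarrow> g z \<noteq> 0 \<Longrightarrow>
        norm (deriv g z / g z - (\<Sum>a\<leftarrow>zs. 1 / (z - a)))
          \<le> 4 * (ln (M / norm (g 0)) + 1) * (r + r1) / (r - r1)\<^sup>2 + real (length zs) / (R - r)"
      using Landau_local_0[OF g R gM g0] by blast
    define X where "X = ln (M / norm (f c)) + 1"
    have "norm (f c) \<le> M" using M R by auto
    hence "0 \<le> ln (M / norm (f c))" using f0 by (intro ln_ge_zero) simp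
    hence X: "X > 0" by (simp add: X_def)
    have len: "real (length zs) \<le> C1 * X"
    proof -
      have "real (length zs) \<le> C1 * (X - 1)" using zs(2) by (simp add: C1_def X_def g_def)
      also have "\<dots> \<le> C1 * X" using C1 by (intro mult_left_mono) auto
      finally show ?thesis .
    qed
    have C1C: "C1 * X \<le> C * X" unfolding C_def using pos X by (intro mult_right_mono) linarith+
    show "\<exists>zs. {a\<in>cball c r1. f a = 0} \<subseteq> set zs \<and> real (length zs) \<le> C * (ln (M / norm (f c)) + 1) \<and>
     (\<forall>z\<in>cball c r1. f z \<noteq> 0 \<longrightarrow>
        norm (deriv f z / f z - (\<Sum>a\<leftarrow>zs. 1 / (z - a))) \<le> C * (ln (M / norm (f c)) + 1))"
    proof (intro exI[of _ "map ((+) c) zs"] conjI ballI impI)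
      show "{a\<in>cball c r1. f a = 0} \<subseteq> set (map ((+) c) zs)"
      proof
        fix a assume a: "a \<in> {a\<in>cball c r1. f a = 0}"
        have "a - c \<in> set zs" unfolding zs(1) using a R by (auto simp: g_def dist_norm norm_minus_commute)
        thus "a \<in> set (map ((+) c) zs)" by (auto intro!: image_eqI[of _ _ "a - c"])
      qed
      show "real (length (map ((+) c) zs)) \<le> C * (ln (M / norm (f c)) + 1)"
        using len C1C by (simp add: X_def)
      fix z assume z: "z \<in> cball c r1" "f z \<noteq> 0"
      have "norm (deriv g (z - c) / g (z - c) - (\<Sum>a\<leftarrow>zs. 1 / (z - c - a)))
          \<le> 4 * (ln (M / norm (g 0)) + 1) * (r + r1) / (r - r1)\<^sup>2 + real (length zs) / (R - r)"
        using z by (intro zs(3)) (auto simp: g_def dist_norm norm_minus_commute)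
      also have "g (z - c) = f z" by (simp add: g_def)
      also have "deriv g (z - c) = deriv f z"
        unfolding deriv_def g_def using DERIV_shift[of f _ "z - c" c] by (simp add: add.commute)
      also have "4 * (ln (M / norm (g 0)) + 1) * (r + r1) / (r - r1)\<^sup>2 + real (length zs) / (R - r) \<le>
         4 * (r + r1) / (r - r1)\<^sup>2 * X + C1 / (R - r) * X"
      proof (rule add_mono)
        have "real (length zs) / (R - r) \<le> (C1 * X) / (R - r)"
          using len R by (intro divide_right_mono) auto
        thus "real (length zs) / (R - r) \<le> C1 / (R - r) * X" by simp
      next
        have "4 * (ln (M / norm (g 0)) + 1) * (r + r1) / (r - r1)\<^sup>2 = 4 * X * (r + r1) / (r - r1)\<^sup>2"
          by (simp add: X_def g_def)
        also have "\<dots> = 4 * (r + r1) / (r - r1)\<^sup>2 * X" by simp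
        finally show "4 * (ln (M / norm (g 0)) + 1) * (r + r1) / (r - r1)\<^sup>2 \<le> 4 * (r + r1) / (r - r1)\<^sup>2 * X"
          by (rule eq_refl)
      qed
      also have "\<dots> \<le> C * X" using C1 X by (simp add: C_def algebra_simps)
      finally show "norm (deriv f z / f z - (\<Sum>a\<leftarrow>map ((+) c) zs. 1 / (z - a))) \<le> C * (ln (M / norm (f c)) + 1)"
        by (simp add: X_def o_def diff_diff_eq)
    qed
  qed
qed

section \<open>Counting the zeros\<close>

text \<open>
  Pigeonhole principle: of \<open>k + 1\<close> points spaced by \<open>1 / (k + 1)\<close>, each of
  the \<open>k\<close> given points is too close to at most one.
\<close>

lemma separated_point:
  fixes a :: real and zs :: "real list"
  shows "\<exists>t\<in>{a..a+1}. \<forall>z\<in>set zs. \<bar>t - z\<bar> \<ge> 1 / (2 * (real (length zs) + 1))"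
proof (rule ccontr)
  assume H: "\<not> ?thesis"
  define k where "k = length zs"
  define p where "p = (\<lambda>j. a + (2 * real j + 1) / (2 * (real k + 1)))"
  have "\<exists>z\<in>set zs. \<bar>p j - z\<bar> < 1 / (2 * (real k + 1))" if "j \<le> k" for j
  proof -
    have "p j \<in> {a..a+1}" using that by (simp add: p_def field_simps)
    thus ?thesis using H unfolding k_def by (meson not_le)
  qed
  then obtain f where f: "\<And>j. j \<le> k \<Longrightarrow> f j \<in> set zs" "\<And>j. j \<le> k \<Longrightarrow> \<bar>p j - f j\<bar> < 1 / (2 * (real k + 1))"
    by metis
  have "inj_on f {..k}"
  proof (rule inj_onI)
    fix i j assume ij: "i \<in> {..k}" "j \<in> {..k}" "f i = f j"
    define q where "q = 2 * (real k + 1)"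
    have q: "q > 0" by (simp add: q_def)
    have "\<bar>p i - p j\<bar> < 1 / q + 1 / q"
      using f(2)[of i] f(2)[of j] ij by (auto simp: q_def)
    moreover have "p i - p j = (2 * (real i - real j)) / q"
      unfolding p_def q_def[symmetric] by (simp add: diff_divide_distrib add_divide_distrib)
    ultimately have "\<bar>2 * (real i - real j)\<bar> / q < 2 / q" using q by (simp add: abs_divide)
    hence "\<bar>2 * (real i - real j)\<bar> < 2" using q by (simp only: divide_less_cancel)
    hence "real i < real j + 1" "real j < real i + 1" by (auto simp: abs_less_iff)
    thus "i = j" by linarith
  qed
  hence "card {..k} \<le> card (set zs)" using f(1) by (intro card_inj_on_le) auto
  thus False using card_length[of zs] by (simp add: k_def)
qed

text \<open>
  Each unit interval contains a height at distance at least a constant over \<open>log n\<close>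
  from the \<open>O(log n)\<close> nearby zeros. There the sum of the \<open>1 / (s -
  \<rho>)\<close> is \<open>O((log n)\<^sup>2)\<close>.
\<close>

lemma zeta_logderiv_good_heights:
  "\<exists>C>0. \<exists>n0. \<forall>n\<ge>n0. \<exists>t\<in>{real n..real n + 1}. \<forall>\<sigma>\<in>{1/2..2}.
     zeta (Complex \<sigma> t) \<noteq> 0 \<and> norm (deriv zeta (Complex \<sigma> t) / zeta (Complex \<sigma> t)) \<le> C * (ln (real n))\<^sup>2"
proof -
  obtain C1 where C1: "C1 > 0" "\<And>s. Re s \<ge> - 9/10 \<Longrightarrow> norm (s - 1) \<ge> 1 \<Longrightarrow> norm (zeta s) \<le> C1 * (1 + norm s) ^ 2"
    using zeta_poly_bound by auto
  obtain C2 where C2: "C2 > 0" "\<And>f c M. f holomorphic_on ball c (29/10) \<Longrightarrow> (\<forall>z\<in>cball c (28/10). norm (f z) \<le> M) \<Longrightarrow> f c \<noteq> 0 \<Longrightarrow>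
     (\<exists>zs. {a\<in>cball c (16/10). f a = 0} \<subseteq> set zs \<and> real (length zs) \<le> C2 * (ln (M / norm (f c)) + 1) \<and>
     (\<forall>z\<in>cball c (16/10). f z \<noteq> 0 \<longrightarrow>
        norm (deriv f z / f z - (\<Sum>a\<leftarrow>zs. 1 / (z - a))) \<le> C2 * (ln (M / norm (f c)) + 1)))"
    \<comment> \<open>around \<open>2 + \<i> (n + 1/2)\<close>, radius 1.6 covers \<open>{1/2..2}\<close> at the heights \<open>{n..n+1}\<close>, as \<open>1.5\<^sup>2 + 0.5\<^sup>2 < 1.6\<^sup>2\<close>,
      and radius 2.9 stays in \<open>Re s \<ge> -9/10\<close>, where zeta is polynomially bounded\<close>
    using Landau_local[of "16/10" "17/10" "28/10" "29/10"] by auto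
  define K where "K = 3 + \<bar>ln (36 * C1)\<bar>"
  define D where "D = C2 * K"
  have K: "K > 0" by (simp add: K_def)
  have D: "D > 0" using K C2 by (simp add: D_def)
  have main: "\<exists>t\<in>{real n..real n + 1}. \<forall>\<sigma>\<in>{1/2..2}.
     zeta (Complex \<sigma> t) \<noteq> 0 \<and> norm (deriv zeta (Complex \<sigma> t) / zeta (Complex \<sigma> t)) \<le> (2 * D\<^sup>2 + 3 * D) * (ln (real n))\<^sup>2"
    if n: "n \<ge> 4" for n
  proof -
    define c where "c = Complex 2 (real n + 1/2)"
    define l where "l = ln (real n)"
    have l: "l \<ge> 1"
    proof -
      have "exp 1 \<le> real n" using exp_le n by linarith
      hence "ln (exp 1) \<le> ln (real n)" using n by (subst ln_le_cancel_iff) auto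
      thus ?thesis by (simp add: l_def)
    qed
    define M where "M = 9 * C1 * (real n)\<^sup>2"
    have hol: "zeta holomorphic_on ball c (29/10)"
    proof (rule holomorphic_on_subset[OF zeta_holomorphic])
      have "1 \<notin> ball c (29/10)"
        using abs_Im_le_cmod[of "c - 1"] n by (auto simp: c_def dist_norm)
      thus "ball c (29/10) \<subseteq> - {1}" by auto
    qed
    have bd: "norm (zeta z) \<le> M" if "z \<in> cball c (28/10)" for z
    proof -
      have d: "norm (c - z) \<le> 28/10" using that by (simp add: dist_norm)
      have "\<bar>Re (c - z)\<bar> \<le> 28/10" "\<bar>Im (c - z)\<bar> \<le> 28/10"
        using abs_Re_le_cmod[of "c - z"] abs_Im_le_cmod[of "c - z"] d by linarith+
      hence ri: "\<bar>2 - Re z\<bar> \<le> 28/10" "\<bar>real n + 1/2 - Im z\<bar> \<le> 28/10" by (simp_all add: c_def)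
      have re: "Re z \<ge> -9/10" using ri(1) by linarith
      have im: "Im z \<ge> 1" using ri(2) n by linarith
      have "norm (z - 1) \<ge> 1" using abs_Im_le_cmod[of "z - 1"] im by simp
      hence b1: "norm (zeta z) \<le> C1 * (1 + norm z)\<^sup>2" using re by (intro C1(2)) simp
      have "norm z \<le> norm c + norm (z - c)" using norm_triangle_ineq[of c "z - c"] by simp
      also have "norm (z - c) \<le> 28/10" using d by (simp add: norm_minus_commute)
      also have "norm c \<le> 2 + (real n + 1/2)" using cmod_le[of c] by (simp add: c_def)
      finally have nz: "1 + norm z \<le> 3 * real n" using n by simp
      have "(1 + norm z)\<^sup>2 \<le> (3 * real n)\<^sup>2" using nz by (intro power_mono) auto
      hence "C1 * (1 + norm z)\<^sup>2 \<le> C1 * (3 * real n)\<^sup>2" using C1 by (intro mult_left_mono) auto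
      also have "\<dots> = M" by (simp add: M_def power_mult_distrib)
      finally show ?thesis using b1 by linarith
    qed
    have zc: "norm (zeta c) \<ge> 1/4" by (rule norm_zeta_ge_quarter) (simp add: c_def)
    hence zc0: "zeta c \<noteq> 0" by auto
    have M0: "M > 0" using C1 n by (simp add: M_def)
    have X: "ln (M / norm (zeta c)) + 1 \<le> K * l"
    proof -
      have "M / norm (zeta c) \<le> M / (1/4)" using zc M0 by (intro divide_left_mono) auto
      hence "ln (M / norm (zeta c)) \<le> ln (M / (1/4))" using M0 zc0 by (subst ln_le_cancel_iff) auto
      also have "M / (1/4) = (36 * C1) * (real n)\<^sup>2" by (simp add: M_def)
      also have "ln \<dots> = ln (36 * C1) + ln ((real n)\<^sup>2)" using C1 n by (intro ln_mult_pos) auto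
      also have "ln ((real n)\<^sup>2) = 2 * l" unfolding l_def using n by (simp add: ln_realpow)
      also have "ln (36 * C1) \<le> \<bar>ln (36 * C1)\<bar> * l" using l mult_left_mono[OF l, of "\<bar>ln (36 * C1)\<bar>"] by simp
      finally show ?thesis using l by (simp add: K_def distrib_right)
    qed
    obtain zs where zs: "{a\<in>cball c (16/10). zeta a = 0} \<subseteq> set zs" "real (length zs) \<le> C2 * (ln (M / norm (zeta c)) + 1)"
      "\<And>z. z\<in>cball c (16/10) \<Longrightarrow> zeta z \<noteq> 0 \<Longrightarrow>
        norm (deriv zeta z / zeta z - (\<Sum>a\<leftarrow>zs. 1 / (z - a))) \<le> C2 * (ln (M / norm (zeta c)) + 1)"
      using C2(2)[of zeta c M] hol bd zc0 by blast
    have CX: "C2 * (ln (M / norm (zeta c)) + 1) \<le> D * l"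
      using X C2(1) unfolding D_def mult.assoc by (intro mult_left_mono) auto
    define k where "k = real (length zs)"
    have k: "k \<le> D * l" "k \<ge> 0" using zs(2) CX by (auto simp: k_def)
    obtain t where t: "t \<in> {real n..real n + 1}" "\<And>a. a \<in> set zs \<Longrightarrow> \<bar>t - Im a\<bar> \<ge> 1 / (2 * (k + 1))"
      using separated_point[of "real n" "map Im zs"] by (auto simp: k_def)
    show ?thesis
    proof (intro bexI[of _ t] ballI conjI)
      fix \<sigma> :: real assume \<sigma>: "\<sigma> \<in> {1/2..2}"
      define s where "s = Complex \<sigma> t"
      have sc: "s \<in> cball c (16/10)"
      proof -
        have "\<bar>Re (c - s)\<bar> \<le> 3/2" "\<bar>Im (c - s)\<bar> \<le> 1/2" 
          unfolding s_def c_def using \<sigma> t(1) by (auto intro!: abs_leI simp: field_simps)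
        hence "(Re (c - s))\<^sup>2 \<le> (3/2)\<^sup>2" "(Im (c - s))\<^sup>2 \<le> (1/2)\<^sup>2" by (simp_all only: abs_le_square_iff[symmetric])
        hence "(norm (c - s))\<^sup>2 \<le> (16/10)\<^sup>2" unfolding cmod_power2 by (simp add: power2_eq_square)
        hence "norm (c - s) \<le> 16/10" by (rule power2_le_imp_le) auto
        thus ?thesis by (simp add: dist_norm)
      qed
      show nz: "zeta (Complex \<sigma> t) \<noteq> 0"
      proof
        assume "zeta (Complex \<sigma> t) = 0"
        hence "s \<in> set zs" using zs(1) sc by (auto simp: s_def)
        from t(2)[OF this] show False using k(2) by (simp add: s_def)
      qed
      have "norm (\<Sum>a\<leftarrow>zs. 1 / (s - a)) \<le> (\<Sum>a\<leftarrow>zs. norm (1 / (s - a)))"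
        by (induction zs) (auto intro: norm_triangle_le)
      also have "\<dots> \<le> (\<Sum>a\<leftarrow>zs. 2 * (k + 1))"
      proof (rule sum_list_mono)
        fix a assume a: "a \<in> set zs"
        have p: "0 < 1 / (2 * (k + 1))" using k by simp
        have "1 / (2 * (k + 1)) \<le> \<bar>Im (s - a)\<bar>" using t(2)[OF a] by (simp add: s_def)
        also have "\<dots> \<le> norm (s - a)" by (rule abs_Im_le_cmod)
        finally have le: "1 / (2 * (k + 1)) \<le> norm (s - a)" .
        have "1 / norm (s - a) \<le> 1 / (1 / (2 * (k + 1)))"
          using less_le_trans[OF p le] p by (intro divide_left_mono le mult_pos_pos) auto
        thus "norm (1 / (s - a)) \<le> 2 * (k + 1)" by (simp add: norm_divide)
      qed
      also have "\<dots> = k * (2 * (k + 1))" by (simp add: sum_list_triv k_def)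
      also have "\<dots> \<le> (D * l) * (2 * (D * l + 1))" using k by (intro mult_mono) auto
      finally have S: "norm (\<Sum>a\<leftarrow>zs. 1 / (s - a)) \<le> (D * l) * (2 * (D * l + 1))" .
      have "norm (deriv zeta s / zeta s) \<le> norm (\<Sum>a\<leftarrow>zs. 1 / (s - a)) + norm (deriv zeta s / zeta s - (\<Sum>a\<leftarrow>zs. 1 / (s - a)))"
        using norm_triangle_ineq[of "\<Sum>a\<leftarrow>zs. 1 / (s - a)" "deriv zeta s / zeta s - (\<Sum>a\<leftarrow>zs. 1 / (s - a))"] by simp
      also have "\<dots> \<le> (D * l) * (2 * (D * l + 1)) + D * l"
        using S zs(3)[OF sc] nz CX by (intro add_mono) (auto simp: s_def)
      also have "\<dots> = 2 * D\<^sup>2 * l\<^sup>2 + 3 * D * l" by (simp add: power2_eq_square algebra_simps)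
      also have "\<dots> \<le> 2 * D\<^sup>2 * l\<^sup>2 + 3 * D * l\<^sup>2"
        using l D self_le_power[of l 2] by (intro add_left_mono mult_left_mono) auto
      finally show "norm (deriv zeta (Complex \<sigma> t) / zeta (Complex \<sigma> t)) \<le> (2 * D\<^sup>2 + 3 * D) * (ln (real n))\<^sup>2"
        by (simp add: s_def l_def distrib_right)
    qed (use t in auto)
  qed
  show ?thesis
  proof (intro exI[of _ "2 * D\<^sup>2 + 3 * D"] conjI exI[of _ 4] allI impI main)
    show "0 < 2 * D\<^sup>2 + 3 * D" using D by (simp add: add_pos_pos)
  qed
qed

lemma deriv_zeta_cnj: "s \<noteq> 1 \<Longrightarrow> deriv zeta (cnj s) = cnj (deriv zeta s)"
proof -
  assume s: "s \<noteq> 1"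
  have "(zeta has_field_derivative deriv zeta s) (at s)"
    by (rule holomorphic_derivI[OF zeta_holomorphic]) (use s in auto)
  hence "(cnj \<circ> zeta \<circ> cnj has_field_derivative cnj (deriv zeta s)) (at (cnj s))"
    by (intro has_field_derivative_cnj_cnj) simp
  also have "cnj \<circ> zeta \<circ> cnj = zeta" by (auto simp: zeta_cnj)
  finally show ?thesis by (rule DERIV_imp_deriv)
qed

text \<open>
  Zeros of a nonconstant holomorphic function are isolated; and were zeta constant, it would have no
  zeros at all.
\<close>

lemma finite_zeta_zeros:
  assumes K: "compact K" "1 \<notin> K"
  shows "finite {w\<in>K. zeta w = 0}"
proof (cases "zeta constant_on (- {1})")
  case True
  then obtain c where c: "\<And>s. s \<noteq> 1 \<Longrightarrow> zeta s = c" by (auto simp: constant_on_def)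
  have "c \<noteq> 0" using c[of 2] norm_zeta_ge_quarter[of 2] by auto
  hence "zeta w \<noteq> 0" if "w \<in> K" for w using c[of w] K(2) that by metis
  hence "{w\<in>K. zeta w = 0} = {}" by blast
  thus ?thesis by (simp only: finite.emptyI)
next
  case False
  show ?thesis
    by (rule holomorphic_compact_finite_zeros[OF zeta_holomorphic _ _ K(1) _ False])
       (use K(2) in \<open>auto intro!: connected_punctured_universe\<close>)
qed

lemma finite_zeros_upto:
  assumes RH: Riemann_hypothesis shows "finite (zeros_upto T)"
proof -
  have "zeros_upto T \<subseteq> {w\<in>closed_segment (Complex (1/2) 0) (Complex (1/2) T). zeta w = 0}"
  proof
    fix w assume "w \<in> zeros_upto T"
    hence "Re w = 1/2" "0 < Im w" "Im w \<le> T" "zeta w = 0"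
      using RH by (auto simp: zeros_upto_def Riemann_hypothesis_def nontrivial_zeros_def)
    thus "w \<in> {w\<in>closed_segment (Complex (1/2) 0) (Complex (1/2) T). zeta w = 0}"
      by (auto simp: closed_segment_same_Re closed_segment_eq_real_ivl)
  qed
  moreover have "finite {w\<in>closed_segment (Complex (1/2) 0) (Complex (1/2) T). zeta w = 0}"
    by (rule finite_zeta_zeros[OF compact_segment]) (auto simp: closed_segment_same_Re)
  ultimately show ?thesis by (rule finite_subset)
qed

text \<open>
  The argument principle. Zeros at height at most \<open>T0\<close> are not counted, which is
  harmless for an upper bound of the integral.
\<close>

lemma rectangle_zero_count:
  assumes fin: "finite (zeros_upto T)" and T: "0 < T0" "T0 < T"
    and a: "a1 = Complex (-1) T0" "a3 = Complex 2 T"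
    and nz: "\<And>s. s \<in> path_image (rectpath a1 a3) \<Longrightarrow> zeta s \<noteq> 0"
  shows "Im (contour_integral (rectpath a1 a3) (\<lambda>s. deriv zeta s / zeta s)) \<le> 2 * pi * real (zero_count T)"
proof -
  \<comment> \<open>a slightly larger open rectangle that avoids the pole and contains only finitely many zeros\<close>
  define S where "S = box (Complex (-2) (T0/2)) (Complex 3 (T + 1))"
  have S1: "1 \<notin> S" using T by (auto simp: S_def in_box_complex_iff)
  have sub: "cbox a1 a3 \<subseteq> S" using T by (auto simp: S_def a in_cbox_complex_iff in_box_complex_iff)
  have pi: "path_image (rectpath a1 a3) = cbox a1 a3 - box a1 a3"
    by (rule path_image_rectpath_cbox_minus_box) (use T in \<open>auto simp: a\<close>)
  have holS: "zeta holomorphic_on S"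
    by (rule holomorphic_on_subset[OF zeta_holomorphic]) (use S1 in auto)
  have finS: "finite {w\<in>S. zeta w = 0}"
  proof (rule finite_subset)
    show "finite {w\<in>cbox (Complex (-2) (T0/2)) (Complex 3 (T + 1)). zeta w = 0}"
      by (rule finite_zeta_zeros) (use T in \<open>auto simp: in_cbox_complex_iff\<close>)
    show "{w\<in>S. zeta w = 0} \<subseteq> {w\<in>cbox (Complex (-2) (T0/2)) (Complex 3 (T + 1)). zeta w = 0}"
      using box_subset_cbox by (auto simp: S_def)
  qed
  define Z where "Z = {w\<in>S. zeta w = 0}"
  have wn: "winding_number (rectpath a1 a3) p = (if p \<in> box a1 a3 then 1 else 0)" if "p \<in> Z" for p
  proof (cases "p \<in> box a1 a3")
    case False
    have "p \<notin> path_image (rectpath a1 a3)" using nz that by (auto simp: Z_def)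
    hence "p \<notin> cbox a1 a3" using False pi by auto
    hence "winding_number (rectpath a1 a3) p = 0"
      using T by (intro winding_number_rectpath_outside) (auto simp: a)
    thus ?thesis using False by simp
  qed (simp add: winding_number_rectpath)
  have "contour_integral (rectpath a1 a3) (\<lambda>x. deriv zeta x * 1 / zeta x) =
     2 * pi * \<i> * (\<Sum>p\<in>{w\<in>S. zeta w = 0 \<or> w \<in> {}}. winding_number (rectpath a1 a3) p * 1 * zorder zeta p)"
  proof (rule argument_principle)
    show "open S" "connected S" unfolding S_def by (auto intro: convex_connected)
    show "path_image (rectpath a1 a3) \<subseteq> S - {w \<in> S. zeta w = 0 \<or> w \<in> {}}"
      using nz pi sub by blast
    show "\<forall>z. z \<notin> S \<longrightarrow> winding_number (rectpath a1 a3) z = 0"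
    proof (intro allI impI)
      fix z assume "z \<notin> S"
      thus "winding_number (rectpath a1 a3) z = 0"
        using sub T by (intro winding_number_rectpath_outside) (auto simp: a)
    qed
  qed (use holS finS in auto)
  also have "{w\<in>S. zeta w = 0 \<or> w \<in> {}} = Z" by (simp add: Z_def)
  also have "(\<Sum>p\<in>Z. winding_number (rectpath a1 a3) p * 1 * zorder zeta p) =
     (\<Sum>p\<in>Z. if p \<in> box a1 a3 then of_real (real_of_int (zorder zeta p)) else 0)"
    by (intro sum.cong refl) (simp add: wn)
  also have "\<dots> = of_real (\<Sum>p\<in>Z \<inter> box a1 a3. real_of_int (zorder zeta p))"
    unfolding of_real_sum by (rule sum.inter_restrict[symmetric]) (use finS in \<open>simp add: Z_def\<close>)
  finally have "Im (contour_integral (rectpath a1 a3) (\<lambda>s. deriv zeta s / zeta s)) =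
     2 * pi * (\<Sum>p\<in>Z \<inter> box a1 a3. real_of_int (zorder zeta p))"
    by simp
  also have "(\<Sum>p\<in>Z \<inter> box a1 a3. real_of_int (zorder zeta p)) \<le> (\<Sum>p\<in>Z \<inter> box a1 a3. real (zero_mult p))"
    by (intro sum_mono) (simp add: zero_mult_def)
  also have "\<dots> \<le> (\<Sum>p\<in>zeros_upto T. real (zero_mult p))"
  proof (rule sum_mono2[OF fin])
    show "Z \<inter> box a1 a3 \<subseteq> zeros_upto T"
    proof
      fix p assume p: "p \<in> Z \<inter> box a1 a3"
      hence "0 < Im p" "Im p \<le> T" "zeta p = 0" using T by (auto simp: Z_def a in_box_complex_iff)
      thus "p \<in> zeros_upto T" by (auto simp: zeros_upto_def nontrivial_zeros_def)
    qed
  qed auto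
  finally show ?thesis by (simp add: zero_count_def)
qed

text \<open>
  On a horizontal line the functional equation reflects the part left of the critical line to the
  right part: \<open>1 - s\<close> is the complex conjugate of \<open>Complex (1 - \<sigma>)
  t\<close>.
\<close>

lemma zeta_left_half:
  assumes t: "t \<noteq> 0" and nz: "zeta (Complex (1 - \<sigma>) t) \<noteq> 0"
  shows "zeta (Complex \<sigma> t) \<noteq> 0"
    and "deriv zeta (Complex \<sigma> t) / zeta (Complex \<sigma> t) =
      chi_dlog (Complex \<sigma> t) - cnj (deriv zeta (Complex (1 - \<sigma>) t) / zeta (Complex (1 - \<sigma>) t))"
proof -
  let ?s = "Complex \<sigma> t" and ?w = "Complex (1 - \<sigma>) t"
  have e: "1 - ?s = cnj ?w" by (simp add: complex_eq_iff)
  have w1: "?w \<noteq> 1" using t by (auto simp: complex_eq_iff)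
  have "zeta ?s = chi ?s * cnj (zeta ?w)"
    using functional_equation[of ?s] t unfolding e zeta_cnj by (simp add: slit_plane_def)
  thus nz': "zeta ?s \<noteq> 0" using nz chi_nonzero_off_axis[of ?s] t by simp
  show "deriv zeta ?s / zeta ?s = chi_dlog ?s - cnj (deriv zeta ?w / zeta ?w)"
    using zeta_logderiv_reflect[OF _ nz'] t unfolding e zeta_cnj deriv_zeta_cnj[OF w1] by simp
qed

lemma continuous_logderiv:
  assumes "\<And>s. s \<in> A \<Longrightarrow> zeta s \<noteq> 0 \<and> s \<noteq> 1"
  shows "continuous_on A (\<lambda>s. deriv zeta s / zeta s)"
proof -
  have "deriv zeta holomorphic_on (- {1})"
    by (intro holomorphic_deriv zeta_holomorphic) auto
  hence "continuous_on A (deriv zeta)" "continuous_on A zeta"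
    using zeta_holomorphic assms by (blast intro: holomorphic_on_imp_continuous_on holomorphic_on_subset)+
  thus ?thesis using assms by (intro continuous_on_divide) auto
qed

text \<open>
  Integration around the rectangle with real parts in \<open>{-1..2}\<close> and heights in
  \<open>{T0..T}\<close>, where \<open>T0\<close> and \<open>T\<close> are good heights and
  \<open>T0\<close> is fixed. The lower side contributes a constant, the right side
  \<open>O(T)\<close>, the upper side \<open>O(T + (log T)\<^sup>2)\<close>, and on the left side
  the real part of the logarithmic derivative is at most \<open>O(1) - ln t\<close>.
\<close>

lemma zero_count_at_good_height:
  assumes RH: Riemann_hypothesis
  shows "\<exists>C>0. \<exists>n0. \<forall>n\<ge>n0. \<exists>t\<in>{real n..real n + 1}.
     t * ln t - C * t - C * (ln (real n))\<^sup>2 \<le> 2 * pi * real (zero_count t)"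
proof -
  let ?L = "\<lambda>s. deriv zeta s / zeta s"
  obtain C1 n1 where C1: "C1 > 0" and good': "\<forall>n\<ge>n1. \<exists>t\<in>{real n..real n + 1}. \<forall>\<sigma>\<in>{1/2..2}.
     zeta (Complex \<sigma> t) \<noteq> 0 \<and> norm (?L (Complex \<sigma> t)) \<le> C1 * (ln (real n))\<^sup>2"
    using zeta_logderiv_good_heights by (elim exE conjE) (rule that; assumption)
  note good = good'[rule_format]
  obtain C2 where C2': "C2 > 0" "\<forall>s. Re s = 2 \<longrightarrow> norm (?L s) \<le> C2"
    using zeta_logderiv_bounded_at_2 by (elim exE conjE) (rule that; assumption)
  note C2 = C2'(1) C2'(2)[rule_format]
  obtain C3 where C3': "C3 > 0" "\<forall>s. \<bar>Im s\<bar> \<ge> 1 \<longrightarrow> Re s \<le> 1/2 \<longrightarrow> norm (chi_dlog s) \<le> C3 + 4 * norm s"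
     "\<forall>t\<ge>1. Re (chi_dlog (-1 + \<i> * of_real t)) \<le> C3 - ln t"
    using chi_dlog_bounds by (elim exE conjE) (rule that; assumption)
  note C3 = C3'(1) C3'(2)[rule_format] C3'(3)[rule_format]
  define N0 where "N0 = max n1 1"
  obtain T0 where T0: "T0 \<in> {real N0..real N0 + 1}" "\<And>\<sigma>. \<sigma> \<in> {1/2..2} \<Longrightarrow> zeta (Complex \<sigma> T0) \<noteq> 0"
  proof -
    have "n1 \<le> N0" by (simp add: N0_def)
    from good[OF this] show ?thesis using that by blast
  qed
  have T01: "T0 \<ge> 1" using T0(1) by (auto simp: N0_def)
  have nzR: "zeta (Complex 2 t) \<noteq> 0" for t using norm_zeta_ge_quarter[of "Complex 2 t"] by auto
  have nzH: "zeta (Complex \<sigma> t) \<noteq> 0" if nz: "\<And>\<sigma>. \<sigma> \<in> {1/2..2} \<Longrightarrow> zeta (Complex \<sigma> t) \<noteq> 0" and t: "t \<ge> 1" and \<sigma>: "\<sigma> \<in> {-1..2}" for \<sigma> t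
  proof (cases "\<sigma> \<ge> 1/2")
    case False
    hence "1 - \<sigma> \<in> {1/2..2}" using \<sigma> by simp
    from zeta_left_half(1)[OF _ nz[OF this]] t show ?thesis by simp
  next
    case True
    show ?thesis by (rule nz) (use True \<sigma> in simp)
  qed
  have nzL: "zeta (Complex (-1) t) \<noteq> 0" if "t \<ge> 1" for t
    using zeta_left_half(1)[of t "-1"] nzR[of t] that by simp
  define B where "B = norm (contour_integral (linepath (Complex (-1) T0) (Complex 2 T0)) ?L)"
  \<comment> \<open>the sum of the constants from the four sides, with room for comparing lower order terms with \<open>T\<close>\<close>
  define C where "C = B + C2 + 3 * C3 + 24 + 3 * C1 + (1 + C3 + C2) * (T0 + 1) + T0 * ln T0 + C3"
  have C0: "C > 0"
  proof -
    have "(1 + C3 + C2) * (T0 + 1) > 0" "T0 * ln T0 \<ge> 0" "B \<ge> 0" using T01 C1 C2 C3 by (auto simp: B_def)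
    thus ?thesis using C1 C2 C3 unfolding C_def by linarith
  qed
  have main: "\<exists>t\<in>{real n..real n + 1}. t * ln t - C * t - C * (ln (real n))\<^sup>2 \<le> 2 * pi * real (zero_count t)"
    if n: "n \<ge> N0 + 2" for n
  proof -
    obtain T where T: "T \<in> {real n..real n + 1}" and good: "\<And>\<sigma>. \<sigma> \<in> {1/2..2} \<Longrightarrow>
       zeta (Complex \<sigma> T) \<noteq> 0 \<and> norm (?L (Complex \<sigma> T)) \<le> C1 * (ln (real n))\<^sup>2"
    proof -
      have "n1 \<le> n" using n by (simp add: N0_def)
      from good[OF this] show ?thesis using that by blast
    qed
    have TT: "T0 < T" using T T0(1) n by auto
    have T1: "T \<ge> 1" using TT T01 by simp
    define Q where "Q = C1 * (ln (real n))\<^sup>2"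
    have Q0: "Q \<ge> 0" using C1 by (simp add: Q_def)
    let ?a1 = "Complex (-1) T0" and ?a2 = "Complex 2 T0" and ?a3 = "Complex 2 T" and ?a4 = "Complex (-1) T"
    have img: "path_image (rectpath ?a1 ?a3) = {z. Im z = T0 \<and> Re z \<in> {-1..2}} \<union> {z. Re z = 2 \<and> Im z \<in> {T0..T}} \<union>
       {z. Im z = T \<and> Re z \<in> {-1..2}} \<union> {z. Re z = -1 \<and> Im z \<in> {T0..T}}"
      using TT by (subst path_image_rectpath) auto
    have nz: "zeta s \<noteq> 0" if s': "s \<in> path_image (rectpath ?a1 ?a3)" for s
    proof -
      have s: "s = Complex (Re s) (Im s)" by simp
      consider "Im s = T0" "Re s \<in> {-1..2}" | "Re s = 2" | "Im s = T" "Re s \<in> {-1..2}" | "Re s = -1" "Im s \<ge> T0"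
        using s' unfolding img Un_iff mem_Collect_eq atLeastAtMost_iff by blast
      thus ?thesis
      proof cases
        case 1
        have "zeta (Complex (Re s) T0) \<noteq> 0" by (rule nzH[OF T0(2) T01 1(2)])
        thus ?thesis unfolding 1(1)[symmetric] complex.collapse .
      next
        case 2
        have "zeta (Complex 2 (Im s)) \<noteq> 0" by (rule nzR)
        thus ?thesis unfolding 2[symmetric] complex.collapse .
      next
        case 3
        have "zeta (Complex (Re s) T) \<noteq> 0" by (rule nzH[OF _ T1 3(2)]) (use good in blast)
        thus ?thesis unfolding 3(1)[symmetric] complex.collapse .
      next
        case 4
        have "zeta (Complex (-1) (Im s)) \<noteq> 0" by (rule nzL) (use 4 T01 in simp)
        thus ?thesis unfolding 4(1)[symmetric] complex.collapse .
      qed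
    qed
    have n1: "s \<noteq> 1" if "s \<in> path_image (rectpath ?a1 ?a3)" for s
      using that T01 TT unfolding img by auto
    have seg: "closed_segment ?a1 ?a2 \<subseteq> path_image (rectpath ?a1 ?a3)" "closed_segment ?a2 ?a3 \<subseteq> path_image (rectpath ?a1 ?a3)"
       "closed_segment ?a3 ?a4 \<subseteq> path_image (rectpath ?a1 ?a3)" "closed_segment ?a4 ?a1 \<subseteq> path_image (rectpath ?a1 ?a3)"
      by (auto simp: rectpath_def Let_def path_image_join)
    have int: "?L contour_integrable_on linepath ?a1 ?a2" "?L contour_integrable_on linepath ?a2 ?a3"
       "?L contour_integrable_on linepath ?a3 ?a4" "?L contour_integrable_on linepath ?a4 ?a1"
      by (intro contour_integrable_continuous_linepath continuous_logderiv; use seg nz n1 in blast)+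
    have eq: "contour_integral (rectpath ?a1 ?a3) ?L = contour_integral (linepath ?a1 ?a2) ?L + (contour_integral (linepath ?a2 ?a3) ?L +
        (contour_integral (linepath ?a3 ?a4) ?L + contour_integral (linepath ?a4 ?a1) ?L))"
      unfolding rectpath_def Let_def using int by simp
    have "Im (contour_integral (rectpath ?a1 ?a3) ?L) \<le> 2 * pi * real (zero_count T)"
      by (rule rectangle_zero_count[OF finite_zeros_upto[OF RH]]) (use nz T01 TT in auto)
    moreover have "Im (contour_integral (linepath ?a1 ?a2) ?L) \<ge> - B"
      using abs_Im_le_cmod[of "contour_integral (linepath ?a1 ?a2) ?L"] unfolding B_def by linarith
    moreover have "Im (contour_integral (linepath ?a2 ?a3) ?L) \<ge> - (C2 * T)"
    proof -
      have "norm (contour_integral (linepath ?a2 ?a3) ?L) \<le> C2 * norm (?a3 - ?a2)"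
        by (rule has_contour_integral_bound_linepath[OF has_contour_integral_integral[OF int(2)]])
           (use C2 in \<open>auto simp: closed_segment_same_Re\<close>)
      also have "?a3 - ?a2 = \<i> * of_real (T - T0)" by (simp add: complex_eq_iff)
      also have "C2 * norm (\<i> * of_real (T - T0)) \<le> C2 * T"
        unfolding norm_mult norm_of_real using TT T01 C2(1) by (intro mult_left_mono) auto
      finally show ?thesis
        using abs_Im_le_cmod[of "contour_integral (linepath ?a2 ?a3) ?L"] by linarith
    qed
    moreover have "Im (contour_integral (linepath ?a3 ?a4) ?L) \<ge> - ((C3 + 4 * (T + 1) + Q) * 3)"
    proof -
      have "norm (contour_integral (linepath ?a3 ?a4) ?L) \<le> (C3 + 4 * (T + 1) + Q) * norm (?a4 - ?a3)"
      proof (rule has_contour_integral_bound_linepath[OF has_contour_integral_integral[OF int(3)]])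
        show "0 \<le> C3 + 4 * (T + 1) + Q" using C3(1) Q0 T1 by simp
        fix s assume "s \<in> closed_segment ?a3 ?a4"
        hence sT: "Im s = T" "Re s \<in> {-1..2}"
          by (auto simp: closed_segment_same_Im closed_segment_eq_real_ivl)
        define \<sigma> where "\<sigma> = Re s"
        have \<sigma>: "s = Complex \<sigma> T" "\<sigma> \<in> {-1..2}" using sT by (simp_all add: \<sigma>_def complex_eq_iff)
        show "norm (?L s) \<le> C3 + 4 * (T + 1) + Q"
        proof (cases "\<sigma> \<ge> 1/2")
          case True
          hence "norm (?L s) \<le> Q" using good[of \<sigma>] \<sigma> by (simp add: Q_def)
          thus ?thesis using C3(1) T1 by simp
        next
          case False
          have g: "zeta (Complex (1 - \<sigma>) T) \<noteq> 0" "norm (?L (Complex (1 - \<sigma>) T)) \<le> Q"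
            using good[of "1 - \<sigma>"] False \<sigma>(2) by (auto simp: Q_def)
          have "norm (?L s) \<le> norm (chi_dlog s) + norm (cnj (?L (Complex (1 - \<sigma>) T)))"
            unfolding \<sigma>(1) using zeta_left_half(2)[OF _ g(1)] T1 norm_triangle_ineq4 by simp
          also have "norm (chi_dlog s) \<le> C3 + 4 * norm s" using False T1 by (intro C3(2)) (auto simp: \<sigma>)
          also have "norm s \<le> T + 1" using cmod_le[of s] False \<sigma> T1 by (simp add: \<sigma>(1))
          also have "norm (cnj (?L (Complex (1 - \<sigma>) T))) \<le> Q" using g(2) unfolding complex_mod_cnj .
          finally show ?thesis by simp
        qed
      qed
      also have "?a4 - ?a3 = of_real (- 3)" by (simp add: complex_eq_iff)
      also have "norm (complex_of_real (- 3)) = 3" unfolding norm_of_real by simp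
      finally show ?thesis
        using abs_Im_le_cmod[of "contour_integral (linepath ?a3 ?a4) ?L"] by linarith
    qed
    moreover have "Im (contour_integral (linepath ?a4 ?a1) ?L) \<ge> T * ln T - T0 * ln T0 - (1 + C3 + C2) * (T - T0)"
    proof -
      define I where "I = contour_integral (linepath ?a1 ?a4) ?L"
      have int': "?L contour_integrable_on linepath ?a1 ?a4"
      proof (intro contour_integrable_continuous_linepath continuous_logderiv)
        fix s assume "s \<in> closed_segment ?a1 ?a4"
        hence "s \<in> path_image (rectpath ?a1 ?a3)" using seg(4) by (auto simp: closed_segment_commute)
        thus "zeta s \<noteq> 0 \<and> s \<noteq> 1" using nz n1 by blast
      qed
      have "((\<lambda>t. ?L (Complex (-1) t)) has_integral (- \<i> * I)) {T0..T}"
        using has_contour_integral_integral[OF int'] TT unfolding I_def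
        by (subst (asm) has_contour_integral_linepath_same_Re_iff) auto
      hence "((\<lambda>t. Re (?L (Complex (-1) t))) has_integral Re (- \<i> * I)) {T0..T}"
        by (rule has_integral_Re)
      moreover have "((\<lambda>t. C3 + C2 - ln t) has_integral ((C3 + C2) * T - (T * ln T - T)) - ((C3 + C2) * T0 - (T0 * ln T0 - T0))) {T0..T}"
      proof (rule fundamental_theorem_of_calculus)
        fix t assume t: "t \<in> {T0..T}"
        have "((\<lambda>t. (C3 + C2) * t - (t * ln t - t)) has_real_derivative C3 + C2 - ln t) (at t)"
          using t T01 by (auto intro!: derivative_eq_intros)
        thus "((\<lambda>t. (C3 + C2) * t - (t * ln t - t)) has_vector_derivative C3 + C2 - ln t) (at t within {T0..T})"
          using has_field_derivative_at_within has_real_derivative_iff_has_vector_derivative by blast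
      qed (use TT in auto)
      ultimately have "Re (- \<i> * I) \<le> ((C3 + C2) * T - (T * ln T - T)) - ((C3 + C2) * T0 - (T0 * ln T0 - T0))"
      proof (rule has_integral_le)
        fix t assume t: "t \<in> {T0..T}"
        have "Complex (-1) t = -1 + \<i> * of_real t" by (simp add: complex_eq_iff)
        hence "Re (chi_dlog (Complex (-1) t)) \<le> C3 - ln t" using C3(3)[of t] t T01 by simp
        moreover have "Re (?L (Complex (-1) t)) = Re (chi_dlog (Complex (-1) t)) - Re (?L (Complex 2 t))"
        proof -
          have e: "1 - (- 1) = (2::real)" by simp
          have "?L (Complex (-1) t) = chi_dlog (Complex (-1) t) - cnj (?L (Complex 2 t))"
          proof (rule zeta_left_half(2)[of t "-1", unfolded e, OF _ nzR[of t]])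
            show "t \<noteq> 0" using t T01 by auto
          qed
          thus ?thesis by (simp only: minus_complex.sel cnj.simps)
        qed
        moreover have "\<bar>Re (?L (Complex 2 t))\<bar> \<le> C2"
          using C2(2)[of "Complex 2 t"] abs_Re_le_cmod[of "?L (Complex 2 t)"] by simp
        ultimately show "Re (?L (Complex (-1) t)) \<le> C3 + C2 - ln t" by linarith
      qed
      hence "Im I \<le> ((C3 + C2) * T - (T * ln T - T)) - ((C3 + C2) * T0 - (T0 * ln T0 - T0))" by simp
      moreover have "contour_integral (linepath ?a4 ?a1) ?L = - I"
        unfolding I_def using contour_integral_reversepath[of "linepath ?a1 ?a4" ?L] by simp
      ultimately show ?thesis by (simp add: algebra_simps)
    qed
    ultimately have "T * ln T - T0 * ln T0 - (1 + C3 + C2) * (T - T0) - (C3 + 4 * (T + 1) + Q) * 3 - C2 * T - B \<le> 2 * pi * real (zero_count T)"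
      unfolding eq by simp
    moreover have "C * T + C * (ln (real n))\<^sup>2 \<ge> T0 * ln T0 + (1 + C3 + C2) * (T - T0) + (C3 + 4 * (T + 1) + Q) * 3 + C2 * T + B"
    proof -
      have "3 * C1 \<le> C" unfolding C_def using T01 C1 C2 C3 by (simp add: B_def)
      hence "3 * Q \<le> C * (ln (real n))\<^sup>2" unfolding Q_def by (simp add: mult_right_mono flip: mult.assoc)
      moreover have "C * T \<ge> T0 * ln T0 + (1 + C3 + C2) * (T - T0) + (C3 + 4 * (T + 1)) * 3 + C2 * T + B"
      proof -
        have b: "B * 1 \<le> B * T" "T0 * ln T0 * 1 \<le> T0 * ln T0 * T" "C3 * 1 \<le> C3 * T"
          "(1 + C3 + C2) * (T - T0) \<le> (1 + C3 + C2) * (T0 + 1) * T"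
        proof -
          have m: "x * 1 \<le> x * T" if "x \<ge> 0" for x
            using that T1 by (intro mult_left_mono) auto
          show "B * 1 \<le> B * T" by (rule m) (simp add: B_def)
          show "T0 * ln T0 * 1 \<le> T0 * ln T0 * T" by (rule m) (use T01 in simp)
          show "C3 * 1 \<le> C3 * T" by (rule m) (use C3(1) in simp)
          have "1 * T \<le> (T0 + 1) * T" using T01 T1 by (intro mult_right_mono) auto
          hence "T - T0 \<le> (T0 + 1) * T" using T01 by linarith
          thus "(1 + C3 + C2) * (T - T0) \<le> (1 + C3 + C2) * (T0 + 1) * T"
            unfolding mult.assoc using C2 C3 by (intro mult_left_mono) auto
        qed
        have "C * T = B * T + C2 * T + 3 * (C3 * T) + 24 * T + 3 * C1 * T + (1 + C3 + C2) * (T0 + 1) * T + T0 * ln T0 * T + C3 * T"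
          unfolding C_def by (simp only: distrib_right mult.assoc)
        moreover have "3 * C1 * T \<ge> 0" "C3 * T \<ge> 0" using C1 C3(1) T1 by auto
        ultimately have facts: "C * T = B * T + C2 * T + 3 * (C3 * T) + 24 * T + 3 * C1 * T + (1 + C3 + C2) * (T0 + 1) * T + T0 * ln T0 * T + C3 * T"
          "3 * C1 * T \<ge> 0" "C3 * T \<ge> 0" by blast+
        have "U + X + (C3 + 4 * (T + 1)) * 3 + C2' + B \<le> C'"
          if "C' = B' + C2' + 3 * C3' + 24 * T + E + Y + V + C3'" "E \<ge> 0" "C3' \<ge> 0" "B * 1 \<le> B'"
             "U * 1 \<le> V" "C3 * 1 \<le> C3'" "X \<le> Y" for U V X Y E B' C2' C3' C' :: real
          using that T1 by (simp add: algebra_simps)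
        from this[OF facts b] show ?thesis .
      qed
      ultimately show ?thesis by (simp add: algebra_simps)
    qed
    ultimately show ?thesis using T by (intro bexI[of _ T]) linarith+
  qed
  show ?thesis using C0 main by blast
qed

lemma zero_count_mono:
  assumes RH: Riemann_hypothesis and "T \<le> T'" shows "zero_count T \<le> zero_count T'"
  unfolding zero_count_def using assms(2)
  by (intro sum_mono2 finite_zeros_upto[OF RH]) (auto simp: zeros_upto_def)

text \<open>
  A good height exists in \<open>{T - 2..T}\<close>, and \<open>zero_count\<close> is monotone.
\<close>

theorem zero_count_lower_bound:
  assumes RH: Riemann_hypothesis and \<epsilon>: "\<epsilon> > 0"
  shows "eventually (\<lambda>T. real (zero_count T) \<ge> (1 - \<epsilon>) * (T * ln T / (2 * pi))) at_top"
proof -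
  obtain C n0 where C: "C > 0" and main: "\<And>n. n \<ge> n0 \<Longrightarrow> \<exists>t\<in>{real n..real n + 1}.
     t * ln t - C * t - C * (ln (real n))\<^sup>2 \<le> 2 * pi * real (zero_count t)"
    using zero_count_at_good_height[OF RH] by blast
  have "eventually (\<lambda>T. (T - 2) * ln (T - 2) - C * T - C * (ln T)\<^sup>2 \<ge> (1 - \<epsilon>) * (T * ln T)) at_top"
    using C \<epsilon> by real_asymp
  moreover have "eventually (\<lambda>T. T \<ge> real n0 + 3) at_top" by (rule eventually_ge_at_top)
  ultimately show ?thesis
  proof eventually_elim
    case (elim T)
    define n where "n = nat \<lfloor>T - 1\<rfloor>"
    have n: "n \<ge> n0" "real n \<le> T - 1" "real n \<ge> T - 2" using elim(2) by (auto simp: n_def) linarith+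
    obtain t where t: "t \<in> {real n..real n + 1}" "t * ln t - C * t - C * (ln (real n))\<^sup>2 \<le> 2 * pi * real (zero_count t)"
      using main[OF n(1)] by blast
    have tT: "T - 2 \<le> t" "t \<le> T" "T - 2 \<ge> 1" using t(1) n elim(2) by auto
    have "(T - 2) * ln (T - 2) \<le> t * ln t" using tT by (intro mult_mono) auto
    moreover have "C * t \<le> C * T" using C tT by simp
    moreover have "C * (ln (real n))\<^sup>2 \<le> C * (ln T)\<^sup>2" using C n tT by (intro mult_left_mono power_mono) auto
    moreover have "2 * pi * real (zero_count t) \<le> 2 * pi * real (zero_count T)"
      using zero_count_mono[OF RH tT(2)] by simp
    ultimately have "(1 - \<epsilon>) * (T * ln T) \<le> 2 * pi * real (zero_count T)" using elim(1) t(2) by linarith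
    thus ?case by (simp add: field_simps)
  qed
qed

section \<open>Sign changes of Hardy's function\<close>

definition hardy :: "real \<Rightarrow> real" where "hardy t = Re (Hardy_Z t)"

lemma chi_inv_sqrt: "continuous_on UNIV chi_inv_sqrt" "chi_inv_sqrt t ^ 2 = inverse (chi (1/2 + \<i> * of_real t))"
  "chi_inv_sqrt t \<noteq> 0"
proof -
  show "continuous_on UNIV chi_inv_sqrt" "chi_inv_sqrt t ^ 2 = inverse (chi (1/2 + \<i> * of_real t))"
    using is_chi_branch_chi_inv_sqrt by (auto simp: is_chi_branch_def)
  hence "chi_inv_sqrt t ^ 2 \<noteq> 0" using chi_nonzero[of t] by simp
  thus "chi_inv_sqrt t \<noteq> 0" by auto
qed

text \<open>
  On the critical line \<open>1 - s = cnj s\<close>, so by the functional equation the square of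
  \<open>Hardy_Z t\<close> is \<open>zeta s * cnj (zeta s)\<close>, a nonnegative real number.
\<close>

lemma Hardy_Z_real:
  assumes t: "t \<noteq> 0" shows "Hardy_Z t = of_real (hardy t)"
proof -
  let ?s = "1/2 + \<i> * complex_of_real t"
  have e: "1 - ?s = cnj ?s" by (simp add: complex_eq_iff)
  have fe: "zeta ?s = chi ?s * cnj (zeta ?s)"
    using functional_equation[of ?s] t unfolding e zeta_cnj by (simp add: slit_plane_def)
  have "(Hardy_Z t)\<^sup>2 = (zeta ?s)\<^sup>2 * inverse (chi ?s)"
    unfolding Hardy_Z_def power_mult_distrib chi_inv_sqrt(2) ..
  also have "\<dots> = zeta ?s * (chi ?s * cnj (zeta ?s)) * inverse (chi ?s)"
    unfolding fe[symmetric] power2_eq_square ..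
  also have "\<dots> = zeta ?s * cnj (zeta ?s)" using chi_nonzero[of t] by simp
  also have "\<dots> = of_real ((norm (zeta ?s))\<^sup>2)" by (rule complex_norm_square[symmetric])
  finally have sq: "(Hardy_Z t)\<^sup>2 = of_real ((norm (zeta ?s))\<^sup>2)" .
  have "Im (Hardy_Z t) = 0"
  proof (rule ccontr)
    assume I: "Im (Hardy_Z t) \<noteq> 0"
    have "Im ((Hardy_Z t)\<^sup>2) = 2 * Re (Hardy_Z t) * Im (Hardy_Z t)" by (simp add: power2_eq_square)
    moreover have "Im ((Hardy_Z t)\<^sup>2) = 0" unfolding sq by simp
    ultimately have R: "Re (Hardy_Z t) = 0" using I by simp
    have "Re ((Hardy_Z t)\<^sup>2) = - (Im (Hardy_Z t))\<^sup>2" using R by (simp add: power2_eq_square)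
    moreover have "Re ((Hardy_Z t)\<^sup>2) \<ge> 0" unfolding sq by simp
    moreover have "(Im (Hardy_Z t))\<^sup>2 > 0" using I by simp
    ultimately show False by linarith
  qed
  thus ?thesis by (simp add: hardy_def complex_eq_iff)
qed

lemma hardy_zero_iff: "t \<noteq> 0 \<Longrightarrow> hardy t = 0 \<longleftrightarrow> zeta (Complex (1/2) t) = 0"
proof -
  assume t: "t \<noteq> 0"
  have e: "1/2 + \<i> * complex_of_real t = Complex (1/2) t" by (simp add: complex_eq_iff)
  have "hardy t = 0 \<longleftrightarrow> Hardy_Z t = 0" unfolding Hardy_Z_real[OF t] by simp
  also have "\<dots> \<longleftrightarrow> zeta (Complex (1/2) t) = 0" unfolding Hardy_Z_def e using chi_inv_sqrt(3) by simp
  finally show ?thesis .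
qed

lemma continuous_hardy: "continuous_on UNIV hardy"
proof -
  have "continuous_on UNIV (\<lambda>t. zeta (1/2 + \<i> * complex_of_real t))"
  proof (rule continuous_on_compose2[OF holomorphic_on_imp_continuous_on[OF zeta_holomorphic]])
    show "continuous_on UNIV (\<lambda>t. 1/2 + \<i> * complex_of_real t)" by (intro continuous_intros)
  qed (auto simp: complex_eq_iff)
  thus ?thesis unfolding hardy_def Hardy_Z_def
    by (intro continuous_intros chi_inv_sqrt(1))
qed

lemma I_plus_hardy: "I_plus T = {t. 0 < t \<and> t \<le> T \<and> hardy t > 0}"
  and I_minus_hardy: "I_minus T = {t. 0 < t \<and> t \<le> T \<and> hardy t < 0}"
  unfolding I_plus_def I_minus_def by (auto simp: Hardy_Z_real less_complex_def)

text \<open>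
  The local form of a zero of the given multiplicity, with a continuous nonvanishing cofactor.
\<close>

lemma zeta_zero_factor:
  assumes r: "\<rho> \<in> nontrivial_zeros"
  shows "zero_mult \<rho> \<ge> 1"
    and "\<exists>h r. r > 0 \<and> continuous_on (cball \<rho> r) h \<and> (\<forall>w\<in>cball \<rho> r. zeta w = h w * (w - \<rho>) ^ zero_mult \<rho> \<and> h w \<noteq> 0)"
proof -
  have r: "\<rho> \<in> - {1}" "zeta \<rho> = 0" using r by (auto simp: nontrivial_zeros_def)
  have op: "open (- {1::complex})" by auto
  have con: "connected (- {1::complex})" by (rule connected_punctured_universe) simp
  have nc: "\<exists>w\<in>- {1}. zeta w \<noteq> 0" using norm_zeta_ge_quarter[of 2] by (intro bexI[of _ 2]) auto
  have Z: "zorder zeta \<rho> > 0" "\<exists>r. r > 0 \<and> cball \<rho> r \<subseteq> - {1} \<and> zor_poly zeta \<rho> holomorphic_on cball \<rho> r \<and>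
      (\<forall>w\<in>cball \<rho> r. zeta w = zor_poly zeta \<rho> w * (w - \<rho>) ^ nat (zorder zeta \<rho>) \<and> zor_poly zeta \<rho> w \<noteq> 0)"
    using zorder_exist_zero[OF zeta_holomorphic op con r(1) nc] r(2) by simp_all
  show "zero_mult \<rho> \<ge> 1" using Z(1) by (simp add: zero_mult_def)
  show "\<exists>h r. r > 0 \<and> continuous_on (cball \<rho> r) h \<and> (\<forall>w\<in>cball \<rho> r. zeta w = h w * (w - \<rho>) ^ zero_mult \<rho> \<and> h w \<noteq> 0)"
    using Z(2) holomorphic_on_imp_continuous_on unfolding zero_mult_def by blast
qed

text \<open>
  Near a simple zero \<open>hardy t = (t - \<gamma>) * Re (k t)\<close> with \<open>k\<close>
  continuous and nonzero at \<open>\<gamma>\<close>. For \<open>t\<close> near but different from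
  \<open>\<gamma>\<close> the value \<open>k t\<close> is real, hence also at
  \<open>\<gamma>\<close>, so its real part does not vanish there.
\<close>

lemma hardy_sign_change:
  assumes z: "Complex (1/2) \<gamma> \<in> nontrivial_zeros" "zero_mult (Complex (1/2) \<gamma>) = 1" and \<gamma>: "\<gamma> > 0"
  shows "\<exists>d>0. (\<forall>t. 0 < \<bar>t - \<gamma>\<bar> \<and> \<bar>t - \<gamma>\<bar> < d \<longrightarrow> (t - \<gamma>) * hardy t > 0) \<or>
                (\<forall>t. 0 < \<bar>t - \<gamma>\<bar> \<and> \<bar>t - \<gamma>\<bar> < d \<longrightarrow> (t - \<gamma>) * hardy t < 0)"
proof -
  define \<rho> where "\<rho> = Complex (1/2) \<gamma>"
  obtain h r where h: "r > 0" "continuous_on (cball \<rho> r) h" "\<And>w. w \<in> cball \<rho> r \<Longrightarrow> zeta w = h w * (w - \<rho>)" "h \<rho> \<noteq> 0"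
    using zeta_zero_factor(2)[OF z(1)] z(2) unfolding \<rho>_def[symmetric] by (auto simp: dist_norm)
  define k where "k = (\<lambda>t. \<i> * h (Complex (1/2) t) * chi_inv_sqrt t)"
  have incb: "Complex (1/2) t \<in> cball \<rho> r" if "t \<in> cball \<gamma> r" for t
  proof -
    have "\<rho> - Complex (1/2) t = \<i> * of_real (\<gamma> - t)" by (simp add: \<rho>_def complex_eq_iff)
    hence "norm (\<rho> - Complex (1/2) t) = \<bar>\<gamma> - t\<bar>" by (simp only: norm_mult norm_ii norm_of_real mult_1)
    thus ?thesis using that by (simp add: dist_norm)
  qed
  have Zk: "Hardy_Z t = of_real (t - \<gamma>) * k t" if "t \<in> cball \<gamma> r" for t
  proof -
    have e: "1/2 + \<i> * complex_of_real t = Complex (1/2) t" by (simp add: complex_eq_iff)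
    have "Complex (1/2) t - \<rho> = \<i> * of_real (t - \<gamma>)" by (simp add: \<rho>_def complex_eq_iff)
    thus ?thesis unfolding Hardy_Z_def e h(3)[OF incb[OF that]] k_def by (simp add: mult_ac)
  qed
  have contk: "continuous_on (cball \<gamma> r) k"
  proof -
    have "continuous_on (cball \<gamma> r) (\<lambda>t. Complex (1/2) t)" unfolding Complex_eq by (intro continuous_intros)
    hence "continuous_on (cball \<gamma> r) (\<lambda>t. h (Complex (1/2) t))"
      by (rule continuous_on_compose2[OF h(2)]) (use incb in auto)
    thus ?thesis unfolding k_def
      by (intro continuous_intros continuous_on_subset[OF chi_inv_sqrt(1)]) auto
  qed
  hence isk: "isCont k \<gamma>" using h(1) by (intro continuous_on_interior) auto
  have "k \<gamma> \<noteq> 0" using h(4) chi_inv_sqrt(3) by (simp add: k_def \<rho>_def)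
  \<comment> \<open>\<open>Hardy_Z\<close> is known to be real only away from \<open>t = 0\<close>\<close>
  define e where "e = min r \<gamma>"
  have e0: "e > 0" using h(1) \<gamma> by (simp add: e_def)
  have real_k: "hardy t = (t - \<gamma>) * Re (k t) \<and> Im (k t) = 0" if "0 < \<bar>t - \<gamma>\<bar>" "\<bar>t - \<gamma>\<bar> < e" for t
  proof -
    have t: "t \<in> cball \<gamma> r" "t \<noteq> 0" using that by (auto simp: e_def dist_real_def)
    have "of_real (hardy t) = of_real (t - \<gamma>) * k t" using Zk[OF t(1)] Hardy_Z_real[OF t(2)] by simp
    hence "hardy t = (t - \<gamma>) * Re (k t)" "0 = (t - \<gamma>) * Im (k t)" by (simp_all add: complex_eq_iff)
    thus ?thesis using that by auto
  qed
  have "Im (k \<gamma>) = 0"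
  proof -
    have "((\<lambda>t. Im (k t)) \<longlongrightarrow> Im (k \<gamma>)) (at \<gamma>)" using isk by (intro tendsto_Im) (simp add: isCont_def)
    moreover have "eventually (\<lambda>t. Im (k t) = 0) (at \<gamma>)"
      unfolding eventually_at using real_k e0 by (intro exI[of _ e]) (auto simp: dist_real_def)
    hence "((\<lambda>t. Im (k t)) \<longlongrightarrow> 0) (at \<gamma>)" by (rule tendsto_eventually)
    ultimately show ?thesis using tendsto_unique[OF trivial_limit_at] by blast
  qed
  hence Rk: "Re (k \<gamma>) \<noteq> 0" using \<open>k \<gamma> \<noteq> 0\<close> by (simp add: complex_eq_iff)
  have tR: "((\<lambda>t. Re (k t)) \<longlongrightarrow> Re (k \<gamma>)) (at \<gamma>)" using isk by (intro tendsto_Re) (simp add: isCont_def)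
  have sq: "(t - \<gamma>) * hardy t = (t - \<gamma>)\<^sup>2 * Re (k t)" if "0 < \<bar>t - \<gamma>\<bar>" "\<bar>t - \<gamma>\<bar> < e" for t
    using real_k[OF that] by (simp add: power2_eq_square)
  show ?thesis
  proof (cases "Re (k \<gamma>) > 0")
    case True
    have "eventually (\<lambda>t. Re (k t) > 0) (at \<gamma>)" using order_tendstoD(1)[OF tR True] .
    then obtain d where d: "d > 0" "\<And>t. t \<noteq> \<gamma> \<Longrightarrow> \<bar>t - \<gamma>\<bar> < d \<Longrightarrow> Re (k t) > 0"
      unfolding eventually_at by (auto simp: dist_real_def)
    show ?thesis
    proof (intro exI[of _ "min d e"] conjI disjI1 allI impI)
      fix t assume t: "0 < \<bar>t - \<gamma>\<bar> \<and> \<bar>t - \<gamma>\<bar> < min d e"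
      have "Re (k t) > 0" using t by (intro d(2)) auto
      thus "(t - \<gamma>) * hardy t > 0" using sq[of t] t by simp
    qed (use d e0 in auto)
  next
    case False
    hence "Re (k \<gamma>) < 0" using Rk by simp
    have "eventually (\<lambda>t. Re (k t) < 0) (at \<gamma>)" using order_tendstoD(2)[OF tR \<open>Re (k \<gamma>) < 0\<close>] .
    then obtain d where d: "d > 0" "\<And>t. t \<noteq> \<gamma> \<Longrightarrow> \<bar>t - \<gamma>\<bar> < d \<Longrightarrow> Re (k t) < 0"
      unfolding eventually_at by (auto simp: dist_real_def)
    show ?thesis
    proof (intro exI[of _ "min d e"] conjI disjI2 allI impI)
      fix t assume t: "0 < \<bar>t - \<gamma>\<bar> \<and> \<bar>t - \<gamma>\<bar> < min d e"
      have "Re (k t) < 0" using t by (intro d(2)) auto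
      thus "(t - \<gamma>) * hardy t < 0" using sq[of t] t by (simp add: mult_pos_neg)
    qed (use d e0 in auto)
  qed
qed

section \<open>Gaps between ordinates\<close>

text \<open>
  Layer cake: the length \<open>l\<close> of an interval is at least \<open>h\<close> times the
  number of \<open>k \<ge> 1\<close> with \<open>k h < l\<close>. After summation over the intervals
  and an exchange of the two sums, only upper bounds for the numbers of short intervals are needed.
\<close>

lemma intervals_measure:
  fixes lo hi :: "'a \<Rightarrow> real"
  assumes A: "finite A" "\<And>a. a \<in> A \<Longrightarrow> lo a \<le> hi a" "\<And>a. a \<in> A \<Longrightarrow> {lo a<..<hi a} \<subseteq> U"
    and disj: "disjoint_family_on (\<lambda>a. {lo a<..<hi a}) A" and U: "U \<in> lmeasurable" and h: "h \<ge> 0"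
    and P: "\<And>k. k \<in> {1..n} \<Longrightarrow> real (card {a\<in>A. hi a - lo a \<le> real k * h}) \<le> P k"
  shows "h * (\<Sum>k=1..n. real (card A) - P k) \<le> measure lebesgue U"
proof -
  \<comment> \<open>if \<open>q\<close> is the largest \<open>k\<close> that counts, the sum is at most \<open>q h < l\<close>\<close>
  have len: "(\<Sum>k=1..n. if real k * h < l then h else 0) \<le> l" if l: "l \<ge> 0" for l
  proof -
    define K where "K = {k\<in>{1..n}. real k * h < l}"
    have K: "finite K" by (simp add: K_def)
    have "(\<Sum>k=1..n. if real k * h < l then h else 0) = real (card K) * h"
      by (simp add: K_def sum.If_cases Int_def conj_commute)
    also have "\<dots> \<le> l"
    proof (cases "K = {}")
      case False
      define q where "q = Max K"
      have q: "q \<in> K" unfolding q_def using K False by (rule Max_in)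
      have "K \<subseteq> {1..q}" using K by (auto simp: q_def) (auto simp: K_def)
      hence "card K \<le> q" using card_mono[of "{1..q}" K] by simp
      hence "real (card K) * h \<le> real q * h" using h by (intro mult_right_mono) auto
      also have "\<dots> \<le> l" using q by (simp add: K_def)
      finally show ?thesis .
    qed (use l in simp)
    finally show ?thesis .
  qed
  have "h * (\<Sum>k=1..n. real (card A) - P k) \<le> h * (\<Sum>k=1..n. real (card {a\<in>A. real k * h < hi a - lo a}))"
  proof (intro mult_left_mono sum_mono h)
    fix k assume k: "k \<in> {1..n}"
    have "A = {a\<in>A. hi a - lo a \<le> real k * h} \<union> {a\<in>A. real k * h < hi a - lo a}" by auto
    hence "card A \<le> card {a\<in>A. hi a - lo a \<le> real k * h} + card {a\<in>A. real k * h < hi a - lo a}"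
      by (metis card_Un_le)
    thus "real (card A) - P k \<le> real (card {a\<in>A. real k * h < hi a - lo a})" using P[OF k] by linarith
  qed
  also have "\<dots> = (\<Sum>k=1..n. \<Sum>a\<in>A. if real k * h < hi a - lo a then h else 0)"
    unfolding sum_distrib_left using A(1)
    by (intro sum.cong refl) (simp add: sum.If_cases Int_def conj_commute mult.commute)
  also have "\<dots> = (\<Sum>a\<in>A. \<Sum>k=1..n. if real k * h < hi a - lo a then h else 0)" by (rule sum.swap)
  also have "\<dots> \<le> (\<Sum>a\<in>A. hi a - lo a)" using A(2) by (intro sum_mono len) auto
  also have "\<dots> = (\<Sum>a\<in>A. measure lebesgue {lo a<..<hi a})" using A(2) by (intro sum.cong) auto
  also have "\<dots> = measure lebesgue (\<Union>a\<in>A. {lo a<..<hi a})"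
    using A(1) disj by (intro measure_finite_Union[symmetric]) (auto simp: emeasure_lborel_Ioo A(2))
  also have "\<dots> \<le> measure lebesgue U"
    using A U by (intro measure_mono_fmeasurable) (auto intro!: sets.finite_UN)
  finally show ?thesis .
qed

definition close_pairs :: "real set \<Rightarrow> real \<Rightarrow> (real \<times> real) set" where
  "close_pairs S d = {(x, y) \<in> S \<times> S. x < y \<and> y - x \<le> d}"

definition gaps :: "real set \<Rightarrow> (real \<times> real) set" where
  "gaps S = {(x, y) \<in> S \<times> S. x < y \<and> S \<inter> {x<..<y} = {}}"

lemma finite_pairs: "finite S \<Longrightarrow> finite (close_pairs S d)" "finite S \<Longrightarrow> finite (gaps S)"
  by (rule finite_subset[of _ "S \<times> S"]; auto simp: close_pairs_def gaps_def)+

lemma gaps_disjoint: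
  assumes p: "p \<in> gaps S" and q: "q \<in> gaps S" and ne: "p \<noteq> q"
  shows "{fst p<..<snd p} \<inter> {fst q<..<snd q} = {}"
proof (rule ccontr)
  assume "\<not> ?thesis"
  then obtain t where "t \<in> {fst p<..<snd p}" "t \<in> {fst q<..<snd q}" by blast
  hence t: "fst p < t" "t < snd p" "fst q < t" "t < snd q" by auto
  have P: "fst p \<in> S" "snd p \<in> S" "\<And>s. s \<in> S \<Longrightarrow> \<not> (fst p < s \<and> s < snd p)" using p by (auto simp: gaps_def)
  have Q: "fst q \<in> S" "snd q \<in> S" "\<And>s. s \<in> S \<Longrightarrow> \<not> (fst q < s \<and> s < snd q)" using q by (auto simp: gaps_def)
  have "fst p = fst q" using P(3)[OF Q(1)] Q(3)[OF P(1)] t by linarith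
  moreover have "snd p = snd q" using P(3)[OF Q(2)] Q(3)[OF P(2)] t by linarith
  ultimately show False using ne by (simp add: prod_eq_iff)
qed

text \<open>
  A gap of length at most \<open>d\<close> is itself a close pair.
\<close>

lemma gaps_measure:
  assumes S: "finite S" and Q: "Q \<subseteq> gaps S" "\<And>x y. (x, y) \<in> Q \<Longrightarrow> {x<..<y} \<subseteq> U"
    and U: "U \<in> lmeasurable" and h: "h \<ge> 0"
  shows "h * (\<Sum>k=1..n. real (card Q) - real (card (close_pairs S (real k * h)))) \<le> measure lebesgue U"
proof (rule intervals_measure[where lo = fst and hi = snd])
  show "finite Q" using Q(1) finite_pairs(2)[OF S] by (rule finite_subset)
  show "fst p \<le> snd p" if "p \<in> Q" for p using Q(1) that by (auto simp: gaps_def)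
  show "{fst p<..<snd p} \<subseteq> U" if "p \<in> Q" for p using Q(2)[of "fst p" "snd p"] that by simp
  show "disjoint_family_on (\<lambda>p. {fst p<..<snd p}) Q"
    unfolding disjoint_family_on_def using Q(1) gaps_disjoint by blast
  show "real (card {p\<in>Q. snd p - fst p \<le> real k * h}) \<le> real (card (close_pairs S (real k * h)))" for k
    using Q(1) by (intro of_nat_mono card_mono finite_pairs S) (auto simp: gaps_def close_pairs_def)
qed (use U h in auto)

text \<open>
  Every point of \<open>S\<close> but the last is the left end of exactly one gap.
\<close>

lemma card_le_right_gaps:
  assumes S: "finite S" and A: "A \<subseteq> S" and Q: "finite Q" "\<And>x y. x \<in> A \<Longrightarrow> (x, y) \<in> gaps S \<Longrightarrow> (x, y) \<in> Q"
  shows "card A \<le> card Q + 1"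
proof -
  have "A - {Max S} \<subseteq> fst ` Q"
  proof
    fix a assume a: "a \<in> A - {Max S}"
    define y where "y = Min {s\<in>S. a < s}"
    have "a < Max S" using S A a by (metis DiffD1 DiffD2 Max_ge insertI1 order_le_less subsetD)
    hence "Max S \<in> {s\<in>S. a < s}" using S A a by (auto intro!: Max_in)
    hence y: "y \<in> {s\<in>S. a < s}" unfolding y_def using S by (intro Min_in) auto
    have "y \<le> s" if "s \<in> S" "a < s" for s unfolding y_def using S that by (intro Min_le) auto
    hence "(a, y) \<in> gaps S" using y A a by (force simp: gaps_def)
    thus "a \<in> fst ` Q" using Q(2)[of a y] a by force
  qed
  hence "card (A - {Max S}) \<le> card (fst ` Q)" using Q(1) by (intro card_mono) auto
  also have "\<dots> \<le> card Q" using Q(1) by (rule card_image_le)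
  finally show ?thesis using finite_subset[OF A S] by (auto simp: card_Diff_singleton_if split: if_splits)
qed

lemma card_le_left_gaps:
  assumes S: "finite S" and A: "A \<subseteq> S" and Q: "finite Q" "\<And>x y. y \<in> A \<Longrightarrow> (x, y) \<in> gaps S \<Longrightarrow> (x, y) \<in> Q"
  shows "card A \<le> card Q + 1"
proof -
  have "A - {Min S} \<subseteq> snd ` Q"
  proof
    fix a assume a: "a \<in> A - {Min S}"
    define x where "x = Max {s\<in>S. s < a}"
    have "Min S < a" using S A a by (metis DiffD1 DiffD2 Min_le insertI1 order_le_less subsetD)
    hence "Min S \<in> {s\<in>S. s < a}" using S A a by (auto intro!: Min_in)
    hence x: "x \<in> {s\<in>S. s < a}" unfolding x_def using S by (intro Max_in) auto
    have "s \<le> x" if "s \<in> S" "s < a" for s unfolding x_def using S that by (intro Max_ge) auto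
    hence "(x, a) \<in> gaps S" using x A a by (force simp: gaps_def)
    thus "a \<in> snd ` Q" using Q(2)[of a x] a by force
  qed
  hence "card (A - {Min S}) \<le> card (snd ` Q)" using Q(1) by (intro card_mono) auto
  also have "\<dots> \<le> card Q" using Q(1) by (rule card_image_le)
  finally show ?thesis using finite_subset[OF A S] by (auto simp: card_Diff_singleton_if split: if_splits)
qed

text \<open>
  The intermediate value theorem.
\<close>

lemma constant_sign:
  fixes f :: "real \<Rightarrow> real"
  assumes f: "continuous_on UNIV f" and nz: "\<And>t. a < t \<Longrightarrow> t < b \<Longrightarrow> f t \<noteq> 0"
    and s: "a < s" "s < b" "f s > 0" and t: "a < t" "t < b"
  shows "f t > 0"
proof (rule ccontr)
  assume "\<not> f t > 0"
  hence ft: "f t < 0" using nz[OF t] by linarith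
  have cn: "connected (f ` {a<..<b})"
    by (intro connected_continuous_image continuous_on_subset[OF f]) auto
  have "f t \<in> f ` {a<..<b}" "f s \<in> f ` {a<..<b}" using s t by auto
  hence "0 \<in> f ` {a<..<b}" using connectedD_interval[OF cn, of "f t" "f s" 0] ft s by auto
  thus False using nz by auto
qed

lemma RH_zeros_upto:
  assumes RH: Riemann_hypothesis and "\<rho> \<in> zeros_upto T"
  shows "\<rho> = Complex (1/2) (Im \<rho>)" "0 < Im \<rho>" "Im \<rho> \<le> T" "\<rho> \<in> nontrivial_zeros" "zeta \<rho> = 0"
  using assms by (auto simp: zeros_upto_def Riemann_hypothesis_def nontrivial_zeros_def complex_eq_iff)

lemma inj_on_Im_zeros: "Riemann_hypothesis \<Longrightarrow> inj_on Im (zeros_upto T)"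
  using RH_zeros_upto(1) by (intro inj_onI) metis

text \<open>
  The diagonal of \<open>pair_count 0 l\<close> is the sum of the squared multiplicities, and off
  the diagonal every pair of different ordinates has weight at least 1.
\<close>

lemma pair_count_lower:
  assumes RH: Riemann_hypothesis and T: "T > 1" and l: "l \<ge> 0"
  shows "(\<Sum>\<rho>\<in>zeros_upto T. real (zero_mult \<rho>)^2) + real (card (close_pairs (Im ` zeros_upto T) (2 * pi * l / ln T)))
          \<le> real (pair_count 0 l T)"
proof -
  define Z where "Z = zeros_upto T"
  define d where "d = 2 * pi * l / ln T"
  have fin: "finite Z" unfolding Z_def by (rule finite_zeros_upto[OF RH])
  have d: "d \<ge> 0" using T l by (simp add: d_def)
  define O1 where "O1 = {(\<rho>, \<rho>') \<in> Z \<times> Z. Im \<rho> < Im \<rho>' \<and> Im \<rho>' - Im \<rho> \<le> d}"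
  have finO: "finite O1" by (rule finite_subset[of _ "Z \<times> Z"]) (use fin in \<open>auto simp: O1_def\<close>)
  have "card (close_pairs (Im ` Z) d) \<le> card O1"
  proof (rule surj_card_le[OF finO, of _ "\<lambda>(x, y). (Im x, Im y)"])
    show "close_pairs (Im ` Z) d \<subseteq> (\<lambda>(x, y). (Im x, Im y)) ` O1"
      by (force simp: close_pairs_def O1_def)
  qed
  hence "(\<Sum>\<rho>\<in>Z. real (zero_mult \<rho>)^2) + real (card (close_pairs (Im ` Z) d)) \<le> (\<Sum>\<rho>\<in>Z. real (zero_mult \<rho>)^2) + real (card O1)"
    by simp
  also have "\<dots> \<le> (\<Sum>\<rho>\<in>Z. real (zero_mult \<rho>)^2) + (\<Sum>(\<rho>, \<rho>')\<in>O1. real (zero_mult \<rho> * zero_mult \<rho>'))"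
  proof -
    have "(\<Sum>(\<rho>, \<rho>')\<in>O1. (1::real)) \<le> (\<Sum>(\<rho>, \<rho>')\<in>O1. real (zero_mult \<rho> * zero_mult \<rho>'))"
    proof (rule sum_mono)
      fix p assume "p \<in> O1"
      then obtain \<rho> \<rho>' where p: "p = (\<rho>, \<rho>')" "\<rho> \<in> Z" "\<rho>' \<in> Z" by (auto simp: O1_def)
      have "zero_mult \<rho> \<ge> 1" "zero_mult \<rho>' \<ge> 1"
        using RH_zeros_upto(4)[OF RH] p(2,3) zeta_zero_factor(1) unfolding Z_def by blast+
      hence "1 * 1 \<le> zero_mult \<rho> * zero_mult \<rho>'" by (intro mult_mono) auto
      hence "real (1 * 1) \<le> real (zero_mult \<rho> * zero_mult \<rho>')" by (rule of_nat_mono)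
      thus "(case p of (\<rho>, \<rho>') \<Rightarrow> 1) \<le> (case p of (\<rho>, \<rho>') \<Rightarrow> real (zero_mult \<rho> * zero_mult \<rho>'))"
        unfolding p by simp
    qed
    thus ?thesis by (simp add: case_prod_unfold)
  qed
  also have "(\<Sum>\<rho>\<in>Z. real (zero_mult \<rho>)^2) + (\<Sum>(\<rho>, \<rho>')\<in>O1. real (zero_mult \<rho> * zero_mult \<rho>')) =
      (\<Sum>(\<rho>, \<rho>')\<in>(\<lambda>\<rho>. (\<rho>, \<rho>)) ` Z \<union> O1. real (zero_mult \<rho> * zero_mult \<rho>'))"
  proof -
    have "(\<Sum>\<rho>\<in>Z. real (zero_mult \<rho>)^2) = (\<Sum>(\<rho>, \<rho>')\<in>(\<lambda>\<rho>. (\<rho>, \<rho>)) ` Z. real (zero_mult \<rho> * zero_mult \<rho>'))"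
      by (subst sum.reindex) (auto simp: inj_on_def power2_eq_square)
    thus ?thesis using fin finO by (subst sum.union_disjoint) (auto simp: O1_def)
  qed
  also have "\<dots> \<le> (\<Sum>(\<rho>, \<rho>')\<in>{(\<rho>, \<rho>') \<in> Z \<times> Z. 2 * pi * 0 / ln T \<le> Im \<rho>' - Im \<rho> \<and> Im \<rho>' - Im \<rho> \<le> d}. real (zero_mult \<rho> * zero_mult \<rho>'))"
  proof (rule sum_mono2)
    show "finite {(\<rho>, \<rho>') \<in> Z \<times> Z. 2 * pi * 0 / ln T \<le> Im \<rho>' - Im \<rho> \<and> Im \<rho>' - Im \<rho> \<le> d}"
      by (rule finite_subset[of _ "Z \<times> Z"]) (use fin in auto)
  qed (use d in \<open>auto simp: O1_def\<close>)
  also have "\<dots> = real (pair_count 0 l T)"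
    unfolding pair_count_def Z_def d_def by (simp add: case_prod_unfold)
  finally show ?thesis by (simp add: Z_def d_def)
qed

text \<open>
  This sums the inequality \<open>2 m - m\<^sup>2 \<le> (if m = 1 then 1 else 0)\<close> for natural
  numbers \<open>m\<close>.
\<close>

lemma simple_zeros_lower:
  assumes RH: Riemann_hypothesis
  shows "2 * real (zero_count T) - (\<Sum>\<rho>\<in>zeros_upto T. real (zero_mult \<rho>)^2) \<le> real (card {\<rho>\<in>zeros_upto T. zero_mult \<rho> = 1})"
proof -
  have fin: "finite (zeros_upto T)" by (rule finite_zeros_upto[OF RH])
  have "2 * real (zero_count T) - (\<Sum>\<rho>\<in>zeros_upto T. real (zero_mult \<rho>)^2) =
    (\<Sum>\<rho>\<in>zeros_upto T. 2 * real (zero_mult \<rho>) - real (zero_mult \<rho>)^2)"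
    by (simp add: zero_count_def sum_subtractf sum_distrib_left)
  also have "\<dots> \<le> (\<Sum>\<rho>\<in>zeros_upto T. if zero_mult \<rho> = 1 then 1 else 0)"
  proof (rule sum_mono)
    fix \<rho> assume "\<rho> \<in> zeros_upto T"
    have "2 * real m - real m ^ 2 \<le> (if m = 1 then 1 else 0)" for m :: nat
    proof (cases "m \<le> 1")
      case False
      hence "2 * real m \<le> real m * real m" by (intro mult_right_mono) auto
      thus ?thesis using False by (simp add: power2_eq_square)
    qed (auto simp: le_Suc_eq)
    thus "2 * real (zero_mult \<rho>) - real (zero_mult \<rho>)^2 \<le> (if zero_mult \<rho> = 1 then 1 else 0)" .
  qed
  also have "\<dots> = real (card {\<rho>\<in>zeros_upto T. zero_mult \<rho> = 1})"
    using fin by (simp add: sum.If_cases Int_def conj_commute)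
  finally show ?thesis .
qed

lemma zero_count_le_squares:
  "real (zero_count T) \<le> (\<Sum>\<rho>\<in>zeros_upto T. real (zero_mult \<rho>)^2)"
proof -
  have "real m \<le> real m ^ 2" for m :: nat by (cases m) (auto simp: power2_eq_square)
  thus ?thesis by (simp add: zero_count_def sum_mono)
qed

text \<open>
  To the right of a simple zero the function \<open>f\<close> is either positive (the set
  \<open>A\<close>) or negative, and in the second case it is positive to the left (the set
  \<open>B\<close>). Elements of \<open>A\<close> are left ends of positive gaps and elements of
  \<open>B\<close> are right ends, with at most one exception each, so twice the number of positive
  gaps is at least the number of simple zeros minus 2. The factor \<open>e\<close> covers both signs
  of Hardy's function.
\<close>

lemma sign_set_measure:
  assumes RH: Riemann_hypothesis and h: "h \<ge> 0" and e: "e = 1 \<or> e = (-1::real)"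
  shows "h * (\<Sum>k=1..n. real (card {\<rho>\<in>zeros_upto T. zero_mult \<rho> = 1}) / 2 - 1 -
           real (card (close_pairs (Im ` zeros_upto T) (real k * h))))
         \<le> measure lebesgue {t. 0 < t \<and> t \<le> T \<and> e * hardy t > 0}"
proof -
  define S where "S = Im ` zeros_upto T"
  define U where "U = {t. 0 < t \<and> t \<le> T \<and> e * hardy t > 0}"
  define f where "f = (\<lambda>t. e * hardy t)"
  have e0: "e \<noteq> 0" using e by auto
  have f: "continuous_on UNIV f" unfolding f_def by (intro continuous_intros continuous_hardy)
  have S: "finite S" unfolding S_def by (intro finite_imageI finite_zeros_upto RH)
  have SI: "S \<subseteq> {0<..T}" unfolding S_def using RH_zeros_upto[OF RH] by auto
  have fS: "t \<in> S" if "f t = 0" "0 < t" "t \<le> T" for t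
  proof -
    have "zeta (Complex (1/2) t) = 0" using that e0 hardy_zero_iff[of t] by (simp add: f_def)
    hence "Complex (1/2) t \<in> zeros_upto T"
      using that by (auto simp: zeros_upto_def nontrivial_zeros_def complex_eq_iff)
    thus ?thesis unfolding S_def by (rule rev_image_eqI) simp
  qed
  have U: "U \<in> lmeasurable"
  proof (rule bounded_set_imp_lmeasurable)
    show "bounded U" by (rule bounded_subset[of "{0..T}"]) (auto simp: U_def)
    have "open {t. f t > 0}" using f by (intro open_Collect_less) auto
    hence "{t. f t > 0} \<inter> {0<..T} \<in> sets lebesgue" by (intro sets.Int) auto
    also have "{t. f t > 0} \<inter> {0<..T} = U" by (auto simp: U_def f_def)
    finally show "U \<in> sets lebesgue" .
  qed
  have gapU: "{x<..<y} \<subseteq> U" if g: "(x, y) \<in> gaps S" and s: "x < s" "s < y" "f s > 0" for x y s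
  proof
    fix t assume t: "t \<in> {x<..<y}"
    have xy: "0 < x" "y \<le> T" "S \<inter> {x<..<y} = {}" using g SI by (auto simp: gaps_def)
    have "f t > 0"
    proof (rule constant_sign[OF f, of x y s t])
      fix r assume r: "x < r" "r < y"
      show "f r \<noteq> 0" using fS[of r] r xy by auto
    qed (use s t in auto)
    thus "t \<in> U" using t xy by (auto simp: U_def f_def)
  qed
  define A where "A = {\<gamma>\<in>S. \<exists>d>0. \<forall>t. 0 < \<bar>t - \<gamma>\<bar> \<and> \<bar>t - \<gamma>\<bar> < d \<longrightarrow> (t - \<gamma>) * f t > 0}"
  define B where "B = {\<gamma>\<in>S. \<exists>d>0. \<forall>t. 0 < \<bar>t - \<gamma>\<bar> \<and> \<bar>t - \<gamma>\<bar> < d \<longrightarrow> (t - \<gamma>) * f t < 0}"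
  have A: "A \<subseteq> S" and B: "B \<subseteq> S" by (auto simp: A_def B_def)
  define N1 where "N1 = card {\<rho>\<in>zeros_upto T. zero_mult \<rho> = 1}"
  have "N1 \<le> card A + card B"
  proof -
    have "N1 = card (Im ` {\<rho>\<in>zeros_upto T. zero_mult \<rho> = 1})"
      unfolding N1_def by (intro card_image[symmetric] inj_on_subset[OF inj_on_Im_zeros[OF RH, of T]]) auto
    also have "\<dots> \<le> card (A \<union> B)"
    proof (rule card_mono)
      show "finite (A \<union> B)" using A B S by (auto intro: finite_subset)
      show "Im ` {\<rho>\<in>zeros_upto T. zero_mult \<rho> = 1} \<subseteq> A \<union> B"
      proof
        fix \<gamma> assume "\<gamma> \<in> Im ` {\<rho>\<in>zeros_upto T. zero_mult \<rho> = 1}"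
        then obtain \<rho> where \<rho>: "\<rho> \<in> zeros_upto T" "zero_mult \<rho> = 1" "\<gamma> = Im \<rho>" by auto
        have eq: "\<rho> = Complex (1/2) \<gamma>" using RH_zeros_upto(1)[OF RH \<rho>(1)] \<rho>(3) by simp
        have \<gamma>S: "\<gamma> \<in> S" using \<rho> by (auto simp: S_def)
        obtain d where d: "d > 0" "(\<forall>t. 0 < \<bar>t - \<gamma>\<bar> \<and> \<bar>t - \<gamma>\<bar> < d \<longrightarrow> (t - \<gamma>) * hardy t > 0) \<or>
                (\<forall>t. 0 < \<bar>t - \<gamma>\<bar> \<and> \<bar>t - \<gamma>\<bar> < d \<longrightarrow> (t - \<gamma>) * hardy t < 0)"
          using hardy_sign_change[of \<gamma>] RH_zeros_upto(2,4)[OF RH \<rho>(1)] \<rho>(2) unfolding eq by auto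
        have "(\<forall>t. 0 < \<bar>t - \<gamma>\<bar> \<and> \<bar>t - \<gamma>\<bar> < d \<longrightarrow> (t - \<gamma>) * f t > 0) \<or>
                (\<forall>t. 0 < \<bar>t - \<gamma>\<bar> \<and> \<bar>t - \<gamma>\<bar> < d \<longrightarrow> (t - \<gamma>) * f t < 0)"
          using e
        proof
          assume "e = 1"
          thus ?thesis using d(2) by (simp add: f_def)
        next
          assume "e = -1"
          thus ?thesis using d(2) by (simp add: f_def disj_commute)
        qed
        thus "\<gamma> \<in> A \<union> B" using d(1) \<gamma>S unfolding A_def B_def by blast
      qed
    qed
    also have "\<dots> \<le> card A + card B" by (rule card_Un_le)
    finally show ?thesis .
  qed
  moreover define Q where "Q = {(x, y) \<in> gaps S. {x<..<y} \<subseteq> U}"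
  have finQ: "finite Q" by (rule finite_subset[OF _ finite_pairs(2)[OF S]]) (auto simp: Q_def)
  moreover have "card A \<le> card Q + 1"
  proof (rule card_le_right_gaps[OF S A finQ])
    fix x y assume x: "x \<in> A" and g: "(x, y) \<in> gaps S"
    from x obtain d where d: "d > 0" "\<And>t. 0 < \<bar>t - x\<bar> \<Longrightarrow> \<bar>t - x\<bar> < d \<Longrightarrow> (t - x) * f t > 0" by (auto simp: A_def)
    define m where "m = min d (y - x)"
    have m: "0 < m" "m \<le> d" "m \<le> y - x" using d(1) g by (auto simp: m_def gaps_def)
    define s where "s = x + m / 2"
    have s: "x < s" "s < y" "\<bar>s - x\<bar> < d" using m by (auto simp: s_def)
    have "(s - x) * f s > 0" using d(2)[of s] s by auto
    hence "f s > 0" using s by (simp add: zero_less_mult_iff)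
    thus "(x, y) \<in> Q" using gapU[OF g s(1,2)] g by (simp add: Q_def)
  qed
  moreover have "card B \<le> card Q + 1"
  proof (rule card_le_left_gaps[OF S B finQ])
    fix x y assume y: "y \<in> B" and g: "(x, y) \<in> gaps S"
    from y obtain d where d: "d > 0" "\<And>t. 0 < \<bar>t - y\<bar> \<Longrightarrow> \<bar>t - y\<bar> < d \<Longrightarrow> (t - y) * f t < 0" by (auto simp: B_def)
    define m where "m = min d (y - x)"
    have m: "0 < m" "m \<le> d" "m \<le> y - x" using d(1) g by (auto simp: m_def gaps_def)
    define s where "s = y - m / 2"
    have s: "x < s" "s < y" "\<bar>s - y\<bar> < d" using m by (auto simp: s_def)
    have "(s - y) * f s < 0" using d(2)[of s] s by auto
    hence "f s > 0" using s by (simp add: mult_less_0_iff)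
    thus "(x, y) \<in> Q" using gapU[OF g s(1,2)] g by (simp add: Q_def)
  qed
  ultimately have "real N1 / 2 - 1 \<le> real (card Q)" by linarith
  hence "h * (\<Sum>k=1..n. real N1 / 2 - 1 - real (card (close_pairs S (real k * h)))) \<le>
      h * (\<Sum>k=1..n. real (card Q) - real (card (close_pairs S (real k * h))))"
    by (intro mult_left_mono sum_mono h) auto
  also have "\<dots> \<le> measure lebesgue U"
    by (rule gaps_measure[OF S _ _ U h]) (auto simp: Q_def)
  finally have "h * (\<Sum>k=1..n. real N1 / 2 - 1 - real (card (close_pairs S (real k * h)))) \<le> measure lebesgue U" .
  thus ?thesis unfolding N1_def S_def U_def .
qed

text \<open>
  The number of simple zeros is at least \<open>2 N - pair_count 0 \<delta> T\<close>, and the close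
  pairs number at most \<open>pair_count 0 l T - N\<close>. The spacing \<open>h\<close> is the
  normalized step \<open>l / n\<close> in units of \<open>2 \<pi> / ln T\<close>.
\<close>

lemma sign_measure_pair_count:
  assumes RH: Riemann_hypothesis and T: "T > 1" and l: "l \<ge> 0" "\<delta> \<ge> 0" and e: "e = 1 \<or> e = (-1::real)" and n: "n > 0"
  shows "2 * pi / ln T * (l / real n) * (\<Sum>k=1..n. 2 * real (zero_count T) - real (pair_count 0 \<delta> T) / 2 - 1 -
            real (pair_count 0 (real k * l / real n) T))
         \<le> measure lebesgue {t. 0 < t \<and> t \<le> T \<and> e * hardy t > 0}"
proof -
  let ?N = "real (zero_count T)" and ?p = "\<lambda>l. real (pair_count 0 l T)"
  define h where "h = 2 * pi / ln T * (l / real n)"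
  have h: "h \<ge> 0" using T l by (simp add: h_def)
  let ?sq = "\<Sum>\<rho>\<in>zeros_upto T. real (zero_mult \<rho>)^2"
  have "h * (\<Sum>k=1..n. 2 * ?N - ?p \<delta> / 2 - 1 - ?p (real k * l / real n)) \<le>
     h * (\<Sum>k=1..n. real (card {\<rho>\<in>zeros_upto T. zero_mult \<rho> = 1}) / 2 - 1 -
           real (card (close_pairs (Im ` zeros_upto T) (real k * h))))"
  proof (intro mult_left_mono sum_mono h)
    fix k
    have eq: "real k * h = 2 * pi * (real k * l / real n) / ln T" by (simp add: h_def mult_ac)
    have "?sq + real (card (close_pairs (Im ` zeros_upto T) (real k * h))) \<le> ?p (real k * l / real n)"
      unfolding eq by (rule pair_count_lower[OF RH T]) (use l in simp)
    moreover have "?sq \<le> ?p \<delta>" using pair_count_lower[OF RH T l(2)] by simp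
    moreover have "2 * ?N - ?sq \<le> real (card {\<rho>\<in>zeros_upto T. zero_mult \<rho> = 1})" by (rule simple_zeros_lower[OF RH])
    moreover have "?N \<le> ?sq" by (rule zero_count_le_squares)
    ultimately show "2 * ?N - ?p \<delta> / 2 - 1 - ?p (real k * l / real n) \<le>
      real (card {\<rho>\<in>zeros_upto T. zero_mult \<rho> = 1}) / 2 - 1 - real (card (close_pairs (Im ` zeros_upto T) (real k * h)))"
      by linarith
  qed
  also have "\<dots> \<le> measure lebesgue {t. 0 < t \<and> t \<le> T \<and> e * hardy t > 0}"
    by (rule sign_set_measure[OF RH h e])
  finally show ?thesis unfolding h_def .
qed

section \<open>The integrated pair density\<close>

definition pair_corr :: "real \<Rightarrow> real" where "pair_corr u = 1 - (sin (pi * u) / (pi * u))\<^sup>2"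

definition pair_int :: "real \<Rightarrow> real" where "pair_int x = integral {0..x} pair_corr"

lemma pair_corr_bounds: "0 \<le> pair_corr u" "pair_corr u \<le> 1"
proof -
  have "\<bar>sin (pi * u)\<bar> \<le> \<bar>pi * u\<bar>" by (rule abs_sin_x_le_abs_x)
  hence "(sin (pi * u))\<^sup>2 \<le> (pi * u)\<^sup>2" by (simp only: abs_le_square_iff)
  hence "(sin (pi * u))\<^sup>2 / (pi * u)\<^sup>2 \<le> 1" by (simp add: divide_le_eq)
  thus "0 \<le> pair_corr u" "pair_corr u \<le> 1" by (auto simp: pair_corr_def power_divide)
qed

text \<open>
  The integrand is continuous once its value at 0 is replaced by the limit 0.
\<close>

lemma pair_corr_integrable: "pair_corr integrable_on {a..b}"
proof -
  define g where "g = (\<lambda>u. if u = 0 then 0 else pair_corr u)"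
  have "continuous (at u) g" for u
  proof (cases "u = 0")
    case True
    have "((\<lambda>h. (sin (0 + h) - sin 0) / h) \<longlongrightarrow> cos 0) (at (0::real))"
      using DERIV_sin[of "0::real"] unfolding DERIV_def .
    hence "((\<lambda>h. sin h / h) \<longlongrightarrow> 1) (at (0::real))" by simp
    moreover have "filterlim (\<lambda>u. pi * u) (at 0) (at (0::real))"
      by (rule filterlim_atI) (auto intro!: tendsto_eq_intros simp: eventually_at_filter)
    ultimately have "((\<lambda>u. sin (pi * u) / (pi * u)) \<longlongrightarrow> 1) (at (0::real))"
      by (rule filterlim_compose)
    hence "((\<lambda>u. pair_corr u) \<longlongrightarrow> 1 - 1\<^sup>2) (at 0)" unfolding pair_corr_def by (intro tendsto_intros)
    hence "(pair_corr \<longlongrightarrow> 0) (at 0)" by simp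
    hence "(g \<longlongrightarrow> 0) (at 0)"
      by (rule Lim_transform_eventually) (auto simp: g_def eventually_at_filter)
    thus ?thesis using True by (simp add: continuous_at g_def)
  next
    case False
    have "isCont pair_corr u" unfolding pair_corr_def using False by (intro continuous_intros) auto
    moreover have "eventually (\<lambda>v. v \<noteq> 0) (nhds u)" using False by (rule t1_space_nhds)
    hence "eventually (\<lambda>v. pair_corr v = g v) (nhds u)" by eventually_elim (simp add: g_def)
    ultimately show ?thesis using isCont_cong by blast
  qed
  hence "continuous_on {a..b} g" by (intro continuous_at_imp_continuous_on) auto
  hence "g integrable_on {a..b}" by (rule integrable_continuous_interval)
  thus ?thesis by (rule integrable_spike[where S = "{0}"]) (auto simp: g_def)
qed

lemma pair_density_eq: "0 \<le> x \<Longrightarrow> pair_density 0 x = pair_int x + 1"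
  by (simp add: pair_density_def pair_int_def pair_corr_def[abs_def])

lemma pair_int_increment:
  assumes "0 \<le> x" "x \<le> y" shows "pair_int x \<le> pair_int y" "pair_int y \<le> pair_int x + (y - x)"
proof -
  have eq: "pair_int y = pair_int x + integral {x..y} pair_corr"
    unfolding pair_int_def using Henstock_Kurzweil_Integration.integral_combine[of 0 x y pair_corr] assms pair_corr_integrable by simp
  have "0 \<le> integral {x..y} pair_corr"
    by (rule Henstock_Kurzweil_Integration.integral_nonneg) (auto simp: pair_corr_integrable pair_corr_bounds)
  moreover have "integral {x..y} pair_corr \<le> integral {x..y} (\<lambda>_. 1)"
    by (rule integral_le) (auto simp: pair_corr_integrable pair_corr_bounds)
  hence "integral {x..y} pair_corr \<le> y - x" using assms by simp
  ultimately show "pair_int x \<le> pair_int y" "pair_int y \<le> pair_int x + (y - x)" unfolding eq by auto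
qed

lemma pair_int_nonneg: "0 \<le> x \<Longrightarrow> 0 \<le> pair_int x"
  using pair_int_increment(1)[of 0 x] by (simp add: pair_int_def)

lemma pair_int_integrable: "0 \<le> a \<Longrightarrow> pair_int integrable_on {a..b}"
proof -
  assume a: "0 \<le> a"
  have "continuous_on {a..b} pair_int"
  proof (rule continuous_on_subset)
    show "continuous_on {0..max a b} pair_int"
      unfolding pair_int_def by (rule indefinite_integral_continuous_1[OF pair_corr_integrable])
  qed (use a in auto)
  thus ?thesis by (rule integrable_continuous_interval)
qed

text \<open>
  The integrand lies between 0 and 1, so \<open>pair_int\<close> is increasing with slope at most 1,
  and the right Riemann sum exceeds the integral by at most \<open>h\<close> times the length.
\<close>

lemma pair_int_Riemann_sum:
  assumes h: "h \<ge> 0"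
  shows "h * (\<Sum>k=1..m. pair_int (real k * h)) \<le> integral {0..real m * h} pair_int + real m * h\<^sup>2"
proof (induction m)
  case (Suc m)
  let ?a = "real m * h" and ?b = "real (Suc m) * h"
  have ab: "0 \<le> ?a" "?a \<le> ?b" "?b - ?a = h" using h by (auto simp: algebra_simps)
  have "integral {?a..?b} (\<lambda>_. pair_int ?b - h) \<le> integral {?a..?b} pair_int"
  proof (rule integral_le)
    show "pair_int integrable_on {?a..?b}" by (rule pair_int_integrable[OF ab(1)])
    fix x assume x: "x \<in> {?a..?b}"
    have "0 \<le> x" using order_trans[OF ab(1)] x by auto
    hence "pair_int ?b \<le> pair_int x + (?b - x)" using x by (intro pair_int_increment) auto
    thus "pair_int ?b - h \<le> pair_int x" using x ab(3) by auto
  qed auto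
  hence "h * (pair_int ?b - h) \<le> integral {?a..?b} pair_int" using ab by simp
  moreover have "integral {0..?b} pair_int = integral {0..?a} pair_int + integral {?a..?b} pair_int"
    using ab by (intro Henstock_Kurzweil_Integration.integral_combine[symmetric] pair_int_integrable) auto
  ultimately show ?case using Suc.IH by (simp add: algebra_simps power2_eq_square)
qed simp

text \<open>
  With \<open>w = 2 \<pi> u\<close> the pair density is \<open>1 - 2 (1 - cos w) /
  w\<^sup>2\<close>. These are the coefficients of its power series up to \<open>w ^ 28\<close>,
  while the last one is the bound of the remainder: the remainder of the cosine after \<open>w ^
  30\<close> is at most \<open>w ^ 32 / fact 32\<close>.
\<close>

definition corr_coeff :: "nat \<Rightarrow> real" where "corr_coeff i = (if i = 15 then 2 / fact 32 else 2 * (-1) ^ (i + 1) / fact (2 * i + 2))"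

definition corr_poly :: "real \<Rightarrow> real" where "corr_poly w = (\<Sum>i=1..15. corr_coeff i * w ^ (2 * i))"
text \<open>
  The first and second antiderivatives of \<open>corr_poly\<close> that vanish at 0.
\<close>

definition corr_poly1 :: "real \<Rightarrow> real" where "corr_poly1 w = (\<Sum>i=1..15. corr_coeff i * w ^ (2 * i + 1) / real (2 * i + 1))"
definition corr_poly2 :: "real \<Rightarrow> real" where "corr_poly2 w = (\<Sum>i=1..15. corr_coeff i * w ^ (2 * i + 2) / (real (2 * i + 1) * real (2 * i + 2)))"

lemma cos_upper: fixes w :: real shows "cos w \<le> (\<Sum>j<16. (-1) ^ j * w ^ (2 * j) / fact (2 * j)) + w ^ 32 / fact (32::nat)"
proof -
  obtain t where t: "cos w = (\<Sum>m<32. cos_coeff m * w ^ m) + (cos (t + 1/2 * real 32 * pi) / fact 32) * w ^ 32"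
    using Maclaurin_cos_expansion[of w 32] by auto
  have "(\<Sum>m<32. cos_coeff m * w ^ m) = (\<Sum>j<16. (-1) ^ j * w ^ (2 * j) / fact (2 * j))"
    by (simp add: cos_coeff_def lessThan_nat_numeral lessThan_Suc)
  moreover have "(cos (t + 1/2 * real 32 * pi) / fact 32) * w ^ 32 \<le> w ^ 32 / fact (32::nat)"
    using mult_right_mono[of "cos (t + 1/2 * real 32 * pi)" 1 "w ^ 32 / fact 32"] cos_le_one by simp
  ultimately show ?thesis using t by simp
qed

lemma pair_corr_le_poly:
  assumes u: "u > 0" shows "pair_corr u \<le> corr_poly (2 * pi * u)"
proof -
  define w where "w = 2 * pi * u"
  have w: "w > 0" using u by (simp add: w_def)
  have "cos w = 1 - 2 * (sin (pi * u))\<^sup>2" using cos_double_sin[of "pi * u"] by (simp add: w_def mult_ac)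
  hence "(sin (pi * u) / (pi * u))\<^sup>2 = 2 * (1 - cos w) / w\<^sup>2"
    by (simp add: w_def power_divide power_mult_distrib)
  hence "w\<^sup>2 * pair_corr u = w\<^sup>2 - 2 + 2 * cos w" using w by (simp add: pair_corr_def field_simps)
  also have "\<dots> \<le> w\<^sup>2 - 2 + 2 * ((\<Sum>j<16. (-1) ^ j * w ^ (2 * j) / fact (2 * j)) + w ^ 32 / fact (32::nat))"
    using cos_upper[of w] by simp
  also have "\<dots> = w\<^sup>2 * corr_poly w"
  proof -
    define f where "f = (\<lambda>j::nat. (-1) ^ j * w ^ (2 * j) / fact (2 * j) :: real)"
    have "(\<Sum>j<Suc (Suc 14). f j) = f 0 + (f 1 + (\<Sum>j<14. f (Suc (Suc j))))"
      unfolding sum.lessThan_Suc_shift by simp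
    also have "(\<Sum>j<14. f (Suc (Suc j))) = (\<Sum>i=1..14. f (Suc i))"
      by (simp add: sum.atLeast1_atMost_eq)
    also have "f 0 + (f 1 + (\<Sum>i=1..14. f (Suc i))) = 1 - w\<^sup>2 / 2 + (\<Sum>i=1..14. (-1) ^ (i + 1) * w ^ (2 * i + 2) / fact (2 * i + 2))"
      by (simp add: f_def)
    also have "Suc (Suc 14) = 16" by simp
    finally have "(\<Sum>j<16. (-1) ^ j * w ^ (2 * j) / fact (2 * j)) = 1 - w\<^sup>2 / 2 + (\<Sum>i=1..14. (-1) ^ (i + 1) * w ^ (2 * i + 2) / fact (2 * i + 2))"
      unfolding f_def .
    moreover have "w\<^sup>2 * corr_poly w = (\<Sum>i=1..15. corr_coeff i * w ^ (2 * i + 2))"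
      unfolding corr_poly_def sum_distrib_left by (intro sum.cong refl) (simp add: power_add power2_eq_square)
    moreover have "{1..15::nat} = insert 15 {1..14}" by auto
    hence "(\<Sum>i=1..15. corr_coeff i * w ^ (2 * i + 2)) = 2 / fact 32 * w ^ 32 + (\<Sum>i=1..14. corr_coeff i * w ^ (2 * i + 2))"
      using power_add[of w 2 30] by (simp add: corr_coeff_def power2_eq_square mult.assoc)
    moreover have "(\<Sum>i=1..14. corr_coeff i * w ^ (2 * i + 2)) = 2 * (\<Sum>i=1..14. (-1) ^ (i + 1) * w ^ (2 * i + 2) / fact (2 * i + 2))"
      unfolding sum_distrib_left by (intro sum.cong refl) (simp add: corr_coeff_def)
    ultimately show ?thesis by simp
  qed
  finally have "w\<^sup>2 * pair_corr u \<le> w\<^sup>2 * corr_poly w" .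
  hence "pair_corr u \<le> corr_poly w" by (rule mult_left_le_imp_le) (use w in simp)
  thus ?thesis by (simp add: w_def)
qed

lemma monomial_antideriv:
  "((\<lambda>w::real. c * w ^ (n + 1) / real (n + 1)) has_real_derivative c * w ^ n) (at w)"
  by (rule DERIV_cong[OF DERIV_cdivide[OF DERIV_cmult[OF DERIV_pow]]]) simp

lemma corr_poly_antiderivs:
  "(corr_poly1 has_real_derivative corr_poly w) (at w)" "(corr_poly2 has_real_derivative corr_poly1 w) (at w)"
proof -
  show "(corr_poly1 has_real_derivative corr_poly w) (at w)"
    unfolding corr_poly1_def corr_poly_def by (intro DERIV_sum monomial_antideriv)
  have "((\<lambda>w. corr_coeff i * w ^ (2 * i + 2) / (real (2 * i + 1) * real (2 * i + 2))) has_real_derivative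
      corr_coeff i * w ^ (2 * i + 1) / real (2 * i + 1)) (at w)" for i
    using monomial_antideriv[of "corr_coeff i / real (2 * i + 1)" "2 * i + 1" w] by simp
  thus "(corr_poly2 has_real_derivative corr_poly1 w) (at w)"
    unfolding corr_poly2_def corr_poly1_def by (intro DERIV_sum)
qed

lemma pair_int_upper: "x \<ge> 0 \<Longrightarrow> pair_int x \<le> corr_poly1 (2 * pi * x) / (2 * pi)"
proof -
  assume x: "x \<ge> 0"
  define q where "q = (\<lambda>u. if u = 0 then 1 else corr_poly (2 * pi * u))"
  have "((\<lambda>u. corr_poly (2 * pi * u)) has_integral corr_poly1 (2 * pi * x) / (2 * pi) - corr_poly1 (2 * pi * 0) / (2 * pi)) {0..x}"
  proof (rule fundamental_theorem_of_calculus[OF x])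
    fix u
    have "((\<lambda>u. corr_poly1 (2 * pi * u) / (2 * pi)) has_real_derivative corr_poly (2 * pi * u) * (2 * pi) / (2 * pi)) (at u)"
      by (intro DERIV_cdivide DERIV_chain2[OF corr_poly_antiderivs(1)]) (auto intro!: derivative_eq_intros)
    thus "((\<lambda>u. corr_poly1 (2 * pi * u) / (2 * pi)) has_vector_derivative corr_poly (2 * pi * u)) (at u within {0..x})"
      using has_field_derivative_at_within has_real_derivative_iff_has_vector_derivative by fastforce
  qed
  moreover have "corr_poly1 (2 * pi * 0) = 0" by (simp add: corr_poly1_def)
  ultimately have 1: "((\<lambda>u. corr_poly (2 * pi * u)) has_integral corr_poly1 (2 * pi * x) / (2 * pi)) {0..x}" by simp
  have 2: "(q has_integral corr_poly1 (2 * pi * x) / (2 * pi)) {0..x}"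
    by (rule has_integral_spike[OF _ _ 1, of "{0}"]) (auto simp: q_def)
  have "pair_corr u \<le> q u" if "u \<in> {0..x}" for u
    using pair_corr_le_poly[of u] pair_corr_bounds(2)[of 0] that by (auto simp: q_def)
  thus ?thesis unfolding pair_int_def using has_integral_le[OF integrable_integral[OF pair_corr_integrable] 2] by blast
qed

lemma integral_pair_int_upper: "x \<ge> 0 \<Longrightarrow> integral {0..x} pair_int \<le> corr_poly2 (2 * pi * x) / (2 * pi)\<^sup>2"
proof -
  assume x: "x \<ge> 0"
  have "((\<lambda>u. corr_poly1 (2 * pi * u) / (2 * pi)) has_integral corr_poly2 (2 * pi * x) / (2 * pi)\<^sup>2 - corr_poly2 (2 * pi * 0) / (2 * pi)\<^sup>2) {0..x}"
  proof (rule fundamental_theorem_of_calculus[OF x])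
    fix u
    have "((\<lambda>u. corr_poly2 (2 * pi * u) / (2 * pi)\<^sup>2) has_real_derivative corr_poly1 (2 * pi * u) * (2 * pi) / (2 * pi)\<^sup>2) (at u)"
      by (intro DERIV_cdivide DERIV_chain2[OF corr_poly_antiderivs(2)]) (auto intro!: derivative_eq_intros)
    moreover have "corr_poly1 (2 * pi * u) * (2 * pi) / (2 * pi)\<^sup>2 = corr_poly1 (2 * pi * u) / (2 * pi)"
      by (simp add: power2_eq_square)
    ultimately show "((\<lambda>u. corr_poly2 (2 * pi * u) / (2 * pi)\<^sup>2) has_vector_derivative corr_poly1 (2 * pi * u) / (2 * pi)) (at u within {0..x})"
      using has_field_derivative_at_within has_real_derivative_iff_has_vector_derivative by fastforce
  qed
  moreover have "corr_poly2 (2 * pi * 0) = 0" by (simp add: corr_poly2_def)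
  ultimately have 1: "((\<lambda>u. corr_poly1 (2 * pi * u) / (2 * pi)) has_integral corr_poly2 (2 * pi * x) / (2 * pi)\<^sup>2) {0..x}" by simp
  show ?thesis
    by (rule has_integral_le[OF integrable_integral[OF pair_int_integrable] 1]) (auto intro: pair_int_upper)
qed

text \<open>
  At \<open>x = 3 / \<pi>\<close> the argument \<open>2 \<pi> x\<close> is 6, so only a rational
  number and powers of \<open>\<pi>\<close> have to be evaluated. The first term is the integral of
  the constant 1/2 over \<open>{0..3 / \<pi>}\<close>.
\<close>

lemma constant_lower_bound:
  "3 / (2 * pi) - integral {0..3 / pi} pair_int > 0.329093"
proof -
  have "integral {0..3 / pi} pair_int \<le> corr_poly2 6 / (2 * pi)\<^sup>2"
    using integral_pair_int_upper[of "3 / pi"] by simp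
  moreover have "corr_poly2 6 \<le> 5.857474"
    unfolding corr_poly2_def sum.atLeast1_atMost_eq One_nat_def
    by (simp add: lessThan_nat_numeral lessThan_Suc corr_coeff_def fact_numeral)
  ultimately have "integral {0..3 / pi} pair_int \<le> 5.857474 / (2 * pi)\<^sup>2"
    by (meson divide_right_mono order_trans zero_le_power2)
  moreover have "5.857474 / (2 * pi)\<^sup>2 \<le> 5.857474 / (2 * 3.141592653588)\<^sup>2"
    using pi_approx by (intro divide_left_mono power_mono mult_pos_pos) auto
  moreover have "3 / (2 * pi) \<ge> 3 / (2 * 3.1415926535899)"
    using pi_approx by (intro divide_left_mono) auto
  ultimately show ?thesis by (simp add: power2_eq_square)
qed

section \<open>The measure of the sign sets\<close>

lemma asymp_equiv_eventually_le:
  fixes f g :: "real \<Rightarrow> real"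
  assumes fg: "f \<sim>[at_top] g" and g: "eventually (\<lambda>x. g x > 0) at_top" and d: "\<delta> > 0"
  shows "eventually (\<lambda>x. f x \<le> (1 + \<delta>) * g x) at_top"
proof -
  have "((\<lambda>x. if f x = 0 \<and> g x = 0 then 1 else f x / g x) \<longlongrightarrow> 1) at_top"
    using fg by (simp add: asymp_equiv_def)
  hence "eventually (\<lambda>x. (if f x = 0 \<and> g x = 0 then 1 else f x / g x) < 1 + \<delta>) at_top"
    by (rule order_tendstoD(2)) (use d in simp)
  with g show ?thesis
  proof eventually_elim
    case (elim x)
    hence "f x / g x < 1 + \<delta>" by simp
    thus ?case using elim(1) by (simp add: divide_less_eq)
  qed
qed

lemma zero_count_at_top:
  assumes RH: Riemann_hypothesis
  shows "eventually (\<lambda>T. real (zero_count T) \<ge> K) at_top"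
proof -
  have "eventually (\<lambda>T. real (zero_count T) \<ge> (1 - 1/2) * (T * ln T / (2 * pi))) at_top"
    by (rule zero_count_lower_bound[OF RH]) simp
  moreover have "eventually (\<lambda>T. (1 - 1/2) * (T * ln T / (2 * pi)) \<ge> K) at_top"
  proof -
    have "filterlim (\<lambda>T::real. (1 - 1/2) * (T * ln T / (2 * pi))) at_top at_top" by real_asymp
    thus ?thesis by (simp add: filterlim_at_top)
  qed
  ultimately show ?thesis by eventually_elim linarith
qed

text \<open>
  Pair correlation with \<open>\<alpha> = 0\<close>: the interval contains 0, so the density has the
  additional 1 of the diagonal.
\<close>

lemma pair_count_eventually_le:
  assumes RH: Riemann_hypothesis and PC: pair_correlation_conjecture and l: "l > 0" and \<eta>: "\<eta> > 0"
  shows "eventually (\<lambda>T. real (pair_count 0 l T) \<le> (pair_int l + 1 + \<eta>) * real (zero_count T)) at_top"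
proof -
  have G: "pair_int l \<ge> 0" using l by (intro pair_int_nonneg) simp
  have pd: "pair_density 0 l = pair_int l + 1" using l by (intro pair_density_eq) simp
  have "(\<lambda>T. real (pair_count 0 l T)) \<sim>[at_top] (\<lambda>T. (pair_int l + 1) * real (zero_count T))"
    using PC l unfolding pair_correlation_conjecture_def pd[symmetric] by blast
  moreover have "eventually (\<lambda>T. (pair_int l + 1) * real (zero_count T) > 0) at_top"
    using zero_count_at_top[OF RH, of 1] by eventually_elim (use G in simp)
  ultimately have "eventually (\<lambda>T. real (pair_count 0 l T) \<le> (1 + \<eta> / (pair_int l + 1)) * ((pair_int l + 1) * real (zero_count T))) at_top"
    by (rule asymp_equiv_eventually_le) (use G \<eta> in simp)
  moreover have "(1 + \<eta> / (pair_int l + 1)) * (pair_int l + 1) = pair_int l + 1 + \<eta>" using G by (simp add: field_simps)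
  ultimately show ?thesis by (simp only: mult.assoc[symmetric])
qed

text \<open>
  Each summand in \<open>sign_measure_pair_count\<close> is at least \<open>(1/2 - 3 \<eta> -
  pair_int (k h)) N\<close> for large \<open>T\<close>, and \<open>h\<close> times the sum of the
  brackets approximates the integral of \<open>constant_lower_bound\<close> from below. The slack
  between 0.329093 and 0.32909 pays for the step width and for \<open>\<eta>\<close>.
\<close>

lemma sign_measure_eventually:
  assumes RH: Riemann_hypothesis and PC: pair_correlation_conjecture and e: "e = 1 \<or> e = (-1::real)"
  shows "eventually (\<lambda>T. measure lebesgue {t. 0 < t \<and> t \<le> T \<and> e * hardy t > 0} \<ge> 0.32909 * T) at_top"
proof -
  define l where "l = 3 / pi"
  define \<eta> :: real where "\<eta> = 1 / 10 ^ 7"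
  have \<eta>: "\<eta> > 0" by (simp add: \<eta>_def)
  have l: "0 < l" "l \<le> 1" using pi_gt3 by (auto simp: l_def)
  obtain n :: nat where n: "real n > 10 ^ 6" using reals_Archimedean2 by blast
  have n0: "n > 0" using n by (cases n) auto
  define h where "h = l / real n"
  have h: "h > 0" "real n * h = l" using l n0 by (auto simp: h_def)
  have C: "h * (\<Sum>k=1..n. 1/2 - 3 * \<eta> - pair_int (real k * h)) \<ge> 0.329091"
  proof -
    have "h * (\<Sum>k=1..n. pair_int (real k * h)) \<le> integral {0..real n * h} pair_int + real n * h\<^sup>2"
      using h by (intro pair_int_Riemann_sum) simp
    moreover have "real n * h\<^sup>2 \<le> 1 / 10 ^ 6"
    proof -
      have "real n * h\<^sup>2 = l * l / real n" using n0 by (simp add: h_def power2_eq_square)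
      also have "\<dots> \<le> 1 * 1 / 10 ^ 6" using l n by (intro frac_le mult_mono) auto
      finally show ?thesis by simp
    qed
    moreover have "h * (\<Sum>k=1..n. 1/2 - 3 * \<eta> - pair_int (real k * h)) = l / 2 - 3 * \<eta> * l - h * (\<Sum>k=1..n. pair_int (real k * h))"
    proof -
      have "(\<Sum>k=1..n. 1/2 - 3 * \<eta> - pair_int (real k * h)) = real n * (1/2 - 3 * \<eta>) - (\<Sum>k=1..n. pair_int (real k * h))"
        unfolding sum_subtractf[of "\<lambda>_. 1/2 - 3 * \<eta>"] by simp
      hence "h * (\<Sum>k=1..n. 1/2 - 3 * \<eta> - pair_int (real k * h)) = h * (real n * (1/2 - 3 * \<eta>) - (\<Sum>k=1..n. pair_int (real k * h)))"
        by (rule arg_cong)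
      also have "\<dots> = (real n * h) * (1/2 - 3 * \<eta>) - h * (\<Sum>k=1..n. pair_int (real k * h))"
        by (simp only: right_diff_distrib mult_ac)
      also have "(real n * h) * (1/2 - 3 * \<eta>) = l / 2 - 3 * \<eta> * l" unfolding h(2) by (simp add: right_diff_distrib)
      finally show ?thesis .
    qed
    moreover have "3 * \<eta> * l \<le> 3 * \<eta>" using l \<eta> by simp
    moreover have "l / 2 - integral {0..l} pair_int > 0.329093" using constant_lower_bound by (simp add: l_def)
    ultimately show ?thesis unfolding h(2) by (simp add: \<eta>_def)
  qed
  have "eventually (\<lambda>T. \<forall>k\<in>{1..n}. real (pair_count 0 (real k * h) T) \<le> (pair_int (real k * h) + 1 + \<eta>) * real (zero_count T)) at_top"
    using h \<eta> by (intro eventually_ball_finite ballI pair_count_eventually_le[OF RH PC]) auto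
  moreover have "eventually (\<lambda>T. real (pair_count 0 \<eta> T) \<le> (pair_int \<eta> + 1 + \<eta>) * real (zero_count T)) at_top"
    using \<eta> by (intro pair_count_eventually_le[OF RH PC])
  moreover have "eventually (\<lambda>T. real (zero_count T) \<ge> 1 / \<eta>) at_top" by (rule zero_count_at_top[OF RH])
  moreover have "eventually (\<lambda>T. real (zero_count T) \<ge> (1 - \<eta>) * (T * ln T / (2 * pi))) at_top"
    by (rule zero_count_lower_bound[OF RH \<eta>])
  moreover have "eventually (\<lambda>T::real. T > 1) at_top" by (rule eventually_gt_at_top)
  ultimately show ?thesis
  proof eventually_elim
    case (elim T)
    let ?N = "real (zero_count T)"
    have lnT: "ln T > 0" using elim(5) by simp
    have N1: "1 \<le> \<eta> * ?N" using elim(3) \<eta> by (simp add: field_simps)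
    have G\<eta>: "pair_int \<eta> \<le> \<eta>" using pair_int_increment(2)[of 0 \<eta>] \<eta> by (simp add: pair_int_def)
    have "0.32909 * T \<le> (1 - \<eta>) * T * 0.329091"
      using elim(5) by (simp add: \<eta>_def)
    also have "(1 - \<eta>) * T = 2 * pi / ln T * ((1 - \<eta>) * (T * ln T / (2 * pi)))" using lnT by simp
    also have "\<dots> * 0.329091 \<le> 2 * pi / ln T * ?N * 0.329091"
      using elim(4) lnT by (intro mult_right_mono mult_left_mono) auto
    also have "\<dots> \<le> 2 * pi / ln T * ?N * (h * (\<Sum>k=1..n. 1/2 - 3 * \<eta> - pair_int (real k * h)))"
      using C lnT by (intro mult_left_mono) auto
    also have "\<dots> = 2 * pi / ln T * h * (\<Sum>k=1..n. (1/2 - 3 * \<eta> - pair_int (real k * h)) * ?N)"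
      unfolding sum_distrib_right[symmetric] by simp
    also have "\<dots> \<le> 2 * pi / ln T * h * (\<Sum>k=1..n. 2 * ?N - real (pair_count 0 \<eta> T) / 2 - 1 - real (pair_count 0 (real k * l / real n) T))"
    proof (intro mult_left_mono sum_mono)
      fix k assume k: "k \<in> {1..n}"
      have eq: "real k * l / real n = real k * h" by (simp add: h_def)
      have "real (pair_count 0 (real k * h) T) \<le> (pair_int (real k * h) + 1 + \<eta>) * ?N" using elim(1) k by blast
      moreover have "real (pair_count 0 \<eta> T) \<le> (\<eta> + 1 + \<eta>) * ?N"
        by (rule order_trans[OF elim(2)]) (use G\<eta> in \<open>intro mult_right_mono; simp\<close>)
      ultimately show "(1/2 - 3 * \<eta> - pair_int (real k * h)) * ?N \<le> 2 * ?N - real (pair_count 0 \<eta> T) / 2 - 1 - real (pair_count 0 (real k * l / real n) T)"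
        unfolding eq using N1 by (simp add: algebra_simps)
    qed (use lnT h in auto)
    also have "\<dots> \<le> measure lebesgue {t. 0 < t \<and> t \<le> T \<and> e * hardy t > 0}"
      unfolding h_def using l \<eta> by (intro sign_measure_pair_count[OF RH elim(5) _ _ e n0]) auto
    finally show ?case .
  qed
qed

theorem theorem2:
  assumes "Riemann_hypothesis" and "pair_correlation_conjecture"
  shows "\<forall>\<^sub>F T in at_top. measure lebesgue (I_plus T) \<ge> 0.32909 * T \<and>
                         measure lebesgue (I_minus T) \<ge> 0.32909 * T"
proof -
  from sign_measure_eventually[OF assms, of 1] sign_measure_eventually[OF assms, of "-1"]
  show ?thesis by (simp add: I_plus_hardy I_minus_hardy eventually_conj)
qed

end
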